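(* Let $\mathbf{C}$ be a category with finite limits and coequalisers, such that coequalisers are preserved by the functors $C\times(-)$ for all $C\in\mathbf{C}$, and assume that $\mathbf{C}$ satisfies $\mathrm{OST}$. Let $G\in\mathrm{Grp}(\mathbf{C})$ and let $X$ be a $G$-graph in $\mathbf{C}$ such that the quotient map $q\colon X\to G\backslash X$ has a fixed section $s$ in $\mathrm{Graph}(\mathbf{C})$. Assume that the diagonal functor $\Delta\colon\mathrm{Grp}(\mathbf{C})\to\mathrm{Grp}(\mathrm{Graph}(\mathbf{C})_{/(G\backslash X)})$ has a left adjoint $\operatorname{colim}$, and let $\pi=\operatorname{colim}s^*G_X$ be the fundamental group of the graph of groups $s^*G_X$. If $X$ is connected, then the canonical map $\varphi\colon\pi\to G$ is regular epic in $\mathbf{C}$.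
   Context: Basic notation. $\mathrm{Grp}(\mathbf{C})$ is the category of group objects in $\mathbf{C}$, with structure maps $m_G,i_G,e_G$; $*$ is the terminal object. $\mathrm{Graph}(\mathbf{C})$ is the category of internal directed graphs $X=(d_0,d_1\colon EX\rightrightarrows VX)$, i.e. functors from the parallel-pair category to $\mathbf{C}$; limits and colimits are computed on $E$ and $V$ separately. An object $C$ of $\mathbf{C}$ is also regarded as the constant graph $(C\rightrightarrows C)$, so $C\times X=(C\times EX\rightrightarrows C\times VX)$. A $G$-object is an object $X$ with a left action $a\colon G\times X\to X$; a $G$-graph is a graph with $G$-actions on $EX$ and $VX$ for which $d_0,d_1$ are equivariant, so there is an action map $a\colon G\times X\to X$ in $\mathrm{Graph}(\mathbf{C})$. The quotient $q\colon X\to G\backslash X$ is the coequaliser of $a,\mathrm{pr}_X\colon G\times X\rightrightarrows X$. The stabiliser $G_X$ is the equaliser of $a,\mathrm{pr}_X\colon G\times X\rightrightarrows X$; with its map to $X$ it is a group object in the slice category over $X$, with multiplication induced by $m_G$. A graph $X$ is connected if the coequaliser of $d_0,d_1\colon EX\rightrightarrows VX$ is $*$. For a section $s\colon G\backslash X\to X$ of $q$, $s^*G_X$ is the pullback of $G_X\to X$ along $s$, a group object in the slice over $G\backslash X$. OST. $\mathbf{C}$ satisfies $\mathrm{OST}$ if for every $G\in\mathrm{Grp}(\mathbf{C})$ and every $G$-object $X\in\mathbf{C}$ the quotient $q\colon X\to G\backslash X$ exists and for every section $s\colon G\backslash X\to X$ of $q$ the diagram $G\times s^*G_X\rightrightarrows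 G\times(G\backslash X)\xrightarrow{a\circ(\mathrm{id}_G\times s)}X$ is a coequaliser in $\mathbf{C}$, where the two parallel maps are $\mathrm{id}_G\times(s^*G_X\to G\backslash X)$ and $G\times s^*G_X\to G\times G_X\to G\times G\times X\xrightarrow{m_G\times q}G\times(G\backslash X)$. Diagonal functor and $\varphi$. For $Q\in\mathrm{Graph}(\mathbf{C})$, $\Delta\colon\mathrm{Grp}(\mathbf{C})\to\mathrm{Grp}(\mathrm{Graph}(\mathbf{C})_{/Q})$ is $H\mapsto H\times Q=(H\times EQ\rightrightarrows H\times VQ)$. The canonical map $\varphi\colon\pi\to G$ is the adjoint of the composition $s^*G_X\to G_X\to G\times X\xrightarrow{\mathrm{id}\times q}G\times(G\backslash X)=\Delta(G)$. *)

theory Defs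
  imports Main
begin

section \<open>Categories\<close>

text \<open>
  Categories are presented by hom-sets.  The hom-sets need not be disjoint: an arrow of a slice
  category, or of a category of group objects, is just the underlying arrow.  For this reason
  operations on arrows that may depend on domain and codomain (the arrow part of a functor,
  pairings, ...) take the objects as arguments.
\<close>

record ('o, 'm) cat =
  Ob :: "'o set"
  Hom :: "'o \<Rightarrow> 'o \<Rightarrow> 'm set"
  idt :: "'o \<Rightarrow> 'm"
  cmp :: "'m \<Rightarrow> 'm \<Rightarrow> 'm"  (infixr "\<cdot>\<index>" 70)

locale category =
  fixes C :: "('o, 'm) cat" (structure)
  assumes hom_objects: "f \<in> Hom C A B \<Longrightarrow> A \<in> Ob C \<and> B \<in> Ob C"
    and idt_hom: "A \<in> Ob C \<Longrightarrow> idt C A \<in> Hom C A A"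
    and cmp_hom: "\<lbrakk>g \<in> Hom C B D; f \<in> Hom C A B\<rbrakk> \<Longrightarrow> g \<cdot> f \<in> Hom C A D"
    and idt_left: "f \<in> Hom C A B \<Longrightarrow> idt C B \<cdot> f = f"
    and idt_right: "f \<in> Hom C A B \<Longrightarrow> f \<cdot> idt C A = f"
    and cmp_assoc: "\<lbrakk>h \<in> Hom C D E; g \<in> Hom C B D; f \<in> Hom C A B\<rbrakk>
                      \<Longrightarrow> (h \<cdot> g) \<cdot> f = h \<cdot> (g \<cdot> f)"

record ('o, 'm, 'p, 'n) fnctor =
  FO :: "'o \<Rightarrow> 'p"
  FM :: "'o \<Rightarrow> 'o \<Rightarrow> 'm \<Rightarrow> 'n"

definition is_functor :: "('o, 'm) cat \<Rightarrow> ('p, 'n) cat \<Rightarrow> ('o, 'm, 'p, 'n) fnctor \<Rightarrow> bool" where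
  "is_functor A B F \<longleftrightarrow>
     (\<forall>X\<in>Ob A. FO F X \<in> Ob B \<and> FM F X X (idt A X) = idt B (FO F X)) \<and>
     (\<forall>X Y f. f \<in> Hom A X Y \<longrightarrow> FM F X Y f \<in> Hom B (FO F X) (FO F Y)) \<and>
     (\<forall>X Y Z f g. f \<in> Hom A X Y \<and> g \<in> Hom A Y Z \<longrightarrow>
        FM F X Z (g \<cdot>\<^bsub>A\<^esub> f) = FM F Y Z g \<cdot>\<^bsub>B\<^esub> FM F X Y f)"

text \<open>\<open>L\<close> is left adjoint to \<open>R\<close> by way of the natural bijections
  \<open>\<Phi> X Y : Hom B (L X) Y \<rightarrow> Hom A X (R Y)\<close>.\<close>

definition adjunction ::
  "('o, 'm) cat \<Rightarrow> ('p, 'n) cat \<Rightarrow> ('o, 'm, 'p, 'n) fnctor \<Rightarrow> ('p, 'n, 'o, 'm) fnctor \<Rightarrow>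
   ('o \<Rightarrow> 'p \<Rightarrow> 'n \<Rightarrow> 'm) \<Rightarrow> bool" where
  "adjunction A B L R \<Phi> \<longleftrightarrow>
     is_functor A B L \<and> is_functor B A R \<and>
     (\<forall>X\<in>Ob A. \<forall>Y\<in>Ob B. bij_betw (\<Phi> X Y) (Hom B (FO L X) Y) (Hom A X (FO R Y))) \<and>
     (\<forall>X X' Y Y' u v f. u \<in> Hom A X' X \<and> v \<in> Hom B Y Y' \<and> f \<in> Hom B (FO L X) Y \<longrightarrow>
        \<Phi> X' Y' (v \<cdot>\<^bsub>B\<^esub> f \<cdot>\<^bsub>B\<^esub> FM L X' X u) = FM R Y Y' v \<cdot>\<^bsub>A\<^esub> \<Phi> X Y f \<cdot>\<^bsub>A\<^esub> u)"


section \<open>Limits and colimits\<close>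

definition finite_category :: "('o, 'm) cat \<Rightarrow> bool" where
  "finite_category J \<longleftrightarrow> category J \<and> finite (Ob J) \<and> (\<forall>i j. finite (Hom J i j))"

definition is_cone ::
  "('i, 'a) cat \<Rightarrow> ('o, 'm) cat \<Rightarrow> ('i, 'a, 'o, 'm) fnctor \<Rightarrow> 'o \<Rightarrow> ('i \<Rightarrow> 'm) \<Rightarrow> bool" where
  "is_cone J C F L \<pi> \<longleftrightarrow>
     L \<in> Ob C \<and> (\<forall>i\<in>Ob J. \<pi> i \<in> Hom C L (FO F i)) \<and>
     (\<forall>i j f. f \<in> Hom J i j \<longrightarrow> FM F i j f \<cdot>\<^bsub>C\<^esub> \<pi> i = \<pi> j)"

definition is_limit ::
  "('i, 'a) cat \<Rightarrow> ('o, 'm) cat \<Rightarrow> ('i, 'a, 'o, 'm) fnctor \<Rightarrow> 'o \<Rightarrow> ('i \<Rightarrow> 'm) \<Rightarrow> bool" where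
  "is_limit J C F L \<pi> \<longleftrightarrow>
     is_cone J C F L \<pi> \<and>
     (\<forall>Z \<zeta>. is_cone J C F Z \<zeta> \<longrightarrow>
        (\<exists>!h. h \<in> Hom C Z L \<and> (\<forall>i\<in>Ob J. \<pi> i \<cdot>\<^bsub>C\<^esub> h = \<zeta> i)))"

text \<open>Every finite category is isomorphic to one whose objects and arrows are natural numbers.\<close>

definition has_finite_limits :: "('o, 'm) cat \<Rightarrow> bool" where
  "has_finite_limits C \<longleftrightarrow>
     (\<forall>(J :: (nat, nat) cat) F. finite_category J \<and> is_functor J C F \<longrightarrow> (\<exists>L \<pi>. is_limit J C F L \<pi>))"

definition is_terminal :: "('o, 'm) cat \<Rightarrow> 'o \<Rightarrow> bool" where
  "is_terminal C T \<longleftrightarrow> T \<in> Ob C \<and> (\<forall>A\<in>Ob C. \<exists>!f. f \<in> Hom C A T)"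

definition is_product :: "('o, 'm) cat \<Rightarrow> 'o \<Rightarrow> 'o \<Rightarrow> 'o \<Rightarrow> 'm \<Rightarrow> 'm \<Rightarrow> bool" where
  "is_product C A B P p q \<longleftrightarrow>
     p \<in> Hom C P A \<and> q \<in> Hom C P B \<and>
     (\<forall>Z f g. f \<in> Hom C Z A \<and> g \<in> Hom C Z B \<longrightarrow>
        (\<exists>!h. h \<in> Hom C Z P \<and> p \<cdot>\<^bsub>C\<^esub> h = f \<and> q \<cdot>\<^bsub>C\<^esub> h = g))"

definition is_equaliser ::
  "('o, 'm) cat \<Rightarrow> 'o \<Rightarrow> 'o \<Rightarrow> 'm \<Rightarrow> 'm \<Rightarrow> 'o \<Rightarrow> 'm \<Rightarrow> bool" where
  "is_equaliser C A B f g S k \<longleftrightarrow>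
     f \<in> Hom C A B \<and> g \<in> Hom C A B \<and> k \<in> Hom C S A \<and> f \<cdot>\<^bsub>C\<^esub> k = g \<cdot>\<^bsub>C\<^esub> k \<and>
     (\<forall>Z h. h \<in> Hom C Z A \<and> f \<cdot>\<^bsub>C\<^esub> h = g \<cdot>\<^bsub>C\<^esub> h \<longrightarrow>
        (\<exists>!u. u \<in> Hom C Z S \<and> k \<cdot>\<^bsub>C\<^esub> u = h))"

definition is_coequaliser ::
  "('o, 'm) cat \<Rightarrow> 'o \<Rightarrow> 'o \<Rightarrow> 'm \<Rightarrow> 'm \<Rightarrow> 'o \<Rightarrow> 'm \<Rightarrow> bool" where
  "is_coequaliser C A B f g Q q \<longleftrightarrow>
     f \<in> Hom C A B \<and> g \<in> Hom C A B \<and> q \<in> Hom C B Q \<and> q \<cdot>\<^bsub>C\<^esub> f = q \<cdot>\<^bsub>C\<^esub> g \<and>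
     (\<forall>Z h. h \<in> Hom C B Z \<and> h \<cdot>\<^bsub>C\<^esub> f = h \<cdot>\<^bsub>C\<^esub> g \<longrightarrow>
        (\<exists>!u. u \<in> Hom C Q Z \<and> u \<cdot>\<^bsub>C\<^esub> q = h))"

definition is_pullback ::
  "('o, 'm) cat \<Rightarrow> 'o \<Rightarrow> 'o \<Rightarrow> 'o \<Rightarrow> 'm \<Rightarrow> 'm \<Rightarrow> 'o \<Rightarrow> 'm \<Rightarrow> 'm \<Rightarrow> bool" where
  "is_pullback C A B D f g P p q \<longleftrightarrow>
     f \<in> Hom C A D \<and> g \<in> Hom C B D \<and> p \<in> Hom C P A \<and> q \<in> Hom C P B \<and>
     f \<cdot>\<^bsub>C\<^esub> p = g \<cdot>\<^bsub>C\<^esub> q \<and>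
     (\<forall>Z h k. h \<in> Hom C Z A \<and> k \<in> Hom C Z B \<and> f \<cdot>\<^bsub>C\<^esub> h = g \<cdot>\<^bsub>C\<^esub> k \<longrightarrow>
        (\<exists>!u. u \<in> Hom C Z P \<and> p \<cdot>\<^bsub>C\<^esub> u = h \<and> q \<cdot>\<^bsub>C\<^esub> u = k))"

definition has_coequalisers :: "('o, 'm) cat \<Rightarrow> bool" where
  "has_coequalisers C \<longleftrightarrow>
     (\<forall>A B f g. f \<in> Hom C A B \<and> g \<in> Hom C A B \<longrightarrow> (\<exists>Q q. is_coequaliser C A B f g Q q))"

definition regular_epi :: "('o, 'm) cat \<Rightarrow> 'o \<Rightarrow> 'o \<Rightarrow> 'm \<Rightarrow> bool" where
  "regular_epi C A B f \<longleftrightarrow> (\<exists>W u v. is_coequaliser C W A u v B f)"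


section \<open>Chosen finite products\<close>

definition product_cone :: "('o, 'm) cat \<Rightarrow> 'o \<Rightarrow> 'o \<Rightarrow> 'o \<times> 'm \<times> 'm" where
  "product_cone C A B = (SOME (P, p, q). is_product C A B P p q)"

definition prd :: "('o, 'm) cat \<Rightarrow> 'o \<Rightarrow> 'o \<Rightarrow> 'o" where
  "prd C A B = fst (product_cone C A B)"

definition pr1 :: "('o, 'm) cat \<Rightarrow> 'o \<Rightarrow> 'o \<Rightarrow> 'm" where
  "pr1 C A B = fst (snd (product_cone C A B))"

definition pr2 :: "('o, 'm) cat \<Rightarrow> 'o \<Rightarrow> 'o \<Rightarrow> 'm" where
  "pr2 C A B = snd (snd (product_cone C A B))"

text \<open>\<open>pair C Z A B f g : Z \<rightarrow> A \<times> B\<close> for \<open>f : Z \<rightarrow> A\<close> and \<open>g : Z \<rightarrow> B\<close>;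
  \<open>cross C A B A' B' f g : A \<times> B \<rightarrow> A' \<times> B'\<close> for \<open>f : A \<rightarrow> A'\<close> and \<open>g : B \<rightarrow> B'\<close>.\<close>

definition pair :: "('o, 'm) cat \<Rightarrow> 'o \<Rightarrow> 'o \<Rightarrow> 'o \<Rightarrow> 'm \<Rightarrow> 'm \<Rightarrow> 'm" where
  "pair C Z A B f g =
     (THE h. h \<in> Hom C Z (prd C A B) \<and> pr1 C A B \<cdot>\<^bsub>C\<^esub> h = f \<and> pr2 C A B \<cdot>\<^bsub>C\<^esub> h = g)"

definition cross :: "('o, 'm) cat \<Rightarrow> 'o \<Rightarrow> 'o \<Rightarrow> 'o \<Rightarrow> 'o \<Rightarrow> 'm \<Rightarrow> 'm \<Rightarrow> 'm" where
  "cross C A B A' B' f g =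
     pair C (prd C A B) A' B' (f \<cdot>\<^bsub>C\<^esub> pr1 C A B) (g \<cdot>\<^bsub>C\<^esub> pr2 C A B)"

text \<open>The canonical isomorphism \<open>A \<times> (B \<times> D) \<rightarrow> (A \<times> B) \<times> D\<close>.\<close>

definition assocl :: "('o, 'm) cat \<Rightarrow> 'o \<Rightarrow> 'o \<Rightarrow> 'o \<Rightarrow> 'm" where
  "assocl C A B D =
     (let W = prd C A (prd C B D); r = pr2 C A (prd C B D)
      in pair C W (prd C A B) D
           (pair C W A B (pr1 C A (prd C B D)) (pr1 C B D \<cdot>\<^bsub>C\<^esub> r))
           (pr2 C B D \<cdot>\<^bsub>C\<^esub> r))"

definition one :: "('o, 'm) cat \<Rightarrow> 'o" where
  "one C = (SOME T. is_terminal C T)"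

definition bang :: "('o, 'm) cat \<Rightarrow> 'o \<Rightarrow> 'm" where
  "bang C A = (THE f. f \<in> Hom C A (one C))"

definition products_preserve_coequalisers :: "('o, 'm) cat \<Rightarrow> bool" where
  "products_preserve_coequalisers C \<longleftrightarrow>
     (\<forall>D\<in>Ob C. \<forall>A B f g Q q. is_coequaliser C A B f g Q q \<longrightarrow>
        is_coequaliser C (prd C D A) (prd C D B)
          (cross C D A D B (idt C D) f) (cross C D A D B (idt C D) g)
          (prd C D Q) (cross C D B D Q (idt C D) q))"


section \<open>Group objects, actions and the condition OST\<close>

record ('o, 'm) grpobj =
  car :: 'o
  mul :: 'm
  unt :: 'm
  ivs :: 'm

definition is_group_object :: "('o, 'm) cat \<Rightarrow> ('o, 'm) grpobj \<Rightarrow> bool" where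
  "is_group_object C G \<longleftrightarrow>
     (let A = car G; m = mul G; e = unt G; i = ivs G; I = idt C A; u = e \<cdot>\<^bsub>C\<^esub> bang C A
      in A \<in> Ob C \<and> m \<in> Hom C (prd C A A) A \<and> e \<in> Hom C (one C) A \<and> i \<in> Hom C A A \<and>
         m \<cdot>\<^bsub>C\<^esub> cross C (prd C A A) A A A m I \<cdot>\<^bsub>C\<^esub> assocl C A A A
           = m \<cdot>\<^bsub>C\<^esub> cross C A (prd C A A) A A I m \<and>
         m \<cdot>\<^bsub>C\<^esub> pair C A A A u I = I \<and> m \<cdot>\<^bsub>C\<^esub> pair C A A A I u = I \<and>
         m \<cdot>\<^bsub>C\<^esub> pair C A A A i I = u \<and> m \<cdot>\<^bsub>C\<^esub> pair C A A A I i = u)"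

definition Grp :: "('o, 'm) cat \<Rightarrow> (('o, 'm) grpobj, 'm) cat" where
  "Grp C =
     \<lparr>Ob = {G. is_group_object C G},
      Hom = (\<lambda>G H. {f. is_group_object C G \<and> is_group_object C H \<and>
                        f \<in> Hom C (car G) (car H) \<and>
                        f \<cdot>\<^bsub>C\<^esub> mul G
                          = mul H \<cdot>\<^bsub>C\<^esub> cross C (car G) (car G) (car H) (car H) f f}),
      idt = (\<lambda>G. idt C (car G)),
      cmp = cmp C\<rparr>"

definition is_action :: "('o, 'm) cat \<Rightarrow> ('o, 'm) grpobj \<Rightarrow> 'o \<Rightarrow> 'm \<Rightarrow> bool" where
  "is_action C G X a \<longleftrightarrow>
     (let A = car G
      in X \<in> Ob C \<and> a \<in> Hom C (prd C A X) X \<and>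
         a \<cdot>\<^bsub>C\<^esub> pair C X A X (unt G \<cdot>\<^bsub>C\<^esub> bang C X) (idt C X) = idt C X \<and>
         a \<cdot>\<^bsub>C\<^esub> cross C (prd C A A) X A X (mul G) (idt C X) \<cdot>\<^bsub>C\<^esub> assocl C A A X
           = a \<cdot>\<^bsub>C\<^esub> cross C A (prd C A X) A X (idt C A) a)"

text \<open>
  In \<open>OST\<close> the quotient \<open>q : X \<rightarrow> Q\<close>, the stabiliser \<open>k : S \<rightarrow> G \<times> X\<close> and the
  pullback \<open>(P, \<sigma>, p)\<close> of \<open>S \<rightarrow> X\<close> along the section \<open>s\<close> range over all objects with the
  respective universal property.
\<close>

definition OST :: "('o, 'm) cat \<Rightarrow> bool" where
  "OST C \<longleftrightarrow>
     (\<forall>G\<in>Ob (Grp C). \<forall>X a. is_action C G X a \<longrightarrow>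
        (let A = car G; I = idt C A; GX = prd C A X
         in (\<exists>Q q. is_coequaliser C GX X a (pr2 C A X) Q q) \<and>
            (\<forall>Q q s S k P \<sigma> p.
               is_coequaliser C GX X a (pr2 C A X) Q q \<and>
               s \<in> Hom C Q X \<and> q \<cdot>\<^bsub>C\<^esub> s = idt C Q \<and>
               is_equaliser C GX X a (pr2 C A X) S k \<and>
               is_pullback C S Q X (pr2 C A X \<cdot>\<^bsub>C\<^esub> k) s P \<sigma> p \<longrightarrow>
               is_coequaliser C (prd C A P) (prd C A Q)
                 (cross C A P A Q I p)
                 (cross C (prd C A A) X A Q (mul G) q \<cdot>\<^bsub>C\<^esub> assocl C A A X
                    \<cdot>\<^bsub>C\<^esub> cross C A S A GX I k \<cdot>\<^bsub>C\<^esub> cross C A P A S I \<sigma>)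
                 X (a \<cdot>\<^bsub>C\<^esub> cross C A Q A X I s))))"


section \<open>Internal graphs\<close>

record ('o, 'm) graph =
  gE :: 'o
  gV :: 'o
  gd0 :: 'm
  gd1 :: 'm

definition Graph :: "('o, 'm) cat \<Rightarrow> (('o, 'm) graph, 'm \<times> 'm) cat" where
  "Graph C =
     \<lparr>Ob = {X. gd0 X \<in> Hom C (gE X) (gV X) \<and> gd1 X \<in> Hom C (gE X) (gV X)},
      Hom = (\<lambda>X Y. {(f, g). gd0 X \<in> Hom C (gE X) (gV X) \<and> gd1 X \<in> Hom C (gE X) (gV X) \<and>
                             gd0 Y \<in> Hom C (gE Y) (gV Y) \<and> gd1 Y \<in> Hom C (gE Y) (gV Y) \<and>
                             f \<in> Hom C (gE X) (gE Y) \<and> g \<in> Hom C (gV X) (gV Y) \<and>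
                             gd0 Y \<cdot>\<^bsub>C\<^esub> f = g \<cdot>\<^bsub>C\<^esub> gd0 X \<and>
                             gd1 Y \<cdot>\<^bsub>C\<^esub> f = g \<cdot>\<^bsub>C\<^esub> gd1 X}),
      idt = (\<lambda>X. (idt C (gE X), idt C (gV X))),
      cmp = (\<lambda>(g, g') (f, f'). (g \<cdot>\<^bsub>C\<^esub> f, g' \<cdot>\<^bsub>C\<^esub> f'))\<rparr>"

definition connected_graph :: "('o, 'm) cat \<Rightarrow> ('o, 'm) graph \<Rightarrow> bool" where
  "connected_graph C X \<longleftrightarrow>
     (\<exists>T t. is_terminal C T \<and> is_coequaliser C (gE X) (gV X) (gd0 X) (gd1 X) T t)"

text \<open>
  \<open>gtimes C A X\<close> is the product \<open>A \<times> X\<close> with the constant graph on \<open>A\<close>.  Arrows into a constant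
  graph, such as the first projection \<open>gpr1\<close>, are pairs of arrows into \<open>A\<close>;
  \<open>const_arr\<close>, \<open>gpair\<close> and \<open>gbang\<close> are arrows from constant graphs, into constant graphs on products
  and into the constant graph on the terminal object.
\<close>

definition gtimes :: "('o, 'm) cat \<Rightarrow> 'o \<Rightarrow> ('o, 'm) graph \<Rightarrow> ('o, 'm) graph" where
  "gtimes C A X =
     \<lparr>gE = prd C A (gE X), gV = prd C A (gV X),
      gd0 = cross C A (gE X) A (gV X) (idt C A) (gd0 X),
      gd1 = cross C A (gE X) A (gV X) (idt C A) (gd1 X)\<rparr>"

definition gpr1 :: "('o, 'm) cat \<Rightarrow> 'o \<Rightarrow> ('o, 'm) graph \<Rightarrow> 'm \<times> 'm" where
  "gpr1 C A X = (pr1 C A (gE X), pr1 C A (gV X))"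

definition gpr2 :: "('o, 'm) cat \<Rightarrow> 'o \<Rightarrow> ('o, 'm) graph \<Rightarrow> 'm \<times> 'm" where
  "gpr2 C A X = (pr2 C A (gE X), pr2 C A (gV X))"

definition gcross :: "('o, 'm) cat \<Rightarrow> 'o \<Rightarrow> ('o, 'm) graph \<Rightarrow> 'o \<Rightarrow> ('o, 'm) graph \<Rightarrow>
    'm \<Rightarrow> 'm \<times> 'm \<Rightarrow> 'm \<times> 'm" where
  "gcross C A X A' X' f h =
     (cross C A (gE X) A' (gE X') f (fst h), cross C A (gV X) A' (gV X') f (snd h))"

definition const_arr :: "'m \<Rightarrow> 'm \<times> 'm" where
  "const_arr f = (f, f)"

definition gpair :: "('o, 'm) cat \<Rightarrow> ('o, 'm) graph \<Rightarrow> 'o \<Rightarrow> 'o \<Rightarrow>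
    'm \<times> 'm \<Rightarrow> 'm \<times> 'm \<Rightarrow> 'm \<times> 'm" where
  "gpair C Z A B f g =
     (pair C (gE Z) A B (fst f) (fst g), pair C (gV Z) A B (snd f) (snd g))"

definition gbang :: "('o, 'm) cat \<Rightarrow> ('o, 'm) graph \<Rightarrow> 'm \<times> 'm" where
  "gbang C Z = (bang C (gE Z), bang C (gV Z))"

text \<open>The action map of a \<open>G\<close>-graph is the pair of the actions on edges and on vertices.\<close>

definition is_G_graph ::
  "('o, 'm) cat \<Rightarrow> ('o, 'm) grpobj \<Rightarrow> ('o, 'm) graph \<Rightarrow> 'm \<times> 'm \<Rightarrow> bool" where
  "is_G_graph C G X a \<longleftrightarrow>
     X \<in> Ob (Graph C) \<and> is_action C G (gE X) (fst a) \<and> is_action C G (gV X) (snd a) \<and>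
     gd0 X \<cdot>\<^bsub>C\<^esub> fst a
       = snd a \<cdot>\<^bsub>C\<^esub> cross C (car G) (gE X) (car G) (gV X) (idt C (car G)) (gd0 X) \<and>
     gd1 X \<cdot>\<^bsub>C\<^esub> fst a
       = snd a \<cdot>\<^bsub>C\<^esub> cross C (car G) (gE X) (car G) (gV X) (idt C (car G)) (gd1 X)"


section \<open>Slices and group objects over a graph\<close>

definition slice :: "('o, 'm) cat \<Rightarrow> 'o \<Rightarrow> ('o \<times> 'm, 'm) cat" where
  "slice D B =
     \<lparr>Ob = {(A, r). r \<in> Hom D A B},
      Hom = (\<lambda>(A, r) (A', r'). {h. r \<in> Hom D A B \<and> r' \<in> Hom D A' B \<and>
                                     h \<in> Hom D A A' \<and> r' \<cdot>\<^bsub>D\<^esub> h = r}),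
      idt = (\<lambda>(A, r). idt D A),
      cmp = cmp D\<rparr>"

text \<open>
  The group structure over the graph \<open>B\<close> induced on an object \<open>Z\<close> over \<open>B\<close> by a map \<open>\<gamma>\<close> from \<open>Z\<close> to
  the constant graph on \<open>G\<close>: multiplication, unit and inverse are the maps over \<open>B\<close> that \<open>\<gamma>\<close> carries
  to those of \<open>G\<close>.  It is only used when \<open>\<gamma>\<close> and the structure map of \<open>Z\<close> embed \<open>Z\<close> into \<open>G \<times> B\<close>
  as a subgroup over \<open>B\<close>, so that these maps exist and are unique.
\<close>

definition induced_grp ::
  "('o, 'm) cat \<Rightarrow> ('o, 'm) graph \<Rightarrow> ('o, 'm) grpobj \<Rightarrow> ('o, 'm) graph \<times> ('m \<times> 'm) \<Rightarrow> 'm \<times> 'm \<Rightarrow>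
   (('o, 'm) graph \<times> ('m \<times> 'm), 'm \<times> 'm) grpobj" where
  "induced_grp C B G Z \<gamma> =
     (let D = slice (Graph C) B; W = prd D Z Z; A = car G
      in \<lparr>car = Z,
          mul = (THE h. h \<in> Hom D W Z \<and>
                   \<gamma> \<cdot>\<^bsub>Graph C\<^esub> h
                     = const_arr (mul G) \<cdot>\<^bsub>Graph C\<^esub>
                       gpair C (fst W) A A (\<gamma> \<cdot>\<^bsub>Graph C\<^esub> pr1 D Z Z) (\<gamma> \<cdot>\<^bsub>Graph C\<^esub> pr2 D Z Z)),
          unt = (THE h. h \<in> Hom D (one D) Z \<and>
                   \<gamma> \<cdot>\<^bsub>Graph C\<^esub> h = const_arr (unt G) \<cdot>\<^bsub>Graph C\<^esub> gbang C (fst (one D))),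
          ivs = (THE h. h \<in> Hom D Z Z \<and> \<gamma> \<cdot>\<^bsub>Graph C\<^esub> h = const_arr (ivs G) \<cdot>\<^bsub>Graph C\<^esub> \<gamma>)\<rparr>)"

definition Delta ::
  "('o, 'm) cat \<Rightarrow> ('o, 'm) graph \<Rightarrow>
   (('o, 'm) grpobj, 'm, (('o, 'm) graph \<times> ('m \<times> 'm), 'm \<times> 'm) grpobj, 'm \<times> 'm) fnctor" where
  "Delta C Q =
     \<lparr>FO = (\<lambda>H. induced_grp C Q H (gtimes C (car H) Q, gpr2 C (car H) Q) (gpr1 C (car H) Q)),
      FM = (\<lambda>H K f. gcross C (car H) Q (car K) Q f (idt (Graph C) Q))\<rparr>"

text \<open>The stabiliser, for an equaliser \<open>k : S \<rightarrow> G \<times> X\<close> of the action and the projection, as a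
  group over \<open>X\<close>.\<close>

definition stabiliser_grp ::
  "('o, 'm) cat \<Rightarrow> ('o, 'm) grpobj \<Rightarrow> ('o, 'm) graph \<Rightarrow> ('o, 'm) graph \<Rightarrow> 'm \<times> 'm \<Rightarrow>
   (('o, 'm) graph \<times> ('m \<times> 'm), 'm \<times> 'm) grpobj" where
  "stabiliser_grp C G X S k =
     induced_grp C X G (S, gpr2 C (car G) X \<cdot>\<^bsub>Graph C\<^esub> k) (gpr1 C (car G) X \<cdot>\<^bsub>Graph C\<^esub> k)"

text \<open>The pullback along \<open>s : Q \<rightarrow> X\<close> of a group object \<open>H = (S \<rightarrow> X)\<close> over \<open>X\<close>, for a pullback
  \<open>(P, \<sigma> : P \<rightarrow> S, p : P \<rightarrow> Q)\<close> of \<open>S \<rightarrow> X\<close> along \<open>s\<close>.  An object \<open>(Z, r)\<close> over \<open>Q\<close> is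
  regarded as the object \<open>(Z, s \<cdot> r)\<close> over \<open>X\<close>.\<close>

definition pullback_grp ::
  "('o, 'm) cat \<Rightarrow> 'o \<Rightarrow> 'o \<Rightarrow> 'm \<Rightarrow> ('o \<times> 'm, 'm) grpobj \<Rightarrow> 'o \<Rightarrow> 'm \<Rightarrow> 'm \<Rightarrow>
   ('o \<times> 'm, 'm) grpobj" where
  "pullback_grp D Q X s H P \<sigma> p =
     (let DQ = slice D Q; DX = slice D X; Z = (P, p); W = prd DQ Z Z; T = one DQ;
          push = (\<lambda>(Y, r). (Y, s \<cdot>\<^bsub>D\<^esub> r))
      in \<lparr>car = Z,
          mul = (THE h. h \<in> Hom DQ W Z \<and>
                   \<sigma> \<cdot>\<^bsub>D\<^esub> h
                     = mul H \<cdot>\<^bsub>D\<^esub>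
                       pair DX (push W) (car H) (car H) (\<sigma> \<cdot>\<^bsub>D\<^esub> pr1 DQ Z Z) (\<sigma> \<cdot>\<^bsub>D\<^esub> pr2 DQ Z Z)),
          unt = (THE h. h \<in> Hom DQ T Z \<and>
                   \<sigma> \<cdot>\<^bsub>D\<^esub> h = unt H \<cdot>\<^bsub>D\<^esub> bang DX (push T)),
          ivs = (THE h. h \<in> Hom DQ Z Z \<and> \<sigma> \<cdot>\<^bsub>D\<^esub> h = ivs H \<cdot>\<^bsub>D\<^esub> \<sigma>)\<rparr>)"

text \<open>For an adjunction \<open>\<Phi>\<close> between \<open>colim\<close> and \<open>Delta C Q\<close>, the arrow \<open>colim \<Pi> \<rightarrow> G\<close>
  adjoint to \<open>\<psi> : \<Pi> \<rightarrow> G \<times> Q\<close>.\<close>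

definition adjoint_arrow ::
  "('p, 'n) cat \<Rightarrow> ('o, 'm, 'p, 'n) fnctor \<Rightarrow> ('o \<Rightarrow> 'p \<Rightarrow> 'n \<Rightarrow> 'm) \<Rightarrow> 'o \<Rightarrow> 'p \<Rightarrow> 'm \<Rightarrow> 'n" where
  "adjoint_arrow B L \<Phi> X Y \<psi> = the_inv_into (Hom B (FO L X) Y) (\<Phi> X Y) \<psi>"

end

theory Submission
  imports Defs
begin

text \<open>
  The idea is to show that \<open>\<pi>\<close> acts transitively on \<open>G\<close> through \<open>\<phi>\<close>, and to read off from this that
  \<open>\<phi>\<close> is a regular epimorphism.

  For the second part, let \<open>\<pi>\<close> act on \<open>G\<close> by left multiplication with \<open>\<phi>\<close>. If the quotient of this
  action is the terminal object, then the unit of \<open>G\<close> is a section of the quotient map, and the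
  condition \<open>OST\<close> for this action says that the orbit map of the unit, which is \<open>\<phi>\<close> itself, is a
  coequaliser (\<open>regular_epi_if_transitive\<close>).

  For the first part, one has to see that a function \<open>h\<close> on \<open>G\<close> that is invariant under the image of
  \<open>\<phi>\<close> is constant; by inversion in \<open>G\<close> it may be taken to be right invariant. By naturality of
  the adjunction, the embedding of \<open>s\<^sup>*G\<^sub>X\<close> into \<open>G \<times> Q\<close> is the unit of the adjunction followed by
  \<open>\<Delta> \<phi>\<close>. Hence \<open>h\<close> is invariant under the elements of \<open>s\<^sup>*G\<^sub>X\<close>. Applied to the action of \<open>G\<close> on the
  vertices of \<open>X\<close>, the condition \<open>OST\<close> says that such an \<open>h\<close>, regarded as a function on \<open>G \<times> V Q\<close>,
  descends to a function on the vertices of \<open>X\<close>. The descended function takes equal values at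
  the ends of each edge, because all edges are translates of edges in the image of \<open>s\<close> (this is
  \<open>OST\<close> for the action on edges). As \<open>X\<close> is connected, it is constant, and so is \<open>h\<close>
  (\<open>invariant_factors_through_point\<close>).

  To use the adjunction at all, one needs that \<open>s\<^sup>*G\<^sub>X\<close> is a group object over \<open>Q\<close> and that its
  embedding into \<open>G \<times> Q\<close> is a homomorphism. Both follow from the fact that the objects over \<open>Q\<close>
  in question represent subgroup functors of the functor that sends a graph to the group of its
  arrows into the constant graph of \<open>G\<close> (\<open>structure_group_object\<close>, \<open>structure_morphism\<close>).
  Group objects and actions are handled throughout by generalized elements
  (\<open>group_object_iff\<close>, \<open>action_iff\<close>).
\<close>

section \<open>Finite products and generalized elements\<close>

context category
begin

lemma hom_dom: "f \<in> Hom C A B \<Longrightarrow> A \<in> Ob C"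
  and hom_cod: "f \<in> Hom C A B \<Longrightarrow> B \<in> Ob C"
  using hom_objects by blast+

end

locale cartesian = category +
  assumes ex_terminal: "\<exists>T. is_terminal C T"
    and ex_product: "\<lbrakk>A \<in> Ob C; B \<in> Ob C\<rbrakk> \<Longrightarrow> \<exists>P p q. is_product C A B P p q"
begin

lemma one_terminal: "is_terminal C (one C)"
  unfolding one_def using ex_terminal by (rule someI_ex)

lemma one_ob: "one C \<in> Ob C"
  using one_terminal unfolding is_terminal_def by blast

lemma bang_hom: "A \<in> Ob C \<Longrightarrow> bang C A \<in> Hom C A (one C)"
  using one_terminal unfolding is_terminal_def bang_def by (metis (mono_tags, lifting) theI')

lemma bang_unique: "f \<in> Hom C A (one C) \<Longrightarrow> f = bang C A"
  using one_terminal bang_hom hom_dom unfolding is_terminal_def by metis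

lemma bang_cmp: "f \<in> Hom C A B \<Longrightarrow> bang C B \<cdot> f = bang C A"
  by (meson bang_unique bang_hom cmp_hom hom_cod)

lemma prd_is_product:
  assumes "A \<in> Ob C" "B \<in> Ob C"
  shows "is_product C A B (prd C A B) (pr1 C A B) (pr2 C A B)"
proof -
  have "\<exists>x. case x of (P, p, q) \<Rightarrow> is_product C A B P p q"
    using ex_product[OF assms] by auto
  from someI_ex[OF this] show ?thesis
    unfolding prd_def pr1_def pr2_def product_cone_def by (simp add: case_prod_unfold)
qed

lemma pr1_hom: "\<lbrakk>A \<in> Ob C; B \<in> Ob C\<rbrakk> \<Longrightarrow> pr1 C A B \<in> Hom C (prd C A B) A"
  and pr2_hom: "\<lbrakk>A \<in> Ob C; B \<in> Ob C\<rbrakk> \<Longrightarrow> pr2 C A B \<in> Hom C (prd C A B) B"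
  using prd_is_product unfolding is_product_def by blast+

lemma prd_ob: "\<lbrakk>A \<in> Ob C; B \<in> Ob C\<rbrakk> \<Longrightarrow> prd C A B \<in> Ob C"
  using pr1_hom hom_dom by blast

lemma
  assumes "f \<in> Hom C Z A" "g \<in> Hom C Z B"
  shows pair_hom: "pair C Z A B f g \<in> Hom C Z (prd C A B)"
    and pr1_pair: "pr1 C A B \<cdot> pair C Z A B f g = f"
    and pr2_pair: "pr2 C A B \<cdot> pair C Z A B f g = g"
proof -
  have "\<exists>!h. h \<in> Hom C Z (prd C A B) \<and> pr1 C A B \<cdot> h = f \<and> pr2 C A B \<cdot> h = g"
    using prd_is_product[of A B] assms hom_cod unfolding is_product_def by blast
  from theI'[OF this]
  show "pair C Z A B f g \<in> Hom C Z (prd C A B)"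
    "pr1 C A B \<cdot> pair C Z A B f g = f" "pr2 C A B \<cdot> pair C Z A B f g = g"
    unfolding pair_def by blast+
qed

lemma prd_eqI:
  assumes "A \<in> Ob C" "B \<in> Ob C" "u \<in> Hom C Z (prd C A B)" "v \<in> Hom C Z (prd C A B)"
    and "pr1 C A B \<cdot> u = pr1 C A B \<cdot> v" "pr2 C A B \<cdot> u = pr2 C A B \<cdot> v"
  shows "u = v"
proof -
  have "pr1 C A B \<cdot> v \<in> Hom C Z A" "pr2 C A B \<cdot> v \<in> Hom C Z B"
    using assms pr1_hom pr2_hom cmp_hom by blast+
  then show ?thesis
    using prd_is_product[of A B] assms unfolding is_product_def by metis
qed

lemma pair_unique:
  assumes "u \<in> Hom C Z (prd C A B)" "A \<in> Ob C" "B \<in> Ob C"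
    and "pr1 C A B \<cdot> u = f" "pr2 C A B \<cdot> u = g"
  shows "u = pair C Z A B f g"
proof -
  have "f \<in> Hom C Z A" "g \<in> Hom C Z B"
    using assms pr1_hom pr2_hom cmp_hom by blast+
  from pair_hom[OF this] pr1_pair[OF this] pr2_pair[OF this] show ?thesis
    using prd_eqI[OF assms(2,3,1)] assms(4,5) by simp
qed

lemma pair_cmp:
  assumes "f \<in> Hom C Z A" "g \<in> Hom C Z B" "h \<in> Hom C Y Z"
  shows "pair C Z A B f g \<cdot> h = pair C Y A B (f \<cdot> h) (g \<cdot> h)"
proof (rule pair_unique)
  note u = pair_hom[OF assms(1,2)]
  show o: "pair C Z A B f g \<cdot> h \<in> Hom C Y (prd C A B)" "A \<in> Ob C" "B \<in> Ob C"
    using assms cmp_hom u hom_cod by blast+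
  show "pr1 C A B \<cdot> pair C Z A B f g \<cdot> h = f \<cdot> h"
    "pr2 C A B \<cdot> pair C Z A B f g \<cdot> h = g \<cdot> h"
    using cmp_assoc[OF pr1_hom[OF o(2,3)] u assms(3)] cmp_assoc[OF pr2_hom[OF o(2,3)] u assms(3)]
      pr1_pair[OF assms(1,2)] pr2_pair[OF assms(1,2)] by simp_all
qed

lemma pair_eta:
  assumes "A \<in> Ob C" "B \<in> Ob C" "u \<in> Hom C Z (prd C A B)"
  shows "pair C Z A B (pr1 C A B \<cdot> u) (pr2 C A B \<cdot> u) = u"
  using pair_unique assms by metis

lemma cross_hom:
  assumes "f \<in> Hom C A A'" "g \<in> Hom C B B'"
  shows "cross C A B A' B' f g \<in> Hom C (prd C A B) (prd C A' B')"
  unfolding cross_def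
  by (rule pair_hom; rule cmp_hom; use assms hom_dom pr1_hom pr2_hom in blast)

lemma
  assumes "f \<in> Hom C A A'" "g \<in> Hom C B B'"
  shows pr1_cross: "pr1 C A' B' \<cdot> cross C A B A' B' f g = f \<cdot> pr1 C A B"
    and pr2_cross: "pr2 C A' B' \<cdot> cross C A B A' B' f g = g \<cdot> pr2 C A B"
proof -
  have "A \<in> Ob C" "B \<in> Ob C" using assms hom_dom by blast+
  then have "f \<cdot> pr1 C A B \<in> Hom C (prd C A B) A'" "g \<cdot> pr2 C A B \<in> Hom C (prd C A B) B'"
    using assms pr1_hom pr2_hom cmp_hom by blast+
  then show "pr1 C A' B' \<cdot> cross C A B A' B' f g = f \<cdot> pr1 C A B"
    "pr2 C A' B' \<cdot> cross C A B A' B' f g = g \<cdot> pr2 C A B"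
    unfolding cross_def by (rule pr1_pair pr2_pair)+
qed

lemma cross_pair:
  assumes "f \<in> Hom C A A'" "g \<in> Hom C B B'" "x \<in> Hom C Z A" "y \<in> Hom C Z B"
  shows "cross C A B A' B' f g \<cdot> pair C Z A B x y = pair C Z A' B' (f \<cdot> x) (g \<cdot> y)"
proof -
  have o: "A \<in> Ob C" "B \<in> Ob C" "A' \<in> Ob C" "B' \<in> Ob C" using assms hom_dom hom_cod by blast+
  note t = pr1_hom[OF o(1,2)] pr2_hom[OF o(1,2)] pair_hom[OF assms(3,4)]
  show ?thesis
    unfolding cross_def
    by (simp add: pair_cmp[OF cmp_hom[OF assms(1) t(1)] cmp_hom[OF assms(2) t(2)] t(3)]
        cmp_assoc[OF assms(1) t(1) t(3)] cmp_assoc[OF assms(2) t(2) t(3)]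
        pr1_pair[OF assms(3,4)] pr2_pair[OF assms(3,4)])
qed

lemma
  assumes "x \<in> Hom C Z A" "y \<in> Hom C Z B" "z \<in> Hom C Z D"
  shows assocl_hom: "assocl C A B D \<in> Hom C (prd C A (prd C B D)) (prd C (prd C A B) D)"
    and assocl_pair: "assocl C A B D \<cdot> pair C Z A (prd C B D) x (pair C Z B D y z)
           = pair C Z (prd C A B) D (pair C Z A B x y) z"
proof -
  have o: "A \<in> Ob C" "B \<in> Ob C" "D \<in> Ob C" using assms hom_cod by blast+
  define W where "W = prd C A (prd C B D)"
  define r where "r = pr2 C A (prd C B D)"
  have r: "r \<in> Hom C W (prd C B D)" and q1: "pr1 C A (prd C B D) \<in> Hom C W A"
    unfolding W_def r_def using o prd_ob pr1_hom pr2_hom by blast+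
  have r1: "pr1 C B D \<cdot> r \<in> Hom C W B" and r2: "pr2 C B D \<cdot> r \<in> Hom C W D"
    using r o pr1_hom pr2_hom cmp_hom by blast+
  note yz = pair_hom[OF assms(2,3)]
  define u where "u = pair C Z A (prd C B D) x (pair C Z B D y z)"
  have u: "u \<in> Hom C Z W" and u1: "pr1 C A (prd C B D) \<cdot> u = x" and u2: "r \<cdot> u = pair C Z B D y z"
    unfolding u_def W_def r_def
    using pair_hom[OF assms(1) yz] pr1_pair[OF assms(1) yz] pr2_pair[OF assms(1) yz] by blast+
  have d: "assocl C A B D
      = pair C W (prd C A B) D (pair C W A B (pr1 C A (prd C B D)) (pr1 C B D \<cdot> r)) (pr2 C B D \<cdot> r)"
    unfolding assocl_def Let_def W_def r_def by simp
  show "assocl C A B D \<in> Hom C (prd C A (prd C B D)) (prd C (prd C A B) D)"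
    unfolding d by (fold W_def) (intro pair_hom q1 r1 r2)
  have "(pr1 C B D \<cdot> r) \<cdot> u = y" "(pr2 C B D \<cdot> r) \<cdot> u = z"
    using u2 cmp_assoc[OF pr1_hom[OF o(2,3)] r u] cmp_assoc[OF pr2_hom[OF o(2,3)] r u]
      pr1_pair[OF assms(2,3)] pr2_pair[OF assms(2,3)] by simp_all
  then show "assocl C A B D \<cdot> pair C Z A (prd C B D) x (pair C Z B D y z)
           = pair C Z (prd C A B) D (pair C Z A B x y) z"
    unfolding d u_def[symmetric]
    using u1 by (simp add: pair_cmp[OF pair_hom[OF q1 r1] r2 u] pair_cmp[OF q1 r1 u])
qed

end

section \<open>Group objects and actions through generalized elements\<close>

definition elt_mul :: "('o, 'm) cat \<Rightarrow> ('o, 'm) grpobj \<Rightarrow> 'o \<Rightarrow> 'm \<Rightarrow> 'm \<Rightarrow> 'm" where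
  "elt_mul C G Z x y = mul G \<cdot>\<^bsub>C\<^esub> pair C Z (car G) (car G) x y"

definition elt_unt :: "('o, 'm) cat \<Rightarrow> ('o, 'm) grpobj \<Rightarrow> 'o \<Rightarrow> 'm" where
  "elt_unt C G Z = unt G \<cdot>\<^bsub>C\<^esub> bang C Z"

definition elt_act :: "('o, 'm) cat \<Rightarrow> ('o, 'm) grpobj \<Rightarrow> 'o \<Rightarrow> 'm \<Rightarrow> 'o \<Rightarrow> 'm \<Rightarrow> 'm \<Rightarrow> 'm" where
  "elt_act C G X a Z g x = a \<cdot>\<^bsub>C\<^esub> pair C Z (car G) X g x"

context cartesian
begin

lemma elt_mul_hom:
  "\<lbrakk>mul G \<in> Hom C (prd C (car G) (car G)) (car G); x \<in> Hom C Z (car G); y \<in> Hom C Z (car G)\<rbrakk>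
    \<Longrightarrow> elt_mul C G Z x y \<in> Hom C Z (car G)"
  unfolding elt_mul_def using cmp_hom pair_hom by blast

lemma elt_mul_cmp:
  assumes "mul G \<in> Hom C (prd C (car G) (car G)) (car G)"
    "x \<in> Hom C Z (car G)" "y \<in> Hom C Z (car G)" "h \<in> Hom C Y Z"
  shows "elt_mul C G Z x y \<cdot> h = elt_mul C G Y (x \<cdot> h) (y \<cdot> h)"
  unfolding elt_mul_def
  using cmp_assoc[OF assms(1) pair_hom[OF assms(2,3)] assms(4)] pair_cmp[OF assms(2,3,4)] by simp

lemma elt_unt_hom:
  "\<lbrakk>unt G \<in> Hom C (one C) (car G); Z \<in> Ob C\<rbrakk> \<Longrightarrow> elt_unt C G Z \<in> Hom C Z (car G)"
  unfolding elt_unt_def using cmp_hom bang_hom by blast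

lemma elt_unt_cmp:
  assumes "unt G \<in> Hom C (one C) (car G)" "h \<in> Hom C Y Z"
  shows "elt_unt C G Z \<cdot> h = elt_unt C G Y"
  unfolding elt_unt_def
  using cmp_assoc[OF assms(1) bang_hom[OF hom_cod[OF assms(2)]] assms(2)] bang_cmp[OF assms(2)]
  by simp

lemma elt_act_cmp:
  assumes "a \<in> Hom C (prd C (car G) X) X" "g \<in> Hom C Z (car G)" "x \<in> Hom C Z X" "h \<in> Hom C Y Z"
  shows "elt_act C G X a Z g x \<cdot> h = elt_act C G X a Y (g \<cdot> h) (x \<cdot> h)"
  unfolding elt_act_def
  using cmp_assoc[OF assms(1) pair_hom[OF assms(2,3)] assms(4)] pair_cmp[OF assms(2,3,4)] by simp

text \<open>
  An equation between arrows out of \<open>A \<times> (A \<times> X)\<close> holds as soon as it holds on all triples of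
  generalized elements, because the identity of \<open>A \<times> (A \<times> X)\<close> is itself such a triple. With \<open>X = A\<close>
  this serves the associativity of a group, otherwise that of an action.
\<close>

lemma assoc_law_iff:
  assumes f: "f \<in> Hom C (prd C A X) X" and m: "m \<in> Hom C (prd C A A) A"
  shows "f \<cdot> cross C (prd C A A) X A X m (idt C X) \<cdot> assocl C A A X
           = f \<cdot> cross C A (prd C A X) A X (idt C A) f
    \<longleftrightarrow> (\<forall>Z x y z. x \<in> Hom C Z A \<and> y \<in> Hom C Z A \<and> z \<in> Hom C Z X \<longrightarrow>
           f \<cdot> pair C Z A X (m \<cdot> pair C Z A A x y) z = f \<cdot> pair C Z A X x (f \<cdot> pair C Z A X y z))"
    (is "?l = ?r \<longleftrightarrow> ?el")
proof -
  have o: "A \<in> Ob C" "X \<in> Ob C" using f m hom_cod by blast+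
  define W where "W = prd C A (prd C A X)"
  have ax: "prd C A X \<in> Ob C" "prd C A A \<in> Ob C" using o prd_ob by blast+
  have c1: "cross C (prd C A A) X A X m (idt C X) \<in> Hom C (prd C (prd C A A) X) (prd C A X)"
    using m idt_hom[OF o(2)] by (rule cross_hom)
  have c2: "cross C A (prd C A X) A X (idt C A) f \<in> Hom C W (prd C A X)"
    unfolding W_def using idt_hom[OF o(1)] f by (rule cross_hom)
  have as: "assocl C A A X \<in> Hom C W (prd C (prd C A A) X)"
    unfolding W_def
    using assocl_hom o pr1_hom pr2_hom ax cmp_hom by metis
  have ev: "?l \<cdot> u = f \<cdot> pair C Z A X (m \<cdot> pair C Z A A x y) z \<and>
            ?r \<cdot> u = f \<cdot> pair C Z A X x (f \<cdot> pair C Z A X y z) \<and> u \<in> Hom C Z W"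
    if u: "u = pair C Z A (prd C A X) x (pair C Z A X y z)"
      and x: "x \<in> Hom C Z A" and y: "y \<in> Hom C Z A" and z: "z \<in> Hom C Z X" for Z x y z u
  proof -
    have uh: "u \<in> Hom C Z W" unfolding u W_def using pair_hom[OF x pair_hom[OF y z]] .
    have "?l \<cdot> u = f \<cdot> cross C (prd C A A) X A X m (idt C X) \<cdot> assocl C A A X \<cdot> u"
      using cmp_assoc[OF f cmp_hom[OF c1 as] uh] cmp_assoc[OF c1 as uh] by simp
    also have "assocl C A A X \<cdot> u = pair C Z (prd C A A) X (pair C Z A A x y) z"
      unfolding u using x y z by (rule assocl_pair)
    also have "cross C (prd C A A) X A X m (idt C X) \<cdot> \<dots>
        = pair C Z A X (m \<cdot> pair C Z A A x y) (idt C X \<cdot> z)"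
      using m idt_hom[OF o(2)] pair_hom[OF x y] z by (rule cross_pair)
    also have "idt C X \<cdot> z = z" using z by (rule idt_left)
    finally have 1: "?l \<cdot> u = f \<cdot> pair C Z A X (m \<cdot> pair C Z A A x y) z" .
    have "?r \<cdot> u = f \<cdot> cross C A (prd C A X) A X (idt C A) f \<cdot> u"
      using cmp_assoc[OF f c2 uh] .
    also have "cross C A (prd C A X) A X (idt C A) f \<cdot> u
        = pair C Z A X (idt C A \<cdot> x) (f \<cdot> pair C Z A X y z)"
      unfolding u using idt_hom[OF o(1)] f x pair_hom[OF y z] by (rule cross_pair)
    also have "idt C A \<cdot> x = x" using x by (rule idt_left)
    finally show ?thesis using 1 uh by blast
  qed
  show ?thesis
  proof
    assume eq: "?l = ?r"
    then show ?el using ev by metis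
  next
    assume el: ?el
    let ?r2 = "pr2 C A (prd C A X)"
    have t: "pr1 C A (prd C A X) \<in> Hom C W A" "?r2 \<in> Hom C W (prd C A X)"
      unfolding W_def using o ax pr1_hom pr2_hom by blast+
    have t2: "pr1 C A X \<cdot> ?r2 \<in> Hom C W A" "pr2 C A X \<cdot> ?r2 \<in> Hom C W X"
      using t o pr1_hom pr2_hom cmp_hom by blast+
    \<comment> \<open>The generic triple, whose components are the projections.\<close>
    have "pair C W A (prd C A X) (pr1 C A (prd C A X))
            (pair C W A X (pr1 C A X \<cdot> ?r2) (pr2 C A X \<cdot> ?r2)) = idt C W"
      unfolding pair_eta[OF o t(2)]
      using pair_unique[of "idt C W" W A "prd C A X"] idt_hom hom_dom[OF t(1)] o ax t idt_right W_def
      by metis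
    then have u: "idt C W = pair C W A (prd C A X) (pr1 C A (prd C A X))
            (pair C W A X (pr1 C A X \<cdot> ?r2) (pr2 C A X \<cdot> ?r2))" by simp
    have "?l \<cdot> idt C W = ?r \<cdot> idt C W"
      using ev[OF u t(1) t2] el t t2 by metis
    moreover have "?l \<in> Hom C W X" "?r \<in> Hom C W X"
      using f c1 c2 as cmp_hom by blast+
    ultimately show "?l = ?r" using idt_right by metis
  qed
qed

text \<open>
  The Yoneda description of group objects: the diagrams commute if and only if all sets
  \<open>Hom C Z (car G)\<close> satisfy the group laws. Every later computation in a group object, in \<open>C\<close> or in
  a slice, goes through this lemma and becomes a computation with elements.
\<close>

lemma group_object_iff:
  "is_group_object C G \<longleftrightarrow>
     car G \<in> Ob C \<and> mul G \<in> Hom C (prd C (car G) (car G)) (car G) \<and>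
     unt G \<in> Hom C (one C) (car G) \<and> ivs G \<in> Hom C (car G) (car G) \<and>
     (\<forall>Z x y z. x \<in> Hom C Z (car G) \<and> y \<in> Hom C Z (car G) \<and> z \<in> Hom C Z (car G) \<longrightarrow>
        elt_mul C G Z (elt_mul C G Z x y) z = elt_mul C G Z x (elt_mul C G Z y z)) \<and>
     (\<forall>Z x. x \<in> Hom C Z (car G) \<longrightarrow>
        elt_mul C G Z (elt_unt C G Z) x = x \<and> elt_mul C G Z x (elt_unt C G Z) = x \<and>
        elt_mul C G Z (ivs G \<cdot> x) x = elt_unt C G Z \<and>
        elt_mul C G Z x (ivs G \<cdot> x) = elt_unt C G Z)"
    (is "_ \<longleftrightarrow> ?o \<and> ?m \<and> ?e \<and> ?i \<and> ?assoc \<and> ?unit")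
proof -
  define A where "A = car G"
  let ?I = "idt C A"
  let ?ax = "mul G \<cdot> pair C A A A (unt G \<cdot> bang C A) ?I = ?I \<and>
      mul G \<cdot> pair C A A A ?I (unt G \<cdot> bang C A) = ?I \<and>
      mul G \<cdot> pair C A A A (ivs G) ?I = unt G \<cdot> bang C A \<and>
      mul G \<cdot> pair C A A A ?I (ivs G) = unt G \<cdot> bang C A"
  have unit: "?unit \<longleftrightarrow> ?ax" if h: ?o ?m ?e ?i
  proof -
    note h' = h[folded A_def]
    have I: "?I \<in> Hom C A A" using h'(1) idt_hom by blast
    have u: "elt_unt C G A \<in> Hom C A A" using elt_unt_hom h' A_def by simp
    show ?thesis
    proof
      assume ?unit
      then have "elt_mul C G A (elt_unt C G A) ?I = ?I \<and> elt_mul C G A ?I (elt_unt C G A) = ?I \<and>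
        elt_mul C G A (ivs G \<cdot> ?I) ?I = elt_unt C G A \<and>
        elt_mul C G A ?I (ivs G \<cdot> ?I) = elt_unt C G A"
        using I unfolding A_def by blast
      then show ?ax
        unfolding elt_mul_def elt_unt_def A_def[symmetric] using idt_right[OF h'(4)] by simp
    next
      assume ax: ?ax
      have ax': "elt_mul C G A (elt_unt C G A) ?I = ?I" "elt_mul C G A ?I (elt_unt C G A) = ?I"
        "elt_mul C G A (ivs G) ?I = elt_unt C G A" "elt_mul C G A ?I (ivs G) = elt_unt C G A"
        using ax unfolding elt_mul_def elt_unt_def A_def[symmetric] by simp_all
      show ?unit
      proof (intro allI impI)
        fix Z x assume x: "x \<in> Hom C Z (car G)"
        note c = elt_mul_cmp[OF h(2), folded A_def, OF _ _ x[folded A_def]]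
        note uc = elt_unt_cmp[OF h(3) x, folded A_def]
        note Ix = idt_left[OF x, folded A_def]
        show "elt_mul C G Z (elt_unt C G Z) x = x \<and> elt_mul C G Z x (elt_unt C G Z) = x \<and>
          elt_mul C G Z (ivs G \<cdot> x) x = elt_unt C G Z \<and>
          elt_mul C G Z x (ivs G \<cdot> x) = elt_unt C G Z"
          using c[OF u I] c[OF I u] c[OF h'(4) I] c[OF I h'(4)] uc Ix ax' by metis
      qed
    qed
  qed
  show ?thesis
    unfolding is_group_object_def Let_def
    using unit assoc_law_iff[of "mul G" A A "mul G"]
    unfolding A_def elt_mul_def by blast
qed

lemma action_iff:
  assumes G: "is_group_object C G"
  shows "is_action C G X a \<longleftrightarrow>
     X \<in> Ob C \<and> a \<in> Hom C (prd C (car G) X) X \<and>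
     (\<forall>Z x. x \<in> Hom C Z X \<longrightarrow> elt_act C G X a Z (elt_unt C G Z) x = x) \<and>
     (\<forall>Z g h x. g \<in> Hom C Z (car G) \<and> h \<in> Hom C Z (car G) \<and> x \<in> Hom C Z X \<longrightarrow>
        elt_act C G X a Z (elt_mul C G Z g h) x = elt_act C G X a Z g (elt_act C G X a Z h x))"
    (is "_ \<longleftrightarrow> ?X \<and> ?a \<and> ?unit \<and> ?mul")
proof -
  have g: "mul G \<in> Hom C (prd C (car G) (car G)) (car G)" "unt G \<in> Hom C (one C) (car G)"
    using G unfolding group_object_iff by blast+
  have unit: "?unit \<longleftrightarrow> a \<cdot> pair C X (car G) X (unt G \<cdot> bang C X) (idt C X) = idt C X"
    if h: ?X ?a
  proof
    assume ?unit
    then show "a \<cdot> pair C X (car G) X (unt G \<cdot> bang C X) (idt C X) = idt C X"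
      using idt_hom[OF h(1)] unfolding elt_act_def elt_unt_def by blast
  next
    assume ax: "a \<cdot> pair C X (car G) X (unt G \<cdot> bang C X) (idt C X) = idt C X"
    show ?unit
    proof (intro allI impI)
      fix Z x assume x: "x \<in> Hom C Z X"
      have "elt_act C G X a X (elt_unt C G X) (idt C X) \<cdot> x = x"
        using ax idt_left[OF x] unfolding elt_act_def elt_unt_def by simp
      then show "elt_act C G X a Z (elt_unt C G Z) x = x"
        using elt_act_cmp[OF h(2) elt_unt_hom[OF g(2) h(1)] idt_hom[OF h(1)] x]
          elt_unt_cmp[OF g(2) x] idt_left[OF x] by simp
    qed
  qed
  show ?thesis
    unfolding is_action_def Let_def
    using unit assoc_law_iff[of a "car G" X "mul G"] g(1)
    unfolding elt_mul_def elt_act_def by blast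
qed

end

section \<open>Limits obtained from finite diagrams\<close>

context category
begin

lemma finite_limits_terminal:
  assumes "has_finite_limits C"
  shows "\<exists>T. is_terminal C T"
proof -
  let ?J = "\<lparr>Ob = {}, Hom = \<lambda>_ _. {}, idt = \<lambda>_. 0, cmp = \<lambda>_ _. 0\<rparr> :: (nat, nat) cat"
  let ?F = "\<lparr>FO = \<lambda>_. undefined, FM = \<lambda>_ _ _. undefined\<rparr> :: (nat, nat, 'o, 'm) fnctor"
  have "finite_category ?J" "is_functor ?J C ?F"
    unfolding finite_category_def is_functor_def by (auto intro!: category.intro)
  then obtain T \<pi> where "is_limit ?J C ?F T \<pi>"
    using assms unfolding has_finite_limits_def by blast
  then have "is_terminal C T"
    unfolding is_limit_def is_cone_def is_terminal_def by simp
  then show ?thesis by blast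
qed

text \<open>
  The diagram is the discrete category on the objects \<open>0\<close> and \<open>1\<close>; the number \<open>0\<close> names both of its
  identities.
\<close>

lemma finite_limits_product:
  assumes "has_finite_limits C" "A \<in> Ob C" "B \<in> Ob C"
  shows "\<exists>P p q. is_product C A B P p q"
proof -
  let ?J = "\<lparr>Ob = {0, 1}, Hom = \<lambda>i j. if i = j \<and> i \<in> {0, 1} then {0} else {},
    idt = \<lambda>_. 0, cmp = \<lambda>_ _. 0\<rparr> :: (nat, nat) cat"
  let ?O = "\<lambda>i::nat. if i = 0 then A else B"
  let ?F = "\<lparr>FO = ?O, FM = \<lambda>i _ _. idt C (?O i)\<rparr> :: (nat, nat, 'o, 'm) fnctor"
  have "finite_category ?J"
    unfolding finite_category_def by (auto intro!: category.intro split: if_splits)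
  moreover have "is_functor ?J C ?F"
    unfolding is_functor_def using assms idt_hom idt_left[OF idt_hom]
    by (auto split: if_splits)
  ultimately obtain P \<pi> where lim: "is_limit ?J C ?F P \<pi>"
    using assms unfolding has_finite_limits_def by blast
  have cone: "is_cone ?J C ?F Z \<zeta> \<longleftrightarrow> \<zeta> 0 \<in> Hom C Z A \<and> \<zeta> 1 \<in> Hom C Z B" for Z \<zeta>
    unfolding is_cone_def using hom_dom idt_left by (auto split: if_splits)
  have "is_product C A B P (\<pi> 0) (\<pi> 1)"
    unfolding is_product_def
  proof (intro conjI allI impI)
    show "\<pi> 0 \<in> Hom C P A" "\<pi> 1 \<in> Hom C P B"
      using lim cone unfolding is_limit_def by blast+
    fix Z f g assume fg: "f \<in> Hom C Z A \<and> g \<in> Hom C Z B"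
    let ?z = "\<lambda>i::nat. if i = 0 then f else g"
    have "is_cone ?J C ?F Z ?z" using fg cone[of Z ?z] by simp
    then have "\<exists>!h. h \<in> Hom C Z P \<and> (\<forall>i\<in>Ob ?J. \<pi> i \<cdot> h = ?z i)"
      using lim unfolding is_limit_def by blast
    then show "\<exists>!h. h \<in> Hom C Z P \<and> \<pi> 0 \<cdot> h = f \<and> \<pi> 1 \<cdot> h = g" by simp
  qed
  then show ?thesis by blast
qed

text \<open>
  The diagram is the parallel pair: the arrows \<open>1\<close> and \<open>2\<close> lead from the object \<open>0\<close> to the object
  \<open>1\<close>, and all identities are called \<open>0\<close>, so that composition is addition.
\<close>

lemma finite_limits_equaliser:
  assumes "has_finite_limits C" "f \<in> Hom C A B" "g \<in> Hom C A B"
  shows "\<exists>S k. is_equaliser C A B f g S k"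
proof -
  let ?J = "\<lparr>Ob = {0, 1},
    Hom = \<lambda>i j. if i = j \<and> i \<in> {0, 1} then {0} else if i = 0 \<and> j = 1 then {1, 2} else {},
    idt = \<lambda>_. 0, cmp = (+)\<rparr> :: (nat, nat) cat"
  let ?O = "\<lambda>i::nat. if i = 0 then A else B"
  let ?M = "\<lambda>(i::nat) (j::nat) (x::nat). if x = 0 then idt C (?O i) else if x = 1 then f else g"
  let ?F = "\<lparr>FO = ?O, FM = ?M\<rparr> :: (nat, nat, 'o, 'm) fnctor"
  have AB: "A \<in> Ob C" "B \<in> Ob C" using assms hom_dom hom_cod by blast+
  have "finite_category ?J"
    unfolding finite_category_def by (auto intro!: category.intro split: if_splits)
  moreover have "is_functor ?J C ?F"
    unfolding is_functor_def using assms AB idt_hom idt_left idt_right idt_left[OF idt_hom]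
    by (auto split: if_splits)
  ultimately obtain S \<pi> where lim: "is_limit ?J C ?F S \<pi>"
    using assms unfolding has_finite_limits_def by blast
  have cone: "is_cone ?J C ?F Z \<zeta> \<longleftrightarrow> \<zeta> 0 \<in> Hom C Z A \<and> \<zeta> 1 = f \<cdot> \<zeta> 0 \<and> \<zeta> 1 = g \<cdot> \<zeta> 0" for Z \<zeta>
  proof
    assume c: "is_cone ?J C ?F Z \<zeta>"
    then have "FM ?F i j x \<cdot> \<zeta> i = \<zeta> j" if "x \<in> Hom ?J i j" for i j x
      using that unfolding is_cone_def by blast
    from this[of 1 0 1] this[of 2 0 1] show "\<zeta> 0 \<in> Hom C Z A \<and> \<zeta> 1 = f \<cdot> \<zeta> 0 \<and> \<zeta> 1 = g \<cdot> \<zeta> 0"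
      using c unfolding is_cone_def by simp
  next
    assume z: "\<zeta> 0 \<in> Hom C Z A \<and> \<zeta> 1 = f \<cdot> \<zeta> 0 \<and> \<zeta> 1 = g \<cdot> \<zeta> 0"
    then have "\<zeta> 1 \<in> Hom C Z B" using assms(2) cmp_hom by metis
    then show "is_cone ?J C ?F Z \<zeta>"
      unfolding is_cone_def using z hom_dom idt_left by (auto split: if_splits)
  qed
  have "is_equaliser C A B f g S (\<pi> 0)"
    unfolding is_equaliser_def
  proof (intro conjI allI impI)
    have c: "is_cone ?J C ?F S \<pi>" using lim unfolding is_limit_def by blast
    show k: "\<pi> 0 \<in> Hom C S A" "f \<cdot> \<pi> 0 = g \<cdot> \<pi> 0" using c[unfolded cone] by (blast, metis)
    fix Z h assume h: "h \<in> Hom C Z A \<and> f \<cdot> h = g \<cdot> h"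
    let ?z = "\<lambda>i::nat. if i = 0 then h else f \<cdot> h"
    have "is_cone ?J C ?F Z ?z" using h cone[of Z ?z] by simp
    then have "\<exists>!u. u \<in> Hom C Z S \<and> (\<forall>i\<in>Ob ?J. \<pi> i \<cdot> u = ?z i)"
      using lim unfolding is_limit_def by blast
    moreover have "u \<in> Hom C Z S \<and> (\<forall>i\<in>Ob ?J. \<pi> i \<cdot> u = ?z i) \<longleftrightarrow>
        u \<in> Hom C Z S \<and> \<pi> 0 \<cdot> u = h" for u
      using c[unfolded cone] cmp_assoc[OF assms(2) k(1), of u Z] by auto
    ultimately show "\<exists>!u. u \<in> Hom C Z S \<and> \<pi> 0 \<cdot> u = h" by (simp only:)
  qed (use assms in simp_all)
  then show ?thesis by blast
qed

lemma finite_limits_cartesian: "has_finite_limits C \<Longrightarrow> cartesian C"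
  using finite_limits_terminal finite_limits_product by unfold_locales

lemma pullback_eqI:
  assumes "is_pullback C A B D f g P p q" "u \<in> Hom C Z P" "v \<in> Hom C Z P"
    and "p \<cdot> u = p \<cdot> v" "q \<cdot> u = q \<cdot> v"
  shows "u = v"
proof -
  have h: "f \<in> Hom C A D" "g \<in> Hom C B D" "p \<in> Hom C P A" "q \<in> Hom C P B" "f \<cdot> p = g \<cdot> q"
    using assms(1) unfolding is_pullback_def by blast+
  have "f \<cdot> p \<cdot> v = g \<cdot> q \<cdot> v"
    using cmp_assoc[OF h(1,3) assms(3)] cmp_assoc[OF h(2,4) assms(3)] h(5) by simp
  then have "\<exists>!u. u \<in> Hom C Z P \<and> p \<cdot> u = p \<cdot> v \<and> q \<cdot> u = q \<cdot> v"
    using assms(1) cmp_hom[OF h(3) assms(3)] cmp_hom[OF h(4) assms(3)]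
    unfolding is_pullback_def by blast
  then show ?thesis using assms by blast
qed

lemma coequaliser_epi:
  assumes "is_coequaliser C A B f g Q q" "u \<in> Hom C Q Z" "v \<in> Hom C Q Z" "u \<cdot> q = v \<cdot> q"
  shows "u = v"
proof -
  have h: "f \<in> Hom C A B" "g \<in> Hom C A B" "q \<in> Hom C B Q" "q \<cdot> f = q \<cdot> g"
    using assms(1) unfolding is_coequaliser_def by blast+
  have "(v \<cdot> q) \<cdot> f = (v \<cdot> q) \<cdot> g"
    using cmp_assoc[OF assms(3) h(3,1)] cmp_assoc[OF assms(3) h(3,2)] h(4) by simp
  then have "\<exists>!u. u \<in> Hom C Q Z \<and> u \<cdot> q = v \<cdot> q"
    using assms(1) cmp_hom[OF assms(3) h(3)] unfolding is_coequaliser_def by blast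
  then show ?thesis using assms by blast
qed

lemma finite_limits_pullback:
  assumes "has_finite_limits C" "f \<in> Hom C A D" "g \<in> Hom C B D"
  shows "\<exists>P p q. is_pullback C A B D f g P p q"
proof -
  interpret cartesian C using assms(1) by (rule finite_limits_cartesian)
  have o: "A \<in> Ob C" "B \<in> Ob C" using assms hom_dom by blast+
  note p1 = pr1_hom[OF o] and p2 = pr2_hom[OF o]
  obtain P k where eq: "is_equaliser C (prd C A B) D (f \<cdot> pr1 C A B) (g \<cdot> pr2 C A B) P k"
    using finite_limits_equaliser[OF assms(1) cmp_hom[OF assms(2) p1] cmp_hom[OF assms(3) p2]]
    by blast
  then have k: "k \<in> Hom C P (prd C A B)" "(f \<cdot> pr1 C A B) \<cdot> k = (g \<cdot> pr2 C A B) \<cdot> k"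
    unfolding is_equaliser_def by blast+
  have "is_pullback C A B D f g P (pr1 C A B \<cdot> k) (pr2 C A B \<cdot> k)"
    unfolding is_pullback_def
  proof (intro conjI allI impI)
    show "pr1 C A B \<cdot> k \<in> Hom C P A" "pr2 C A B \<cdot> k \<in> Hom C P B"
      using cmp_hom[OF p1 k(1)] cmp_hom[OF p2 k(1)] by blast+
    show "f \<cdot> pr1 C A B \<cdot> k = g \<cdot> pr2 C A B \<cdot> k"
      using k(2) cmp_assoc[OF assms(2) p1 k(1)] cmp_assoc[OF assms(3) p2 k(1)] by simp
    fix Z h l assume hl: "h \<in> Hom C Z A \<and> l \<in> Hom C Z B \<and> f \<cdot> h = g \<cdot> l"
    then have h: "h \<in> Hom C Z A" and l: "l \<in> Hom C Z B" by blast+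
    note w = pair_hom[OF h l]
    have "(f \<cdot> pr1 C A B) \<cdot> pair C Z A B h l = (g \<cdot> pr2 C A B) \<cdot> pair C Z A B h l"
      using hl cmp_assoc[OF assms(2) p1 w] cmp_assoc[OF assms(3) p2 w] pr1_pair[OF h l] pr2_pair[OF h l]
      by simp
    then have ex: "\<exists>!u. u \<in> Hom C Z P \<and> k \<cdot> u = pair C Z A B h l"
      using eq w unfolding is_equaliser_def by blast
    have eqv: "u \<in> Hom C Z P \<and> k \<cdot> u = pair C Z A B h l \<longleftrightarrow>
        u \<in> Hom C Z P \<and> (pr1 C A B \<cdot> k) \<cdot> u = h \<and> (pr2 C A B \<cdot> k) \<cdot> u = l" for u
    proof (cases "u \<in> Hom C Z P")
      case True
      have "k \<cdot> u = pair C Z A B h l \<longleftrightarrow> pr1 C A B \<cdot> k \<cdot> u = h \<and> pr2 C A B \<cdot> k \<cdot> u = l"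
        using pair_unique[OF cmp_hom[OF k(1) True] o] pr1_pair[OF h l] pr2_pair[OF h l] by fastforce
      then show ?thesis
        unfolding cmp_assoc[OF p1 k(1) True] cmp_assoc[OF p2 k(1) True] by blast
    qed blast
    show "\<exists>!u. u \<in> Hom C Z P \<and> (pr1 C A B \<cdot> k) \<cdot> u = h \<and> (pr2 C A B \<cdot> k) \<cdot> u = l"
      using ex unfolding eqv .
  qed (use assms in simp_all)
  then show ?thesis by blast
qed

end

section \<open>Slices\<close>

lemma slice_Ob: "Y \<in> Ob (slice D B) \<longleftrightarrow> snd Y \<in> Hom D (fst Y) B"
  unfolding slice_def by (auto simp: case_prod_unfold)

lemma slice_Hom: "h \<in> Hom (slice D B) Y Z \<longleftrightarrow>
    snd Y \<in> Hom D (fst Y) B \<and> snd Z \<in> Hom D (fst Z) B \<and> h \<in> Hom D (fst Y) (fst Z) \<and>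
    snd Z \<cdot>\<^bsub>D\<^esub> h = snd Y"
  unfolding slice_def by (auto simp: case_prod_unfold)

lemma slice_cmp [simp]: "cmp (slice D B) = cmp D"
  and slice_idt [simp]: "idt (slice D B) Y = idt D (fst Y)"
  unfolding slice_def by (auto simp: case_prod_unfold)

context category
begin

lemma slice_category: "category (slice C B)"
proof
  fix f g h Y Z W V
  show "f \<in> Hom (slice C B) Y Z \<Longrightarrow> Y \<in> Ob (slice C B) \<and> Z \<in> Ob (slice C B)"
    unfolding slice_Hom slice_Ob by blast
  show "Y \<in> Ob (slice C B) \<Longrightarrow> idt (slice C B) Y \<in> Hom (slice C B) Y Y"
    unfolding slice_Hom slice_Ob using idt_hom idt_right hom_dom by auto
  show "g \<in> Hom (slice C B) Z W \<Longrightarrow> f \<in> Hom (slice C B) Y Z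
      \<Longrightarrow> g \<cdot>\<^bsub>slice C B\<^esub> f \<in> Hom (slice C B) Y W"
    unfolding slice_Hom using cmp_hom cmp_assoc[of "snd W" "fst W" B g "fst Z" f "fst Y"] by auto
  show "f \<in> Hom (slice C B) Y Z \<Longrightarrow> idt (slice C B) Z \<cdot>\<^bsub>slice C B\<^esub> f = f"
    "f \<in> Hom (slice C B) Y Z \<Longrightarrow> f \<cdot>\<^bsub>slice C B\<^esub> idt (slice C B) Y = f"
    unfolding slice_Hom using idt_left idt_right by auto
  show "h \<in> Hom (slice C B) W V \<Longrightarrow> g \<in> Hom (slice C B) Z W \<Longrightarrow> f \<in> Hom (slice C B) Y Z
    \<Longrightarrow> (h \<cdot>\<^bsub>slice C B\<^esub> g) \<cdot>\<^bsub>slice C B\<^esub> f = h \<cdot>\<^bsub>slice C B\<^esub> g \<cdot>\<^bsub>slice C B\<^esub> f"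
    unfolding slice_Hom using cmp_assoc by auto
qed

text \<open>
  Products in the slice are the pullbacks over \<open>B\<close>, and the identity of \<open>B\<close> is terminal.
\<close>

lemma slice_cartesian:
  assumes B: "B \<in> Ob C"
    and pb: "\<And>A A' f g. f \<in> Hom C A B \<Longrightarrow> g \<in> Hom C A' B \<Longrightarrow> \<exists>P p q. is_pullback C A A' B f g P p q"
  shows "cartesian (slice C B)"
proof -
  interpret S: category "slice C B" by (rule slice_category)
  show ?thesis
  proof
    have "is_terminal (slice C B) (B, idt C B)"
      unfolding is_terminal_def
    proof (intro conjI ballI)
      show "(B, idt C B) \<in> Ob (slice C B)" unfolding slice_Ob using idt_hom[OF B] by simp
      fix Y assume Y: "Y \<in> Ob (slice C B)"
      show "\<exists>!f. f \<in> Hom (slice C B) Y (B, idt C B)"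
        by (rule ex1I[of _ "snd Y"]; use Y idt_hom[OF B] idt_left in \<open>auto simp: slice_Ob slice_Hom\<close>)
    qed
    then show "\<exists>T. is_terminal (slice C B) T" by blast
  next
    fix Y Z assume "Y \<in> Ob (slice C B)" "Z \<in> Ob (slice C B)"
    then have y: "snd Y \<in> Hom C (fst Y) B" and z: "snd Z \<in> Hom C (fst Z) B"
      unfolding slice_Ob by blast+
    then obtain P p q where P: "is_pullback C (fst Y) (fst Z) B (snd Y) (snd Z) P p q"
      using pb by blast
    then have p: "p \<in> Hom C P (fst Y)" and q: "q \<in> Hom C P (fst Z)" and pq: "snd Y \<cdot> p = snd Z \<cdot> q"
      unfolding is_pullback_def by blast+
    have r: "snd Y \<cdot> p \<in> Hom C P B" using y p cmp_hom by blast
    have "is_product (slice C B) Y Z (P, snd Y \<cdot> p) p q"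
      unfolding is_product_def
    proof (intro conjI allI impI)
      show "p \<in> Hom (slice C B) (P, snd Y \<cdot> p) Y" "q \<in> Hom (slice C B) (P, snd Y \<cdot> p) Z"
        unfolding slice_Hom using y z p q pq r by simp_all
      fix W f g assume fg: "f \<in> Hom (slice C B) W Y \<and> g \<in> Hom (slice C B) W Z"
      then have "\<exists>!h. h \<in> Hom C (fst W) P \<and> p \<cdot> h = f \<and> q \<cdot> h = g"
        using P unfolding slice_Hom is_pullback_def by metis
      moreover have "h \<in> Hom (slice C B) W (P, snd Y \<cdot> p) \<longleftrightarrow> h \<in> Hom C (fst W) P"
        if "p \<cdot> h = f" for h
        unfolding slice_Hom using fg r that cmp_assoc[OF y p] unfolding slice_Hom by auto
      ultimately show "\<exists>!h. h \<in> Hom (slice C B) W (P, snd Y \<cdot> p) \<and>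
          p \<cdot>\<^bsub>slice C B\<^esub> h = f \<and> q \<cdot>\<^bsub>slice C B\<^esub> h = g"
        unfolding slice_cmp by metis
    qed
    then show "\<exists>P p q. is_product (slice C B) Y Z P p q" by blast
  qed
qed

end

section \<open>The category of internal graphs\<close>

lemma Graph_Ob: "X \<in> Ob (Graph C) \<longleftrightarrow> gd0 X \<in> Hom C (gE X) (gV X) \<and> gd1 X \<in> Hom C (gE X) (gV X)"
  unfolding Graph_def by simp

lemma Graph_Hom: "f \<in> Hom (Graph C) X Y \<longleftrightarrow> X \<in> Ob (Graph C) \<and> Y \<in> Ob (Graph C) \<and>
    fst f \<in> Hom C (gE X) (gE Y) \<and> snd f \<in> Hom C (gV X) (gV Y) \<and>
    gd0 Y \<cdot>\<^bsub>C\<^esub> fst f = snd f \<cdot>\<^bsub>C\<^esub> gd0 X \<and> gd1 Y \<cdot>\<^bsub>C\<^esub> fst f = snd f \<cdot>\<^bsub>C\<^esub> gd1 X"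
  unfolding Graph_def by (auto simp: case_prod_unfold)

lemma Graph_cmp [simp]: "fst (g \<cdot>\<^bsub>Graph C\<^esub> f) = fst g \<cdot>\<^bsub>C\<^esub> fst f"
    "snd (g \<cdot>\<^bsub>Graph C\<^esub> f) = snd g \<cdot>\<^bsub>C\<^esub> snd f"
  and Graph_idt [simp]: "fst (idt (Graph C) X) = idt C (gE X)" "snd (idt (Graph C) X) = idt C (gV X)"
  unfolding Graph_def by (auto simp: case_prod_unfold)

context category
begin

lemma Graph_cmp_hom:
  assumes g: "g \<in> Hom (Graph C) Y Z" and f: "f \<in> Hom (Graph C) X Y"
  shows "g \<cdot>\<^bsub>Graph C\<^esub> f \<in> Hom (Graph C) X Z"
proof -
  note g' = g[unfolded Graph_Hom Graph_Ob] and f' = f[unfolded Graph_Hom Graph_Ob]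
  have "d' \<cdot> fst g \<cdot> fst f = (snd g \<cdot> snd f) \<cdot> d''"
    if "d' \<in> Hom C (gE Z) (gV Z)" "d \<in> Hom C (gE Y) (gV Y)" "d'' \<in> Hom C (gE X) (gV X)"
      "d' \<cdot> fst g = snd g \<cdot> d" "d \<cdot> fst f = snd f \<cdot> d''" for d d' d''
  proof -
    have "d' \<cdot> fst g \<cdot> fst f = (snd g \<cdot> d) \<cdot> fst f"
      using cmp_assoc[of d'] that f' g' by metis
    also have "\<dots> = snd g \<cdot> snd f \<cdot> d''"
      using cmp_assoc[of "snd g" "gV Y" "gV Z" d] that f' g' by metis
    also have "\<dots> = (snd g \<cdot> snd f) \<cdot> d''"
      using cmp_assoc[of "snd g" "gV Y" "gV Z" "snd f"] that f' g' by metis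
    finally show ?thesis .
  qed
  note sq = this
  have "gd0 Z \<cdot> fst g \<cdot> fst f = (snd g \<cdot> snd f) \<cdot> gd0 X"
    "gd1 Z \<cdot> fst g \<cdot> fst f = (snd g \<cdot> snd f) \<cdot> gd1 X"
    using sq[of "gd0 Z" "gd0 Y" "gd0 X"] sq[of "gd1 Z" "gd1 Y" "gd1 X"] g' f' by blast+
  moreover have "fst g \<cdot> fst f \<in> Hom C (gE X) (gE Z)" "snd g \<cdot> snd f \<in> Hom C (gV X) (gV Z)"
    using g' f' cmp_hom by blast+
  ultimately show ?thesis
    unfolding Graph_Hom Graph_Ob using g' f' by simp
qed

lemma Graph_category: "category (Graph C)"
proof
  fix f g h X Y Z W
  show "f \<in> Hom (Graph C) X Y \<Longrightarrow> X \<in> Ob (Graph C) \<and> Y \<in> Ob (Graph C)"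
    unfolding Graph_Hom by blast
  show "X \<in> Ob (Graph C) \<Longrightarrow> idt (Graph C) X \<in> Hom (Graph C) X X"
    unfolding Graph_Hom Graph_Ob using hom_dom hom_cod idt_hom idt_left idt_right by auto
  show "g \<in> Hom (Graph C) Y Z \<Longrightarrow> f \<in> Hom (Graph C) X Y \<Longrightarrow> g \<cdot>\<^bsub>Graph C\<^esub> f \<in> Hom (Graph C) X Z"
    by (rule Graph_cmp_hom)
  show "f \<in> Hom (Graph C) X Y \<Longrightarrow> idt (Graph C) Y \<cdot>\<^bsub>Graph C\<^esub> f = f"
    "f \<in> Hom (Graph C) X Y \<Longrightarrow> f \<cdot>\<^bsub>Graph C\<^esub> idt (Graph C) X = f"
    unfolding Graph_Hom using idt_left idt_right by (auto intro!: prod_eqI)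
  show "h \<in> Hom (Graph C) Z W \<Longrightarrow> g \<in> Hom (Graph C) Y Z \<Longrightarrow> f \<in> Hom (Graph C) X Y
    \<Longrightarrow> (h \<cdot>\<^bsub>Graph C\<^esub> g) \<cdot>\<^bsub>Graph C\<^esub> f = h \<cdot>\<^bsub>Graph C\<^esub> g \<cdot>\<^bsub>Graph C\<^esub> f"
    unfolding Graph_Hom using cmp_assoc by (auto intro!: prod_eqI)
qed

text \<open>
  Pullbacks are formed on edges and on vertices; the universal property of the vertex part supplies
  the two boundary maps, and its uniqueness part makes the induced arrows compatible with them.
\<close>

lemma Graph_pullback:
  assumes lim: "has_finite_limits C"
    and f: "f \<in> Hom (Graph C) X Z" and g: "g \<in> Hom (Graph C) Y Z"
  shows "\<exists>P p q. is_pullback (Graph C) X Y Z f g P p q"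
proof -
  interpret Gr: category "Graph C" by (rule Graph_category)
  note f' = f[unfolded Graph_Hom Graph_Ob] and g' = g[unfolded Graph_Hom Graph_Ob]
  obtain PE pE qE where E: "is_pullback C (gE X) (gE Y) (gE Z) (fst f) (fst g) PE pE qE"
    using finite_limits_pullback[OF lim] f' g' by blast
  obtain PV pV qV where V: "is_pullback C (gV X) (gV Y) (gV Z) (snd f) (snd g) PV pV qV"
    using finite_limits_pullback[OF lim] f' g' by blast
  have E': "pE \<in> Hom C PE (gE X)" "qE \<in> Hom C PE (gE Y)" "fst f \<cdot> pE = fst g \<cdot> qE"
    and V': "pV \<in> Hom C PV (gV X)" "qV \<in> Hom C PV (gV Y)" "snd f \<cdot> pV = snd g \<cdot> qV"
    using E V unfolding is_pullback_def by blast+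
  have "\<exists>d. d \<in> Hom C PE PV \<and> pV \<cdot> d = dX \<cdot> pE \<and> qV \<cdot> d = dY \<cdot> qE"
    if d: "dX \<in> Hom C (gE X) (gV X)" "dY \<in> Hom C (gE Y) (gV Y)" "dZ \<in> Hom C (gE Z) (gV Z)"
      "dZ \<cdot> fst f = snd f \<cdot> dX" "dZ \<cdot> fst g = snd g \<cdot> dY" for dX dY dZ
  proof -
    have "snd f \<cdot> dX \<cdot> pE = dZ \<cdot> fst f \<cdot> pE"
      using cmp_assoc[of "snd f" _ _ dX _ pE] cmp_assoc[of dZ _ _ "fst f" _ pE] d f' E' by metis
    also have "\<dots> = snd g \<cdot> dY \<cdot> qE"
      using cmp_assoc[of "snd g" _ _ dY _ qE] cmp_assoc[of dZ _ _ "fst g" _ qE] d g' E' by metis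
    finally show ?thesis
      using V cmp_hom[OF d(1) E'(1)] cmp_hom[OF d(2) E'(2)] unfolding is_pullback_def by blast
  qed
  from this[of "gd0 X" "gd0 Y" "gd0 Z"] this[of "gd1 X" "gd1 Y" "gd1 Z"]
  obtain d0 d1 where
    d0: "d0 \<in> Hom C PE PV" "pV \<cdot> d0 = gd0 X \<cdot> pE" "qV \<cdot> d0 = gd0 Y \<cdot> qE" and
    d1: "d1 \<in> Hom C PE PV" "pV \<cdot> d1 = gd1 X \<cdot> pE" "qV \<cdot> d1 = gd1 Y \<cdot> qE"
    using f' g' by metis
  let ?P = "\<lparr>gE = PE, gV = PV, gd0 = d0, gd1 = d1\<rparr>"
  have p: "(pE, pV) \<in> Hom (Graph C) ?P X" and q: "(qE, qV) \<in> Hom (Graph C) ?P Y"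
    unfolding Graph_Hom Graph_Ob using f' g' E' V' d0 d1 by simp_all
  have "is_pullback (Graph C) X Y Z f g ?P (pE, pV) (qE, qV)"
    unfolding is_pullback_def
  proof (intro conjI allI impI f g p q)
    show "f \<cdot>\<^bsub>Graph C\<^esub> (pE, pV) = g \<cdot>\<^bsub>Graph C\<^esub> (qE, qV)"
      using E' V' by (simp add: prod_eq_iff)
    fix W h k
    assume "h \<in> Hom (Graph C) W X \<and> k \<in> Hom (Graph C) W Y \<and> f \<cdot>\<^bsub>Graph C\<^esub> h = g \<cdot>\<^bsub>Graph C\<^esub> k"
    then have h: "h \<in> Hom (Graph C) W X" and k: "k \<in> Hom (Graph C) W Y"
      and hk: "fst f \<cdot> fst h = fst g \<cdot> fst k" "snd f \<cdot> snd h = snd g \<cdot> snd k"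
      by (auto simp: prod_eq_iff)
    note h' = h[unfolded Graph_Hom Graph_Ob] and k' = k[unfolded Graph_Hom Graph_Ob]
    obtain uE where uE: "uE \<in> Hom C (gE W) PE" "pE \<cdot> uE = fst h" "qE \<cdot> uE = fst k"
      using E hk h' k' unfolding is_pullback_def by metis
    obtain uV where uV: "uV \<in> Hom C (gV W) PV" "pV \<cdot> uV = snd h" "qV \<cdot> uV = snd k"
      using V hk h' k' unfolding is_pullback_def by metis
    have sq: "d \<cdot> uE = uV \<cdot> dW"
      if d: "d \<in> Hom C PE PV" "pV \<cdot> d = dX \<cdot> pE" "qV \<cdot> d = dY \<cdot> qE" "dW \<in> Hom C (gE W) (gV W)"
        "dX \<in> Hom C (gE X) (gV X)" "dY \<in> Hom C (gE Y) (gV Y)"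
        "dX \<cdot> fst h = snd h \<cdot> dW" "dY \<cdot> fst k = snd k \<cdot> dW" for d dX dY dW
    proof (rule pullback_eqI[OF V cmp_hom[OF d(1) uE(1)] cmp_hom[OF uV(1) d(4)]])
      show "pV \<cdot> d \<cdot> uE = pV \<cdot> uV \<cdot> dW"
        using cmp_assoc[OF V'(1) d(1) uE(1)] cmp_assoc[OF V'(1) uV(1) d(4)]
          cmp_assoc[OF d(5) E'(1) uE(1)] d uE uV by simp
      show "qV \<cdot> d \<cdot> uE = qV \<cdot> uV \<cdot> dW"
        using cmp_assoc[OF V'(2) d(1) uE(1)] cmp_assoc[OF V'(2) uV(1) d(4)]
          cmp_assoc[OF d(6) E'(2) uE(1)] d uE uV by simp
    qed
    have u: "(uE, uV) \<in> Hom (Graph C) W ?P"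
      unfolding Graph_Hom Graph_Ob using uE uV d0 d1 h' k'
        sq[OF d0, of "gd0 W"] sq[OF d1, of "gd1 W"] by simp
    show "\<exists>!u. u \<in> Hom (Graph C) W ?P \<and> (pE, pV) \<cdot>\<^bsub>Graph C\<^esub> u = h \<and> (qE, qV) \<cdot>\<^bsub>Graph C\<^esub> u = k"
    proof (rule ex1I[of _ "(uE, uV)"], intro conjI u)
      show "(pE, pV) \<cdot>\<^bsub>Graph C\<^esub> (uE, uV) = h" "(qE, qV) \<cdot>\<^bsub>Graph C\<^esub> (uE, uV) = k"
        using uE uV by (simp_all add: prod_eq_iff)
      fix v assume v: "v \<in> Hom (Graph C) W ?P \<and> (pE, pV) \<cdot>\<^bsub>Graph C\<^esub> v = h \<and> (qE, qV) \<cdot>\<^bsub>Graph C\<^esub> v = k"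
      then have "fst v \<in> Hom C (gE W) PE" "snd v \<in> Hom C (gV W) PV"
        "pE \<cdot> fst v = fst h" "pV \<cdot> snd v = snd h" "qE \<cdot> fst v = fst k" "qV \<cdot> snd v = snd k"
        unfolding Graph_Hom by auto
      then show "v = (uE, uV)"
        using pullback_eqI[OF E _ uE(1)] pullback_eqI[OF V _ uV(1)] uE uV by (simp add: prod_eq_iff)
    qed
  qed
  then show ?thesis by blast
qed

lemma Graph_slice_cartesian:
  assumes "has_finite_limits C" "Q \<in> Ob (Graph C)"
  shows "cartesian (slice (Graph C) Q)"
  using category.slice_cartesian[OF Graph_category assms(2)] Graph_pullback[OF assms(1)] by blast

end

section \<open>Constant graphs and the group of arrows into one\<close>

text \<open>
  An arrow into the constant graph of \<open>A\<close> is a function on vertices that takes the same value at both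
  ends of every edge, together with this common value. The arrows from a fixed graph into the
  constant graph of a group object form a group, whose operations are the following.
\<close>

definition const_graph :: "('o, 'm) cat \<Rightarrow> 'o \<Rightarrow> ('o, 'm) graph" where
  "const_graph C A = \<lparr>gE = A, gV = A, gd0 = idt C A, gd1 = idt C A\<rparr>"

definition graph_mul :: "('o, 'm) cat \<Rightarrow> ('o, 'm) grpobj \<Rightarrow> ('o, 'm) graph \<Rightarrow>
    'm \<times> 'm \<Rightarrow> 'm \<times> 'm \<Rightarrow> 'm \<times> 'm" where
  "graph_mul C G Z x y = const_arr (mul G) \<cdot>\<^bsub>Graph C\<^esub> gpair C Z (car G) (car G) x y"

definition graph_unt :: "('o, 'm) cat \<Rightarrow> ('o, 'm) grpobj \<Rightarrow> ('o, 'm) graph \<Rightarrow> 'm \<times> 'm" where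
  "graph_unt C G Z = const_arr (unt G) \<cdot>\<^bsub>Graph C\<^esub> gbang C Z"

definition graph_ivs :: "('o, 'm) cat \<Rightarrow> ('o, 'm) grpobj \<Rightarrow> 'm \<times> 'm \<Rightarrow> 'm \<times> 'm" where
  "graph_ivs C G x = const_arr (ivs G) \<cdot>\<^bsub>Graph C\<^esub> x"

text \<open>
  Pairing into \<open>gtimes C A X\<close>; unlike in \<open>gpair\<close>, the second factor is an arbitrary graph.
\<close>

definition graph_tuple :: "('o, 'm) cat \<Rightarrow> 'o \<Rightarrow> ('o, 'm) graph \<Rightarrow> ('o, 'm) graph \<Rightarrow>
    'm \<times> 'm \<Rightarrow> 'm \<times> 'm \<Rightarrow> 'm \<times> 'm" where
  "graph_tuple C A X Z g x =
     (pair C (gE Z) A (gE X) (fst g) (fst x), pair C (gV Z) A (gV X) (snd g) (snd x))"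

lemma graph_elt_sel [simp]:
  "fst (graph_mul C G Z x y) = elt_mul C G (gE Z) (fst x) (fst y)"
  "snd (graph_mul C G Z x y) = elt_mul C G (gV Z) (snd x) (snd y)"
  "fst (graph_unt C G Z) = elt_unt C G (gE Z)"
  "snd (graph_unt C G Z) = elt_unt C G (gV Z)"
  "fst (graph_ivs C G x) = ivs G \<cdot>\<^bsub>C\<^esub> fst x"
  "snd (graph_ivs C G x) = ivs G \<cdot>\<^bsub>C\<^esub> snd x"
  unfolding graph_mul_def graph_unt_def graph_ivs_def const_arr_def gpair_def gbang_def
    elt_mul_def elt_unt_def by simp_all

locale finitely_complete = category C for C :: "('o, 'm) cat" (structure) +
  assumes lim: "has_finite_limits C"

sublocale finitely_complete \<subseteq> cartesian
  using lim by (rule finite_limits_cartesian)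

context finitely_complete
begin

abbreviation graph_cmp  (infixr "\<odot>" 70) where "g \<odot> f \<equiv> cmp (Graph C) g f"

lemmas gcategory = Graph_category
lemmas gcmp_hom = category.cmp_hom[OF Graph_category]
lemmas gassoc = category.cmp_assoc[OF Graph_category]
lemmas gidt_left = category.idt_left[OF Graph_category]
lemmas gidt_right = category.idt_right[OF Graph_category]
lemmas gdom = category.hom_dom[OF Graph_category]
lemmas gcod = category.hom_cod[OF Graph_category]

lemma graph_edges_vertices_ob: "Z \<in> Ob (Graph C) \<Longrightarrow> gE Z \<in> Ob C \<and> gV Z \<in> Ob C"
  unfolding Graph_Ob using hom_dom hom_cod by blast

lemma const_graph_hom:
  "x \<in> Hom (Graph C) Z (const_graph C A) \<longleftrightarrow> Z \<in> Ob (Graph C) \<and> A \<in> Ob C \<and>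
     fst x \<in> Hom C (gE Z) A \<and> snd x \<in> Hom C (gV Z) A \<and>
     snd x \<cdot> gd0 Z = fst x \<and> snd x \<cdot> gd1 Z = fst x"
  unfolding Graph_Hom Graph_Ob const_graph_def using idt_left idt_hom hom_dom by auto

lemma gtimes_ob:
  assumes "A \<in> Ob C" "X \<in> Ob (Graph C)"
  shows "gtimes C A X \<in> Ob (Graph C)"
  using assms unfolding Graph_Ob gtimes_def by (simp add: cross_hom idt_hom)

lemma gtimes_pr_hom:
  assumes A: "A \<in> Ob C" and X: "X \<in> Ob (Graph C)"
  shows "gpr1 C A X \<in> Hom (Graph C) (gtimes C A X) (const_graph C A)"
    and "gpr2 C A X \<in> Hom (Graph C) (gtimes C A X) X"
proof -
  note o = graph_edges_vertices_ob[OF X]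
  note I = idt_hom[OF A]
  have e: "idt C A \<cdot> pr1 C A (gE X) = pr1 C A (gE X)"
    using idt_left pr1_hom[OF A] o by blast
  show "gpr1 C A X \<in> Hom (Graph C) (gtimes C A X) (const_graph C A)"
    unfolding const_graph_hom using gtimes_ob[OF A X] A pr1_hom[OF A] o X
    by (simp add: gpr1_def gtimes_def Graph_Ob pr1_cross[OF I] e)
  show "gpr2 C A X \<in> Hom (Graph C) (gtimes C A X) X"
    unfolding Graph_Hom using gtimes_ob[OF A X] A pr2_hom[OF A] o X
    by (simp add: gpr2_def gtimes_def Graph_Ob pr2_cross[OF I])
qed

lemma
  assumes X: "X \<in> Ob (Graph C)" and g: "g \<in> Hom (Graph C) Z (const_graph C A)"
    and x: "x \<in> Hom (Graph C) Z X"
  shows graph_tuple_hom: "graph_tuple C A X Z g x \<in> Hom (Graph C) Z (gtimes C A X)"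
    and gpr1_tuple: "gpr1 C A X \<odot> graph_tuple C A X Z g x = g"
    and gpr2_tuple: "gpr2 C A X \<odot> graph_tuple C A X Z g x = x"
proof -
  note g' = g[unfolded const_graph_hom] and x' = x[unfolded Graph_Hom]
  have A: "A \<in> Ob C" using g' by blast
  have "cross C A (gE X) A (gV X) (idt C A) d \<cdot> pair C (gE Z) A (gE X) (fst g) (fst x)
      = pair C (gV Z) A (gV X) (snd g) (snd x) \<cdot> d'"
    if d: "d \<in> Hom C (gE X) (gV X)" "d' \<in> Hom C (gE Z) (gV Z)"
      "d \<cdot> fst x = snd x \<cdot> d'" "snd g \<cdot> d' = fst g" for d d'
  proof -
    have h: "fst g \<in> Hom C (gE Z) A" "fst x \<in> Hom C (gE Z) (gE X)"
      "snd g \<in> Hom C (gV Z) A" "snd x \<in> Hom C (gV Z) (gV X)" using g' x' by blast+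
    show ?thesis
      using cross_pair[OF idt_hom[OF A] d(1) h(1,2)] pair_cmp[OF h(3,4) d(2)] d(3,4) idt_left[OF h(1)]
      by simp
  qed
  note sq = this
  show "graph_tuple C A X Z g x \<in> Hom (Graph C) Z (gtimes C A X)"
    unfolding Graph_Hom using gtimes_ob[OF A X] g' x' pair_hom
      sq[of "gd0 X" "gd0 Z"] sq[of "gd1 X" "gd1 Z"]
    by (simp add: graph_tuple_def gtimes_def Graph_Ob)
  show "gpr1 C A X \<odot> graph_tuple C A X Z g x = g" "gpr2 C A X \<odot> graph_tuple C A X Z g x = x"
    unfolding gpr1_def gpr2_def graph_tuple_def using g' x' pr1_pair pr2_pair
    by (auto simp: prod_eq_iff)
qed

lemma gtimes_eqI:
  assumes A: "A \<in> Ob C" and X: "X \<in> Ob (Graph C)"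
    and u: "u \<in> Hom (Graph C) Z (gtimes C A X)" and v: "v \<in> Hom (Graph C) Z (gtimes C A X)"
    and "gpr1 C A X \<odot> u = gpr1 C A X \<odot> v" "gpr2 C A X \<odot> u = gpr2 C A X \<odot> v"
  shows "u = v"
proof (rule prod_eqI)
  note o = graph_edges_vertices_ob[OF X]
  have *: "fst u \<in> Hom C (gE Z) (prd C A (gE X))" "snd u \<in> Hom C (gV Z) (prd C A (gV X))"
    "fst v \<in> Hom C (gE Z) (prd C A (gE X))" "snd v \<in> Hom C (gV Z) (prd C A (gV X))"
    using u v unfolding Graph_Hom gtimes_def by simp_all
  show "fst u = fst v" "snd u = snd v"
    using prd_eqI[OF A _ *(1,3)] prd_eqI[OF A _ *(2,4)] o assms(5,6)
    unfolding gpr1_def gpr2_def by (auto simp: prod_eq_iff)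
qed

lemma gtimes_product:
  assumes A: "A \<in> Ob C" and X: "X \<in> Ob (Graph C)"
  shows "is_product (Graph C) (const_graph C A) X (gtimes C A X) (gpr1 C A X) (gpr2 C A X)"
  unfolding is_product_def
proof (intro conjI allI impI gtimes_pr_hom[OF A X])
  fix Z g x assume "g \<in> Hom (Graph C) Z (const_graph C A) \<and> x \<in> Hom (Graph C) Z X"
  then have g: "g \<in> Hom (Graph C) Z (const_graph C A)" and x: "x \<in> Hom (Graph C) Z X" by blast+
  note t = graph_tuple_hom[OF X g x] gpr1_tuple[OF X g x] gpr2_tuple[OF X g x]
  show "\<exists>!h. h \<in> Hom (Graph C) Z (gtimes C A X) \<and> gpr1 C A X \<odot> h = g \<and> gpr2 C A X \<odot> h = x"
  proof (rule ex1I[of _ "graph_tuple C A X Z g x"])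
    fix h assume "h \<in> Hom (Graph C) Z (gtimes C A X) \<and> gpr1 C A X \<odot> h = g \<and> gpr2 C A X \<odot> h = x"
    then show "h = graph_tuple C A X Z g x"
      by (intro gtimes_eqI[OF A X _ t(1)]) (simp_all only: t)
  qed (simp only: t)
qed

end

locale group_in_category = finitely_complete C for C :: "('o, 'm) cat" (structure) +
  fixes G :: "('o, 'm) grpobj"
  assumes G: "is_group_object C G"
begin

lemma
  shows car_ob: "car G \<in> Ob C"
    and mul_hom: "mul G \<in> Hom C (prd C (car G) (car G)) (car G)"
    and unt_hom: "unt G \<in> Hom C (one C) (car G)"
    and ivs_hom: "ivs G \<in> Hom C (car G) (car G)"
  using G unfolding group_object_iff by blast+

lemma elt_assoc:
  "\<lbrakk>x \<in> Hom C Z (car G); y \<in> Hom C Z (car G); z \<in> Hom C Z (car G)\<rbrakk>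
    \<Longrightarrow> elt_mul C G Z (elt_mul C G Z x y) z = elt_mul C G Z x (elt_mul C G Z y z)"
  using G unfolding group_object_iff by blast

lemma elt_laws:
  assumes "x \<in> Hom C Z (car G)"
  shows "elt_mul C G Z (elt_unt C G Z) x = x" "elt_mul C G Z x (elt_unt C G Z) = x"
    "elt_mul C G Z (ivs G \<cdot> x) x = elt_unt C G Z" "elt_mul C G Z x (ivs G \<cdot> x) = elt_unt C G Z"
  using G assms unfolding group_object_iff by blast+

abbreviation "KG \<equiv> const_graph C (car G)"

lemma graph_mul_hom:
  assumes "x \<in> Hom (Graph C) Z KG" "y \<in> Hom (Graph C) Z KG"
  shows "graph_mul C G Z x y \<in> Hom (Graph C) Z KG"
  using assms elt_mul_hom[OF mul_hom] elt_mul_cmp[OF mul_hom, of "snd x" "gV Z" "snd y" _ "gE Z"]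
  unfolding const_graph_hom Graph_Ob by simp

lemma graph_unt_hom: "Z \<in> Ob (Graph C) \<Longrightarrow> graph_unt C G Z \<in> Hom (Graph C) Z KG"
  using elt_unt_hom[OF unt_hom] elt_unt_cmp[OF unt_hom, of _ "gE Z" "gV Z"] graph_edges_vertices_ob[of Z] car_ob
  unfolding const_graph_hom Graph_Ob by simp

lemma graph_ivs_hom: "x \<in> Hom (Graph C) Z KG \<Longrightarrow> graph_ivs C G x \<in> Hom (Graph C) Z KG"
  using cmp_hom[OF ivs_hom] cmp_assoc[OF ivs_hom, of "snd x" "gV Z" _ "gE Z"] unfolding const_graph_hom Graph_Ob by simp

lemma graph_mul_cmp:
  assumes "x \<in> Hom (Graph C) Z KG" "y \<in> Hom (Graph C) Z KG" "h \<in> Hom (Graph C) Y Z"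
  shows "graph_mul C G Z x y \<odot> h = graph_mul C G Y (x \<odot> h) (y \<odot> h)"
  using assms(1,2)[unfolded const_graph_hom] assms(3)[unfolded Graph_Hom] elt_mul_cmp[OF mul_hom]
  by (simp add: prod_eq_iff)

lemma graph_unt_cmp: "h \<in> Hom (Graph C) Y Z \<Longrightarrow> graph_unt C G Z \<odot> h = graph_unt C G Y"
  using elt_unt_cmp[OF unt_hom] unfolding Graph_Hom by (auto intro: prod_eqI)

lemma graph_ivs_cmp:
  assumes "x \<in> Hom (Graph C) Z KG" "h \<in> Hom (Graph C) Y Z"
  shows "graph_ivs C G x \<odot> h = graph_ivs C G (x \<odot> h)"
  using assms(1)[unfolded const_graph_hom] assms(2)[unfolded Graph_Hom]
    cmp_assoc[OF ivs_hom, of "fst x" "gE Z" "fst h" "gE Y"]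
    cmp_assoc[OF ivs_hom, of "snd x" "gV Z" "snd h" "gV Y"]
  by (simp add: prod_eq_iff)

lemma graph_assoc:
  "\<lbrakk>x \<in> Hom (Graph C) Z KG; y \<in> Hom (Graph C) Z KG; z \<in> Hom (Graph C) Z KG\<rbrakk>
    \<Longrightarrow> graph_mul C G Z (graph_mul C G Z x y) z = graph_mul C G Z x (graph_mul C G Z y z)"
  using elt_assoc unfolding const_graph_hom by (auto intro: prod_eqI)

lemma graph_laws:
  assumes "x \<in> Hom (Graph C) Z KG"
  shows "graph_mul C G Z (graph_unt C G Z) x = x" "graph_mul C G Z x (graph_unt C G Z) = x"
    "graph_mul C G Z (graph_ivs C G x) x = graph_unt C G Z"
    "graph_mul C G Z x (graph_ivs C G x) = graph_unt C G Z"
  using assms elt_laws unfolding const_graph_hom by (auto intro: prod_eqI)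

section \<open>Groups over a graph that embed into a constant group\<close>

text \<open>
  The objects over \<open>B\<close> that occur below, namely \<open>G \<times> B\<close>, the stabiliser and its pullback, are all
  of the following kind. By way of \<open>\<gamma>\<close> the arrows over \<open>B\<close> from \<open>Y\<close> to \<open>Z\<close> correspond to those elements
  of the group of arrows from \<open>Y\<close> to the constant graph of \<open>G\<close> that satisfy \<open>adm Y\<close>, and these
  elements form a subgroup. Such a \<open>Z\<close> is a group object over \<open>B\<close> because it represents a
  group-valued functor, and no diagram has to be checked for it individually.
\<close>

definition represents_subgroup :: "('o, 'm) graph \<Rightarrow> ('o, 'm) graph \<times> 'm \<times> 'm \<Rightarrow> 'm \<times> 'm \<Rightarrow>
    (('o, 'm) graph \<times> 'm \<times> 'm \<Rightarrow> 'm \<times> 'm \<Rightarrow> bool) \<Rightarrow> bool" where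
  "represents_subgroup B Z \<gamma> adm \<longleftrightarrow>
     Z \<in> Ob (slice (Graph C) B) \<and> \<gamma> \<in> Hom (Graph C) (fst Z) KG \<and>
     (\<forall>Y h. h \<in> Hom (slice (Graph C) B) Y Z \<longrightarrow> adm Y (\<gamma> \<odot> h)) \<and>
     (\<forall>Y f. Y \<in> Ob (slice (Graph C) B) \<and> f \<in> Hom (Graph C) (fst Y) KG \<and> adm Y f \<longrightarrow>
        (\<exists>!h. h \<in> Hom (slice (Graph C) B) Y Z \<and> \<gamma> \<odot> h = f)) \<and>
     (\<forall>Y\<in>Ob (slice (Graph C) B). adm Y (graph_unt C G (fst Y)) \<and>
        (\<forall>f g. f \<in> Hom (Graph C) (fst Y) KG \<and> g \<in> Hom (Graph C) (fst Y) KG \<and> adm Y f \<and> adm Y g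
           \<longrightarrow> adm Y (graph_mul C G (fst Y) f g)) \<and>
        (\<forall>f. f \<in> Hom (Graph C) (fst Y) KG \<and> adm Y f \<longrightarrow> adm Y (graph_ivs C G f)))"

text \<open>
  The group structure that \<open>Z\<close> inherits from \<open>G\<close>: \<open>\<gamma>\<close> turns its operations into those of \<open>G\<close>.
  It is formulated as a property of \<open>K\<close> since the operations arise in two ways, directly from \<open>G\<close>
  or by pulling back a structure that is already there.
\<close>

definition carries_structure :: "('o, 'm) graph \<Rightarrow> ('o, 'm) graph \<times> 'm \<times> 'm \<Rightarrow> 'm \<times> 'm \<Rightarrow>
    (('o, 'm) graph \<times> 'm \<times> 'm, 'm \<times> 'm) grpobj \<Rightarrow> bool" where
  "carries_structure B Z \<gamma> K \<longleftrightarrow> (let D = slice (Graph C) B in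
     car K = Z \<and>
     mul K \<in> Hom D (prd D Z Z) Z \<and>
     \<gamma> \<odot> mul K = graph_mul C G (fst (prd D Z Z)) (\<gamma> \<odot> pr1 D Z Z) (\<gamma> \<odot> pr2 D Z Z) \<and>
     unt K \<in> Hom D (one D) Z \<and> \<gamma> \<odot> unt K = graph_unt C G (fst (one D)) \<and>
     ivs K \<in> Hom D Z Z \<and> \<gamma> \<odot> ivs K = graph_ivs C G \<gamma>)"

lemma over_hom: "h \<in> Hom (slice (Graph C) B) Y Z \<Longrightarrow> h \<in> Hom (Graph C) (fst Y) (fst Z)"
  unfolding slice_Hom by blast

text \<open>
  The definite descriptions in \<open>induced_grp\<close> are meaningful: products, units and inverses of
  admissible elements are admissible, so each of them is \<open>\<gamma> \<odot> h\<close> for exactly one \<open>h\<close>.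
\<close>

lemma induced_grp_structure:
  assumes B: "B \<in> Ob (Graph C)" and rep: "represents_subgroup B Z \<gamma> adm"
  shows "carries_structure B Z \<gamma> (induced_grp C B G Z \<gamma>)"
proof -
  define D where "D = slice (Graph C) B"
  interpret D: cartesian D unfolding D_def using lim B by (rule Graph_slice_cartesian)
  have Z: "Z \<in> Ob D" and \<gamma>: "\<gamma> \<in> Hom (Graph C) (fst Z) KG"
    and adm: "\<And>Y h. h \<in> Hom D Y Z \<Longrightarrow> adm Y (\<gamma> \<odot> h)"
    and lift: "\<And>Y f. \<lbrakk>Y \<in> Ob D; f \<in> Hom (Graph C) (fst Y) KG; adm Y f\<rbrakk>
      \<Longrightarrow> \<exists>!h. h \<in> Hom D Y Z \<and> \<gamma> \<odot> h = f"
    and cu: "\<And>Y. Y \<in> Ob D \<Longrightarrow> adm Y (graph_unt C G (fst Y))"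
    and cm: "\<And>Y f g. \<lbrakk>Y \<in> Ob D; f \<in> Hom (Graph C) (fst Y) KG; g \<in> Hom (Graph C) (fst Y) KG;
      adm Y f; adm Y g\<rbrakk> \<Longrightarrow> adm Y (graph_mul C G (fst Y) f g)"
    and ci: "\<And>Y f. \<lbrakk>Y \<in> Ob D; f \<in> Hom (Graph C) (fst Y) KG; adm Y f\<rbrakk> \<Longrightarrow> adm Y (graph_ivs C G f)"
    using rep unfolding represents_subgroup_def D_def by blast+
  let ?W = "prd D Z Z"
  have W: "?W \<in> Ob D" and T: "one D \<in> Ob D" using Z D.prd_ob D.one_ob by blast+
  have gr: "h \<in> Hom (Graph C) (fst Y) (fst Y')" if "h \<in> Hom D Y Y'" for h Y Y'
    using that over_hom unfolding D_def by blast
  have obj: "fst Y \<in> Ob (Graph C)" if "Y \<in> Ob D" for Y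
    using that gdom unfolding D_def slice_Ob by blast
  note p1 = D.pr1_hom[OF Z Z] and p2 = D.pr2_hom[OF Z Z]
  note g1 = gcmp_hom[OF \<gamma> gr[OF p1]] and g2 = gcmp_hom[OF \<gamma> gr[OF p2]]
  have "\<exists>!h. h \<in> Hom D ?W Z \<and> \<gamma> \<odot> h = graph_mul C G (fst ?W) (\<gamma> \<odot> pr1 D Z Z) (\<gamma> \<odot> pr2 D Z Z)"
    by (rule lift[OF W graph_mul_hom[OF g1 g2] cm[OF W g1 g2 adm[OF p1] adm[OF p2]]])
  note m = theI'[OF this]
  have "\<exists>!h. h \<in> Hom D (one D) Z \<and> \<gamma> \<odot> h = graph_unt C G (fst (one D))"
    by (rule lift[OF T graph_unt_hom[OF obj[OF T]] cu[OF T]])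
  note e = theI'[OF this]
  have "adm Z \<gamma>" using adm[OF D.idt_hom[OF Z]] gidt_right[OF \<gamma>] unfolding D_def slice_idt by simp
  then have "\<exists>!h. h \<in> Hom D Z Z \<and> \<gamma> \<odot> h = graph_ivs C G \<gamma>"
    by (intro lift[OF Z graph_ivs_hom[OF \<gamma>]] ci[OF Z \<gamma>])
  note i = theI'[OF this]
  show ?thesis
    unfolding carries_structure_def induced_grp_def Let_def D_def[symmetric]
    using m e i unfolding graph_mul_def graph_unt_def graph_ivs_def by simp
qed

text \<open>
  Composition with \<open>\<gamma>\<close> is injective on arrows over \<open>B\<close> and multiplicative, so the group laws for
  elements of \<open>K\<close> follow from those for arrows into the constant graph of \<open>G\<close>.
\<close>

lemma structure_group_object:
  assumes B: "B \<in> Ob (Graph C)" and rep: "represents_subgroup B Z \<gamma> adm"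
    and K: "carries_structure B Z \<gamma> K"
  shows "is_group_object (slice (Graph C) B) K"
proof -
  define D where "D = slice (Graph C) B"
  interpret D: cartesian D unfolding D_def using lim B by (rule Graph_slice_cartesian)
  have Dc [simp]: "cmp D = cmp (Graph C)" unfolding D_def by simp
  have Z: "Z \<in> Ob D" and \<gamma>: "\<gamma> \<in> Hom (Graph C) (fst Z) KG"
    and adm: "\<And>Y h. h \<in> Hom D Y Z \<Longrightarrow> adm Y (\<gamma> \<odot> h)"
    and lift: "\<And>Y f. \<lbrakk>Y \<in> Ob D; f \<in> Hom (Graph C) (fst Y) KG; adm Y f\<rbrakk>
      \<Longrightarrow> \<exists>!h. h \<in> Hom D Y Z \<and> \<gamma> \<odot> h = f"
    using rep unfolding represents_subgroup_def D_def by blast+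
  have gr: "h \<in> Hom (Graph C) (fst Y) (fst Y')" if "h \<in> Hom D Y Y'" for h Y Y'
    using that over_hom unfolding D_def by blast
  have el: "\<gamma> \<odot> h \<in> Hom (Graph C) (fst Y) KG" if "h \<in> Hom D Y Z" for h Y
    using gcmp_hom[OF \<gamma> gr[OF that]] .
  have inj: "h = h'" if "h \<in> Hom D Y Z" "h' \<in> Hom D Y Z" "\<gamma> \<odot> h = \<gamma> \<odot> h'" for h h' Y
    using lift[OF D.hom_dom[OF that(1)] el[OF that(1)] adm[OF that(1)]] that by metis
  have K': "car K = Z" "mul K \<in> Hom D (prd D Z Z) Z"
     "\<gamma> \<odot> mul K = graph_mul C G (fst (prd D Z Z)) (\<gamma> \<odot> pr1 D Z Z) (\<gamma> \<odot> pr2 D Z Z)"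
     "unt K \<in> Hom D (one D) Z" "\<gamma> \<odot> unt K = graph_unt C G (fst (one D))"
     "ivs K \<in> Hom D Z Z" "\<gamma> \<odot> ivs K = graph_ivs C G \<gamma>"
    using K unfolding carries_structure_def Let_def D_def by blast+
  note p1 = D.pr1_hom[OF Z Z] and p2 = D.pr2_hom[OF Z Z]
  have mulh: "elt_mul D K Y x y \<in> Hom D Y Z" if "x \<in> Hom D Y Z" "y \<in> Hom D Y Z" for Y x y
    using D.elt_mul_hom[of K x Y y] K'(1,2) that by simp
  have unth: "elt_unt D K Y \<in> Hom D Y Z" if "Y \<in> Ob D" for Y
    using D.elt_unt_hom[of K Y] K'(1,4) that by simp
  have ivsh: "ivs K \<cdot>\<^bsub>D\<^esub> x \<in> Hom D Y Z" if "x \<in> Hom D Y Z" for x Y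
    using D.cmp_hom[OF K'(6) that] .
  have m: "\<gamma> \<odot> elt_mul D K Y x y = graph_mul C G (fst Y) (\<gamma> \<odot> x) (\<gamma> \<odot> y)"
    if x: "x \<in> Hom D Y Z" and y: "y \<in> Hom D Y Z" for Y x y
  proof -
    let ?u = "pair D Y Z Z x y"
    note u = gr[OF D.pair_hom[OF x y]]
    have "\<gamma> \<odot> elt_mul D K Y x y = (\<gamma> \<odot> mul K) \<odot> ?u"
      unfolding elt_mul_def K'(1) Dc using gassoc[OF \<gamma> gr[OF K'(2)] u] by simp
    also have "\<dots> = graph_mul C G (fst Y) ((\<gamma> \<odot> pr1 D Z Z) \<odot> ?u) ((\<gamma> \<odot> pr2 D Z Z) \<odot> ?u)"
      unfolding K'(3) using el[OF p1] el[OF p2] u by (rule graph_mul_cmp)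
    also have "(\<gamma> \<odot> pr1 D Z Z) \<odot> ?u = \<gamma> \<odot> x"
      using gassoc[OF \<gamma> gr[OF p1] u] D.pr1_pair[OF x y] by simp
    also have "(\<gamma> \<odot> pr2 D Z Z) \<odot> ?u = \<gamma> \<odot> y"
      using gassoc[OF \<gamma> gr[OF p2] u] D.pr2_pair[OF x y] by simp
    finally show ?thesis .
  qed
  have e: "\<gamma> \<odot> elt_unt D K Y = graph_unt C G (fst Y)" if Y: "Y \<in> Ob D" for Y
    unfolding elt_unt_def Dc
    using gassoc[OF \<gamma> gr[OF K'(4)] gr[OF D.bang_hom[OF Y]]] K'(5)
      graph_unt_cmp[OF gr[OF D.bang_hom[OF Y]]] by simp
  have i: "\<gamma> \<odot> (ivs K \<cdot>\<^bsub>D\<^esub> x) = graph_ivs C G (\<gamma> \<odot> x)" if x: "x \<in> Hom D Y Z" for x Y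
    unfolding Dc
    using gassoc[OF \<gamma> gr[OF K'(6)] gr[OF x]] K'(7) graph_ivs_cmp[OF \<gamma> gr[OF x]] by simp
  have "is_group_object D K"
    unfolding D.group_object_iff K'(1)
  proof (intro conjI allI impI Z K'(2,4,6))
    fix Y x y z assume "x \<in> Hom D Y Z \<and> y \<in> Hom D Y Z \<and> z \<in> Hom D Y Z"
    then have x: "x \<in> Hom D Y Z" and y: "y \<in> Hom D Y Z" and z: "z \<in> Hom D Y Z" by blast+
    show "elt_mul D K Y (elt_mul D K Y x y) z = elt_mul D K Y x (elt_mul D K Y y z)"
      by (rule inj[of _ Y]) (simp_all add: m x y z mulh graph_assoc[OF el[OF x] el[OF y] el[OF z]])
  next
    fix Y x assume x: "x \<in> Hom D Y Z"
    note Y = D.hom_dom[OF x]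
    note l = graph_laws[OF el[OF x]]
    show "elt_mul D K Y (elt_unt D K Y) x = x"
      by (rule inj[of _ Y]) (simp_all add: m e x Y mulh unth l)
    show "elt_mul D K Y x (elt_unt D K Y) = x"
      by (rule inj[of _ Y]) (simp_all add: m e x Y mulh unth l)
    show "elt_mul D K Y (ivs K \<cdot>\<^bsub>D\<^esub> x) x = elt_unt D K Y"
      by (rule inj[OF mulh[OF ivsh[OF x] x] unth[OF Y]])
        (simp only: m[OF ivsh[OF x] x] i[OF x] e[OF Y] l)
    show "elt_mul D K Y x (ivs K \<cdot>\<^bsub>D\<^esub> x) = elt_unt D K Y"
      by (rule inj[OF mulh[OF x ivsh[OF x]] unth[OF Y]])
        (simp only: m[OF x ivsh[OF x]] i[OF x] e[OF Y] l)
  qed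
  then show ?thesis unfolding D_def .
qed

text \<open>
  An arrow that is compatible with the two maps to the constant graph of \<open>G\<close> is automatically
  multiplicative, since \<open>\<gamma>'\<close> is injective and turns both multiplications into that of \<open>G\<close>.
\<close>

lemma structure_morphism:
  assumes B: "B \<in> Ob (Graph C)"
    and rep: "represents_subgroup B Z \<gamma> adm" and K: "carries_structure B Z \<gamma> K"
    and rep': "represents_subgroup B Z' \<gamma>' adm'" and K': "carries_structure B Z' \<gamma>' K'"
    and j: "j \<in> Hom (slice (Graph C) B) Z Z'" "\<gamma>' \<odot> j = \<gamma>"
  shows "j \<in> Hom (Grp (slice (Graph C) B)) K K'"
proof -
  define D where "D = slice (Graph C) B"
  interpret D: cartesian D unfolding D_def using lim B by (rule Graph_slice_cartesian)
  have Dc [simp]: "cmp D = cmp (Graph C)" unfolding D_def by simp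
  note j = j[folded D_def]
  have Z: "Z \<in> Ob D" and \<gamma>: "\<gamma> \<in> Hom (Graph C) (fst Z) KG"
    and Z': "Z' \<in> Ob D" and \<gamma>': "\<gamma>' \<in> Hom (Graph C) (fst Z') KG"
    and adm': "\<And>Y h. h \<in> Hom D Y Z' \<Longrightarrow> adm' Y (\<gamma>' \<odot> h)"
    and lift': "\<And>Y f. \<lbrakk>Y \<in> Ob D; f \<in> Hom (Graph C) (fst Y) KG; adm' Y f\<rbrakk>
      \<Longrightarrow> \<exists>!h. h \<in> Hom D Y Z' \<and> \<gamma>' \<odot> h = f"
    using rep rep' unfolding represents_subgroup_def D_def by blast+
  have gr: "h \<in> Hom (Graph C) (fst Y) (fst Y')" if "h \<in> Hom D Y Y'" for h Y Y'
    using that over_hom unfolding D_def by blast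
  have inj: "h = h'" if "h \<in> Hom D Y Z'" "h' \<in> Hom D Y Z'" "\<gamma>' \<odot> h = \<gamma>' \<odot> h'" for h h' Y
    using lift'[OF D.hom_dom[OF that(1)] gcmp_hom[OF \<gamma>' gr[OF that(1)]] adm'[OF that(1)]] that
    by metis
  have k: "car K = Z" "mul K \<in> Hom D (prd D Z Z) Z"
     "\<gamma> \<odot> mul K = graph_mul C G (fst (prd D Z Z)) (\<gamma> \<odot> pr1 D Z Z) (\<gamma> \<odot> pr2 D Z Z)"
    and k': "car K' = Z'" "mul K' \<in> Hom D (prd D Z' Z') Z'"
     "\<gamma>' \<odot> mul K' = graph_mul C G (fst (prd D Z' Z')) (\<gamma>' \<odot> pr1 D Z' Z') (\<gamma>' \<odot> pr2 D Z' Z')"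
    using K K' unfolding carries_structure_def Let_def D_def by blast+
  note p1 = D.pr1_hom[OF Z Z] and p2 = D.pr2_hom[OF Z Z]
  note p1' = D.pr1_hom[OF Z' Z'] and p2' = D.pr2_hom[OF Z' Z']
  note jj = D.cross_hom[OF j(1) j(1)]
  have "j \<odot> mul K = mul K' \<odot> cross D Z Z Z' Z' j j"
  proof (rule inj)
    show "j \<odot> mul K \<in> Hom D (prd D Z Z) Z'" "mul K' \<odot> cross D Z Z Z' Z' j j \<in> Hom D (prd D Z Z) Z'"
      using D.cmp_hom[OF j(1) k(2)] D.cmp_hom[OF k'(2) jj] by simp_all
    have 1: "(\<gamma>' \<odot> pr1 D Z' Z') \<odot> cross D Z Z Z' Z' j j = \<gamma> \<odot> pr1 D Z Z"
      using gassoc[OF \<gamma>' gr[OF p1'] gr[OF jj]] D.pr1_cross[OF j(1) j(1)]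
        gassoc[OF \<gamma>' gr[OF j(1)] gr[OF p1]] j(2) by simp
    have 2: "(\<gamma>' \<odot> pr2 D Z' Z') \<odot> cross D Z Z Z' Z' j j = \<gamma> \<odot> pr2 D Z Z"
      using gassoc[OF \<gamma>' gr[OF p2'] gr[OF jj]] D.pr2_cross[OF j(1) j(1)]
        gassoc[OF \<gamma>' gr[OF j(1)] gr[OF p2]] j(2) by simp
    have "\<gamma>' \<odot> j \<odot> mul K = \<gamma> \<odot> mul K"
      using gassoc[OF \<gamma>' gr[OF j(1)] gr[OF k(2)]] j(2) by simp
    also have "\<dots> = (\<gamma>' \<odot> mul K') \<odot> cross D Z Z Z' Z' j j"
      unfolding k(3) k'(3) using graph_mul_cmp[OF gcmp_hom[OF \<gamma>' gr[OF p1']]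
        gcmp_hom[OF \<gamma>' gr[OF p2']] gr[OF jj]] 1 2 by simp
    also have "\<dots> = \<gamma>' \<odot> mul K' \<odot> cross D Z Z Z' Z' j j"
      using gassoc[OF \<gamma>' gr[OF k'(2)] gr[OF jj]] .
    finally show "\<gamma>' \<odot> j \<odot> mul K = \<gamma>' \<odot> mul K' \<odot> cross D Z Z Z' Z' j j" .
  qed
  then have "j \<in> Hom (Grp D) K K'"
    unfolding Grp_def using j(1) k(1) k'(1)
      structure_group_object[OF B rep K, folded D_def]
      structure_group_object[OF B rep' K', folded D_def] by simp
  then show ?thesis unfolding D_def .
qed

lemma Delta_represents:
  assumes B: "B \<in> Ob (Graph C)"
  shows "represents_subgroup B (gtimes C (car G) B, gpr2 C (car G) B) (gpr1 C (car G) B) (\<lambda>_ _. True)"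
proof -
  note pr = gtimes_pr_hom[OF car_ob B]
  have "\<exists>!h. h \<in> Hom (slice (Graph C) B) Y (gtimes C (car G) B, gpr2 C (car G) B)
          \<and> gpr1 C (car G) B \<odot> h = f"
    if "Y \<in> Ob (slice (Graph C) B)" "f \<in> Hom (Graph C) (fst Y) KG" for Y f
  proof -
    have "snd Y \<in> Hom (Graph C) (fst Y) B" using that(1) unfolding slice_Ob .
    then have ex: "\<exists>!h. h \<in> Hom (Graph C) (fst Y) (gtimes C (car G) B) \<and>
        gpr1 C (car G) B \<odot> h = f \<and> gpr2 C (car G) B \<odot> h = snd Y"
      using gtimes_product[OF car_ob B] that(2) unfolding is_product_def by blast
    have eqv: "h \<in> Hom (Graph C) (fst Y) (gtimes C (car G) B) \<and>
        gpr1 C (car G) B \<odot> h = f \<and> gpr2 C (car G) B \<odot> h = snd Y \<longleftrightarrow>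
        h \<in> Hom (slice (Graph C) B) Y (gtimes C (car G) B, gpr2 C (car G) B)
          \<and> gpr1 C (car G) B \<odot> h = f" for h
      unfolding slice_Hom using that(1)[unfolded slice_Ob] pr(2) by auto
    show ?thesis using ex unfolding eqv .
  qed
  then show ?thesis
    unfolding represents_subgroup_def using pr by (simp add: slice_Ob)
qed

lemma Delta_structure:
  assumes B: "B \<in> Ob (Graph C)"
  shows "carries_structure B (gtimes C (car G) B, gpr2 C (car G) B) (gpr1 C (car G) B)
           (FO (Delta C B) G)"
  unfolding Delta_def using induced_grp_structure[OF B Delta_represents[OF B]] by simp

end

section \<open>Stabilisers and their pullback along a section\<close>

text \<open>
  The element \<open>g\<close> fixes the element \<open>x\<close> under the action \<open>a\<close>, where \<open>GX\<close> with the projections \<open>\<rho>\<close>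
  and \<open>\<tau>\<close> is a product of the group and the object acted on. The product is left open so that the
  notion applies to the chosen products of \<open>C\<close> and also to \<open>gtimes\<close> in the category of graphs.
\<close>

definition fixing :: "('o, 'm) cat \<Rightarrow> 'o \<Rightarrow> 'm \<Rightarrow> 'm \<Rightarrow> 'm \<Rightarrow> 'o \<Rightarrow> 'm \<Rightarrow> 'm \<Rightarrow> bool" where
  "fixing D GX \<rho> \<tau> a Z g x \<longleftrightarrow>
     (\<exists>u. u \<in> Hom D Z GX \<and> \<rho> \<cdot>\<^bsub>D\<^esub> u = g \<and> \<tau> \<cdot>\<^bsub>D\<^esub> u = x \<and> a \<cdot>\<^bsub>D\<^esub> u = x)"

context category
begin

lemma product_eqI:
  assumes "is_product C A B P p q" "u \<in> Hom C Z P" "v \<in> Hom C Z P"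
    and "p \<cdot> u = p \<cdot> v" "q \<cdot> u = q \<cdot> v"
  shows "u = v"
proof -
  have h: "p \<in> Hom C P A" "q \<in> Hom C P B" using assms(1) unfolding is_product_def by blast+
  then have "\<exists>!u. u \<in> Hom C Z P \<and> p \<cdot> u = p \<cdot> v \<and> q \<cdot> u = q \<cdot> v"
    using assms(1) cmp_hom[OF h(1) assms(3)] cmp_hom[OF h(2) assms(3)]
    unfolding is_product_def by blast
  then show ?thesis using assms by blast
qed

lemma
  assumes prod: "is_product C A X GX \<rho> \<tau>" and eq: "is_equaliser C GX X a \<tau> S k"
  shows stabiliser_fixing:
      "h \<in> Hom C Z S \<Longrightarrow> fixing C GX \<rho> \<tau> a Z ((\<rho> \<cdot> k) \<cdot> h) ((\<tau> \<cdot> k) \<cdot> h)"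
    and fixing_stabiliser: "fixing C GX \<rho> \<tau> a Z g x \<Longrightarrow>
      \<exists>!h. h \<in> Hom C Z S \<and> (\<rho> \<cdot> k) \<cdot> h = g \<and> (\<tau> \<cdot> k) \<cdot> h = x"
proof -
  have p: "\<rho> \<in> Hom C GX A" "\<tau> \<in> Hom C GX X" using prod unfolding is_product_def by blast+
  have a: "a \<in> Hom C GX X" and k: "k \<in> Hom C S GX" "a \<cdot> k = \<tau> \<cdot> k"
    using eq unfolding is_equaliser_def by blast+
  {
    assume h: "h \<in> Hom C Z S"
    have "k \<cdot> h \<in> Hom C Z GX" "\<rho> \<cdot> k \<cdot> h = (\<rho> \<cdot> k) \<cdot> h" "\<tau> \<cdot> k \<cdot> h = (\<tau> \<cdot> k) \<cdot> h"
      "a \<cdot> k \<cdot> h = (\<tau> \<cdot> k) \<cdot> h"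
      using cmp_hom[OF k(1) h] cmp_assoc[OF p(1) k(1) h] cmp_assoc[OF p(2) k(1) h]
        cmp_assoc[OF a k(1) h] k(2) by simp_all
    then show "fixing C GX \<rho> \<tau> a Z ((\<rho> \<cdot> k) \<cdot> h) ((\<tau> \<cdot> k) \<cdot> h)"
      unfolding fixing_def by blast
  next
    assume "fixing C GX \<rho> \<tau> a Z g x"
    then obtain u where u: "u \<in> Hom C Z GX" "\<rho> \<cdot> u = g" "\<tau> \<cdot> u = x" "a \<cdot> u = x"
      unfolding fixing_def by blast
    then have ex: "\<exists>!h. h \<in> Hom C Z S \<and> k \<cdot> h = u"
      using eq unfolding is_equaliser_def by simp
    have eqv: "h \<in> Hom C Z S \<and> k \<cdot> h = u \<longleftrightarrow>
        h \<in> Hom C Z S \<and> (\<rho> \<cdot> k) \<cdot> h = g \<and> (\<tau> \<cdot> k) \<cdot> h = x" for h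
    proof (cases "h \<in> Hom C Z S")
      case True
      show ?thesis
        unfolding cmp_assoc[OF p(1) k(1) True] cmp_assoc[OF p(2) k(1) True]
        using product_eqI[OF prod cmp_hom[OF k(1) True] u(1)] u(2,3) by fastforce
    qed blast
    show "\<exists>!h. h \<in> Hom C Z S \<and> (\<rho> \<cdot> k) \<cdot> h = g \<and> (\<tau> \<cdot> k) \<cdot> h = x"
      using ex unfolding eqv .
  }
qed

text \<open>
  The pullback of the stabiliser along \<open>s\<close> represents the pairs of an element \<open>y\<close> of \<open>Q\<close> and an
  element \<open>g\<close> of the group that fixes \<open>s \<cdot> y\<close>.
\<close>

lemma
  assumes prod: "is_product C A X GX \<rho> \<tau>" and eq: "is_equaliser C GX X a \<tau> S k"
    and pb: "is_pullback C S Q X (\<tau> \<cdot> k) s P \<sigma> p"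
  shows pullback_stabiliser_fixing:
      "h \<in> Hom C Z P \<Longrightarrow> fixing C GX \<rho> \<tau> a Z (((\<rho> \<cdot> k) \<cdot> \<sigma>) \<cdot> h) (s \<cdot> p \<cdot> h)"
    and fixing_pullback_stabiliser: "\<lbrakk>y \<in> Hom C Z Q; fixing C GX \<rho> \<tau> a Z g (s \<cdot> y)\<rbrakk> \<Longrightarrow>
      \<exists>!h. h \<in> Hom C Z P \<and> ((\<rho> \<cdot> k) \<cdot> \<sigma>) \<cdot> h = g \<and> p \<cdot> h = y"
proof -
  have pr: "\<rho> \<in> Hom C GX A" "\<tau> \<in> Hom C GX X" using prod unfolding is_product_def by blast+
  have k: "k \<in> Hom C S GX" using eq unfolding is_equaliser_def by blast
  note rk = cmp_hom[OF pr(1) k]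
  have t: "\<tau> \<cdot> k \<in> Hom C S X" "s \<in> Hom C Q X" "\<sigma> \<in> Hom C P S" "p \<in> Hom C P Q"
    "(\<tau> \<cdot> k) \<cdot> \<sigma> = s \<cdot> p"
    using pb unfolding is_pullback_def by blast+
  {
    assume h: "h \<in> Hom C Z P"
    have "(\<tau> \<cdot> k) \<cdot> \<sigma> \<cdot> h = s \<cdot> p \<cdot> h"
      using cmp_assoc[OF t(1,3) h] cmp_assoc[OF t(2,4) h] t(5) by simp
    then show "fixing C GX \<rho> \<tau> a Z (((\<rho> \<cdot> k) \<cdot> \<sigma>) \<cdot> h) (s \<cdot> p \<cdot> h)"
      using stabiliser_fixing[OF prod eq cmp_hom[OF t(3) h]] cmp_assoc[OF rk t(3) h] by simp
  next
    assume y: "y \<in> Hom C Z Q" and "fixing C GX \<rho> \<tau> a Z g (s \<cdot> y)"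
    then have ex: "\<exists>!h. h \<in> Hom C Z S \<and> (\<rho> \<cdot> k) \<cdot> h = g \<and> (\<tau> \<cdot> k) \<cdot> h = s \<cdot> y"
      using fixing_stabiliser[OF prod eq] by blast
    then obtain l where l: "l \<in> Hom C Z S" "(\<rho> \<cdot> k) \<cdot> l = g" "(\<tau> \<cdot> k) \<cdot> l = s \<cdot> y" by blast
    have ex2: "\<exists>!h. h \<in> Hom C Z P \<and> \<sigma> \<cdot> h = l \<and> p \<cdot> h = y"
      using pb l y unfolding is_pullback_def by simp
    have eqv: "h \<in> Hom C Z P \<and> \<sigma> \<cdot> h = l \<and> p \<cdot> h = y \<longleftrightarrow>
        h \<in> Hom C Z P \<and> ((\<rho> \<cdot> k) \<cdot> \<sigma>) \<cdot> h = g \<and> p \<cdot> h = y" for h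
    proof (cases "h \<in> Hom C Z P \<and> p \<cdot> h = y")
      case True
      then have h: "h \<in> Hom C Z P" and ph: "p \<cdot> h = y" by blast+
      have "(\<tau> \<cdot> k) \<cdot> \<sigma> \<cdot> h = s \<cdot> y"
        using cmp_assoc[OF t(1,3) h] cmp_assoc[OF t(2,4) h] t(5) ph by simp
      then have "\<sigma> \<cdot> h = l \<longleftrightarrow> (\<rho> \<cdot> k) \<cdot> \<sigma> \<cdot> h = g"
        using ex l cmp_hom[OF t(3) h] by auto
      then show ?thesis using cmp_assoc[OF rk t(3) h] True by simp
    qed blast
    show "\<exists>!h. h \<in> Hom C Z P \<and> ((\<rho> \<cdot> k) \<cdot> \<sigma>) \<cdot> h = g \<and> p \<cdot> h = y"
      using ex2 unfolding eqv .
  }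
qed

end

locale G_graph = group_in_category C G for C :: "('o, 'm) cat" (structure)
    and G :: "('o, 'm) grpobj" +
  fixes X :: "('o, 'm) graph" and a :: "'m \<times> 'm"
  assumes X: "is_G_graph C G X a"
begin

abbreviation "A \<equiv> car G"

lemma X_ob: "X \<in> Ob (Graph C)"
  and act_E: "is_action C G (gE X) (fst a)" and act_V: "is_action C G (gV X) (snd a)"
  using X unfolding is_G_graph_def by blast+

definition fixes_elt :: "('o, 'm) graph \<Rightarrow> 'm \<times> 'm \<Rightarrow> 'm \<times> 'm \<Rightarrow> bool" where
  "fixes_elt Z g x \<longleftrightarrow>
     fixing (Graph C) (gtimes C A X) (gpr1 C A X) (gpr2 C A X) a Z g x"

lemma fixes_elt_iff:
  "fixes_elt Z g x \<longleftrightarrow> g \<in> Hom (Graph C) Z KG \<and> x \<in> Hom (Graph C) Z X \<and>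
     elt_act C G (gE X) (fst a) (gE Z) (fst g) (fst x) = fst x \<and>
     elt_act C G (gV X) (snd a) (gV Z) (snd g) (snd x) = snd x"
proof -
  have ev: "a \<odot> graph_tuple C A X Z g x =
      (elt_act C G (gE X) (fst a) (gE Z) (fst g) (fst x), elt_act C G (gV X) (snd a) (gV Z) (snd g) (snd x))"
    by (simp add: prod_eq_iff graph_tuple_def elt_act_def)
  note pr = gtimes_pr_hom[OF car_ob X_ob]
  show ?thesis
  proof
    assume "fixes_elt Z g x"
    then obtain u where u: "u \<in> Hom (Graph C) Z (gtimes C A X)"
      "gpr1 C A X \<odot> u = g" "gpr2 C A X \<odot> u = x" "a \<odot> u = x"
      unfolding fixes_elt_def fixing_def by blast
    have g: "g \<in> Hom (Graph C) Z KG" and x: "x \<in> Hom (Graph C) Z X"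
      using u gcmp_hom[OF pr(1) u(1)] gcmp_hom[OF pr(2) u(1)] by simp_all
    have "u = graph_tuple C A X Z g x"
      using gtimes_eqI[OF car_ob X_ob u(1) graph_tuple_hom[OF X_ob g x]]
        gpr1_tuple[OF X_ob g x] gpr2_tuple[OF X_ob g x] u by simp
    then show "g \<in> Hom (Graph C) Z KG \<and> x \<in> Hom (Graph C) Z X \<and>
      elt_act C G (gE X) (fst a) (gE Z) (fst g) (fst x) = fst x \<and>
      elt_act C G (gV X) (snd a) (gV Z) (snd g) (snd x) = snd x"
      using ev u(4) g x by (auto simp: prod_eq_iff)
  next
    assume r: "g \<in> Hom (Graph C) Z KG \<and> x \<in> Hom (Graph C) Z X \<and>
      elt_act C G (gE X) (fst a) (gE Z) (fst g) (fst x) = fst x \<and>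
      elt_act C G (gV X) (snd a) (gV Z) (snd g) (snd x) = snd x"
    then have g: "g \<in> Hom (Graph C) Z KG" and x: "x \<in> Hom (Graph C) Z X" by blast+
    have "a \<odot> graph_tuple C A X Z g x = x" using ev r by (simp add: prod_eq_iff)
    then show "fixes_elt Z g x"
      unfolding fixes_elt_def fixing_def
      using graph_tuple_hom[OF X_ob g x] gpr1_tuple[OF X_ob g x] gpr2_tuple[OF X_ob g x] by blast
  qed
qed

lemma elt_stabiliser_subgroup:
  assumes act: "is_action C G Y b" and x: "x \<in> Hom C Z Y"
  shows "elt_act C G Y b Z (elt_unt C G Z) x = x"
    and "\<lbrakk>g \<in> Hom C Z A; h \<in> Hom C Z A; elt_act C G Y b Z g x = x; elt_act C G Y b Z h x = x\<rbrakk>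
      \<Longrightarrow> elt_act C G Y b Z (elt_mul C G Z g h) x = x"
    and "\<lbrakk>g \<in> Hom C Z A; elt_act C G Y b Z g x = x\<rbrakk>
      \<Longrightarrow> elt_act C G Y b Z (ivs G \<cdot> g) x = x"
proof -
  note ac = act[unfolded action_iff[OF G]]
  have unit: "elt_act C G Y b Z (elt_unt C G Z) x = x" using ac x by blast
  have mult: "elt_act C G Y b Z (elt_mul C G Z g h) x = elt_act C G Y b Z g (elt_act C G Y b Z h x)"
    if "g \<in> Hom C Z A" "h \<in> Hom C Z A" for g h
    using ac x that by blast
  show "elt_act C G Y b Z (elt_unt C G Z) x = x" by (rule unit)
  show "\<lbrakk>g \<in> Hom C Z A; h \<in> Hom C Z A; elt_act C G Y b Z g x = x; elt_act C G Y b Z h x = x\<rbrakk>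
      \<Longrightarrow> elt_act C G Y b Z (elt_mul C G Z g h) x = x"
    using mult by simp
  assume g: "g \<in> Hom C Z A" "elt_act C G Y b Z g x = x"
  show "elt_act C G Y b Z (ivs G \<cdot> g) x = x"
    using mult[OF cmp_hom[OF ivs_hom g(1)] g(1)] elt_laws(3)[OF g(1)] unit g(2) by simp
qed

lemma fixes_elt_subgroup:
  assumes x: "x \<in> Hom (Graph C) Z X"
  shows "fixes_elt Z (graph_unt C G Z) x"
    and "\<lbrakk>fixes_elt Z g x; fixes_elt Z h x\<rbrakk> \<Longrightarrow> fixes_elt Z (graph_mul C G Z g h) x"
    and "fixes_elt Z g x \<Longrightarrow> fixes_elt Z (graph_ivs C G g) x"
proof -
  have xE: "fst x \<in> Hom C (gE Z) (gE X)" and xV: "snd x \<in> Hom C (gV Z) (gV X)"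
    using x unfolding Graph_Hom by blast+
  note E = elt_stabiliser_subgroup[OF act_E xE] and V = elt_stabiliser_subgroup[OF act_V xV]
  show "fixes_elt Z (graph_unt C G Z) x"
    unfolding fixes_elt_iff using x graph_unt_hom[OF gdom[OF x]] E(1) V(1) by simp
  show "fixes_elt Z (graph_mul C G Z g h) x" if "fixes_elt Z g x" "fixes_elt Z h x"
    using that graph_mul_hom[of g Z h] E(2)[of "fst g" "fst h"] V(2)[of "snd g" "snd h"]
    unfolding fixes_elt_iff by (simp add: const_graph_hom)
  show "fixes_elt Z (graph_ivs C G g) x" if "fixes_elt Z g x"
    using that graph_ivs_hom[of g Z] E(3)[of "fst g"] V(3)[of "snd g"]
    unfolding fixes_elt_iff by (simp add: const_graph_hom)
qed

end

locale G_graph_stabiliser = G_graph C G X a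
    for C :: "('o, 'm) cat" (structure) and G :: "('o, 'm) grpobj"
    and X :: "('o, 'm) graph" and a :: "'m \<times> 'm" +
  fixes S :: "('o, 'm) graph" and k :: "'m \<times> 'm"
  assumes stabiliser: "is_equaliser (Graph C) (gtimes C (car G) X) X a (gpr2 C (car G) X) S k"
begin

lemma k_hom: "k \<in> Hom (Graph C) S (gtimes C A X)"
  using stabiliser unfolding is_equaliser_def by blast

lemmas pr_hom = gtimes_pr_hom[OF car_ob X_ob]

lemma stabiliser_represents:
  "represents_subgroup X (S, gpr2 C A X \<odot> k) (gpr1 C A X \<odot> k) (\<lambda>Y f. fixes_elt (fst Y) f (snd Y))"
proof -
  let ?Z = "(S, gpr2 C A X \<odot> k)"
  note Z = gcmp_hom[OF pr_hom(2) k_hom]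
  note fx = category.stabiliser_fixing[OF gcategory gtimes_product[OF car_ob X_ob] stabiliser,
      folded fixes_elt_def]
  note fs = category.fixing_stabiliser[OF gcategory gtimes_product[OF car_ob X_ob] stabiliser,
      folded fixes_elt_def]
  show ?thesis
    unfolding represents_subgroup_def
  proof (intro conjI allI impI ballI)
    show "?Z \<in> Ob (slice (Graph C) X)" unfolding slice_Ob using Z by simp
    show "gpr1 C A X \<odot> k \<in> Hom (Graph C) (fst ?Z) KG"
      using gcmp_hom[OF pr_hom(1) k_hom] by simp
  next
    fix Y h assume "h \<in> Hom (slice (Graph C) X) Y ?Z"
    then show "fixes_elt (fst Y) ((gpr1 C A X \<odot> k) \<odot> h) (snd Y)"
      unfolding slice_Hom using fx[of h "fst Y"] by simp
  next
    fix Y f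
    assume Y: "Y \<in> Ob (slice (Graph C) X) \<and> f \<in> Hom (Graph C) (fst Y) KG \<and> fixes_elt (fst Y) f (snd Y)"
    have "h \<in> Hom (Graph C) (fst Y) S \<and> (gpr1 C A X \<odot> k) \<odot> h = f \<and> (gpr2 C A X \<odot> k) \<odot> h = snd Y \<longleftrightarrow>
        h \<in> Hom (slice (Graph C) X) Y ?Z \<and> (gpr1 C A X \<odot> k) \<odot> h = f" for h
      unfolding slice_Hom using Y[unfolded slice_Ob] Z by auto
    then show "\<exists>!h. h \<in> Hom (slice (Graph C) X) Y ?Z \<and> (gpr1 C A X \<odot> k) \<odot> h = f"
      using fs[of "fst Y" f "snd Y"] Y by simp
  qed (simp_all add: slice_Ob fixes_elt_subgroup)
qed

lemma stabiliser_structure: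
  "carries_structure X (S, gpr2 C A X \<odot> k) (gpr1 C A X \<odot> k) (stabiliser_grp C G X S k)"
  unfolding stabiliser_grp_def using X_ob stabiliser_represents by (rule induced_grp_structure)

end

locale graph_of_stabilisers = G_graph_stabiliser C G X a S k
    for C :: "('o, 'm) cat" (structure) and G :: "('o, 'm) grpobj"
    and X :: "('o, 'm) graph" and a :: "'m \<times> 'm"
    and S :: "('o, 'm) graph" and k :: "'m \<times> 'm" +
  fixes Q P :: "('o, 'm) graph" and s \<sigma> p :: "'m \<times> 'm"
  assumes s: "s \<in> Hom (Graph C) Q X"
    and pullback: "is_pullback (Graph C) S Q X (gpr2 C (car G) X \<cdot>\<^bsub>Graph C\<^esub> k) s P \<sigma> p"
begin

abbreviation "sG \<equiv> pullback_grp (Graph C) Q X s (stabiliser_grp C G X S k) P \<sigma> p"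

text \<open>
  An element of \<open>P\<close> consists of an element of \<open>Q\<close> and an element of \<open>G\<close>; \<open>\<delta>\<close> extracts the latter.
\<close>

abbreviation "\<delta> \<equiv> (gpr1 C A X \<odot> k) \<odot> \<sigma>"

lemma \<sigma>_hom: "\<sigma> \<in> Hom (Graph C) P S" and p_hom: "p \<in> Hom (Graph C) P Q"
  and \<sigma>_p: "(gpr2 C A X \<odot> k) \<odot> \<sigma> = s \<odot> p"
  using pullback unfolding is_pullback_def by blast+

lemma Q_ob: "Q \<in> Ob (Graph C)"
  using gdom[OF s] .

lemmas \<delta>_hom = gcmp_hom[OF gcmp_hom[OF pr_hom(1) k_hom] \<sigma>_hom]

lemma pullback_represents:
  "represents_subgroup Q (P, p) \<delta> (\<lambda>Y f. fixes_elt (fst Y) f (s \<odot> snd Y))"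
proof -
  note fx = category.pullback_stabiliser_fixing[OF gcategory gtimes_product[OF car_ob X_ob]
      stabiliser pullback, folded fixes_elt_def]
  note fs = category.fixing_pullback_stabiliser[OF gcategory gtimes_product[OF car_ob X_ob]
      stabiliser pullback, folded fixes_elt_def]
  have sY: "s \<odot> snd Y \<in> Hom (Graph C) (fst Y) X" if "Y \<in> Ob (slice (Graph C) Q)" for Y
    using that gcmp_hom[OF s] unfolding slice_Ob by blast
  show ?thesis
    unfolding represents_subgroup_def
  proof (intro conjI allI impI ballI)
    show "(P, p) \<in> Ob (slice (Graph C) Q)" unfolding slice_Ob using p_hom by simp
    show "\<delta> \<in> Hom (Graph C) (fst (P, p)) KG" using \<delta>_hom by simp
  next
    fix Y h assume "h \<in> Hom (slice (Graph C) Q) Y (P, p)"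
    then show "fixes_elt (fst Y) (\<delta> \<odot> h) (s \<odot> snd Y)"
      unfolding slice_Hom using fx[of h "fst Y"] by auto
  next
    fix Y f
    assume Y: "Y \<in> Ob (slice (Graph C) Q) \<and> f \<in> Hom (Graph C) (fst Y) KG \<and>
      fixes_elt (fst Y) f (s \<odot> snd Y)"
    have "h \<in> Hom (Graph C) (fst Y) P \<and> \<delta> \<odot> h = f \<and> p \<odot> h = snd Y \<longleftrightarrow>
        h \<in> Hom (slice (Graph C) Q) Y (P, p) \<and> \<delta> \<odot> h = f" for h
      unfolding slice_Hom using Y[unfolded slice_Ob] p_hom by auto
    then show "\<exists>!h. h \<in> Hom (slice (Graph C) Q) Y (P, p) \<and> \<delta> \<odot> h = f"
      using fs[of "snd Y" "fst Y" f] Y[unfolded slice_Ob] by simp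
  qed (simp_all add: sY fixes_elt_subgroup)
qed

text \<open>
  The structure that \<open>P\<close> obtains as a pullback of the group object \<open>S\<close> over \<open>X\<close> is the one that it
  inherits from \<open>G\<close>. An object \<open>Y\<close> over \<open>Q\<close> becomes an object over \<open>X\<close> by composition with \<open>s\<close>, written
  \<open>push Y\<close>; arrows over \<open>Q\<close> from \<open>Y\<close> to \<open>P\<close> correspond to arrows over \<open>X\<close> from \<open>push Y\<close> to \<open>S\<close>, which
  explains why each operation exists and what \<open>\<delta>\<close> makes of it.
\<close>

lemma pullback_structure: "carries_structure Q (P, p) \<delta> sG"
proof -
  define DQ where "DQ = slice (Graph C) Q"
  define DX where "DX = slice (Graph C) X"
  interpret DQ: cartesian DQ unfolding DQ_def using lim Q_ob by (rule Graph_slice_cartesian)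
  interpret DX: cartesian DX unfolding DX_def using lim X_ob by (rule Graph_slice_cartesian)
  have Dc [simp]: "cmp DQ = cmp (Graph C)" "cmp DX = cmp (Graph C)"
    unfolding DQ_def DX_def by simp_all
  let ?r = "gpr2 C A X \<odot> k" and ?\<gamma> = "gpr1 C A X \<odot> k"
  let ?H = "stabiliser_grp C G X S k"
  let ?U = "(S, ?r)" and ?Z = "(P, p)"
  define push where "push = (\<lambda>(Y, r). (Y :: ('o, 'm) graph, s \<odot> r))"
  have pushs: "fst (push Y) = fst Y" "snd (push Y) = s \<odot> snd Y" for Y
    unfolding push_def by (simp_all add: case_prod_unfold)
  have pushO: "push Y \<in> Ob DX" if "Y \<in> Ob DQ" for Y
    using that gcmp_hom[OF s] unfolding DQ_def DX_def slice_Ob pushs by blast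
  have H: "car ?H = ?U" "mul ?H \<in> Hom DX (prd DX ?U ?U) ?U"
     "?\<gamma> \<odot> mul ?H = graph_mul C G (fst (prd DX ?U ?U)) (?\<gamma> \<odot> pr1 DX ?U ?U) (?\<gamma> \<odot> pr2 DX ?U ?U)"
     "unt ?H \<in> Hom DX (one DX) ?U" "?\<gamma> \<odot> unt ?H = graph_unt C G (fst (one DX))"
     "ivs ?H \<in> Hom DX ?U ?U" "?\<gamma> \<odot> ivs ?H = graph_ivs C G ?\<gamma>"
    using stabiliser_structure unfolding carries_structure_def Let_def DX_def by blast+
  have r: "?r \<in> Hom (Graph C) S X" and \<gamma>: "?\<gamma> \<in> Hom (Graph C) S KG"
    using gcmp_hom[OF pr_hom(2) k_hom] gcmp_hom[OF pr_hom(1) k_hom] .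
  have U: "?U \<in> Ob DX" and Z: "?Z \<in> Ob DQ"
    unfolding DX_def DQ_def slice_Ob using r p_hom by simp_all
  have grQ: "h \<in> Hom (Graph C) (fst Y) (fst Y')" if "h \<in> Hom DQ Y Y'" for h Y Y'
    using that over_hom unfolding DQ_def by blast
  have grX: "h \<in> Hom (Graph C) (fst Y) (fst Y')" if "h \<in> Hom DX Y Y'" for h Y Y'
    using that over_hom unfolding DX_def by blast
  have \<sigma>push: "\<sigma> \<odot> h \<in> Hom DX (push Y) ?U" if "h \<in> Hom DQ Y ?Z" for h Y
  proof -
    have h: "snd Y \<in> Hom (Graph C) (fst Y) Q" "h \<in> Hom (Graph C) (fst Y) P" "p \<odot> h = snd Y"
      using that unfolding DQ_def slice_Hom by simp_all
    have "?r \<odot> \<sigma> \<odot> h = s \<odot> snd Y"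
      using gassoc[OF r \<sigma>_hom h(2)] gassoc[OF s p_hom h(2)] \<sigma>_p h(3) by simp
    then show ?thesis
      unfolding DX_def slice_Hom pushs using r gcmp_hom[OF \<sigma>_hom h(2)] gcmp_hom[OF s h(1)] by simp
  qed
  have lift: "\<exists>!h. h \<in> Hom DQ Y ?Z \<and> \<sigma> \<odot> h = M"
    if Y: "Y \<in> Ob DQ" and M: "M \<in> Hom DX (push Y) ?U" for Y M
  proof -
    have y: "snd Y \<in> Hom (Graph C) (fst Y) Q" using Y unfolding DQ_def slice_Ob .
    have "M \<in> Hom (Graph C) (fst Y) S" "?r \<odot> M = s \<odot> snd Y"
      using M unfolding DX_def slice_Hom pushs by simp_all
    then have "\<exists>!h. h \<in> Hom (Graph C) (fst Y) P \<and> \<sigma> \<odot> h = M \<and> p \<odot> h = snd Y"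
      using pullback y unfolding is_pullback_def by blast
    moreover have "h \<in> Hom DQ Y ?Z \<and> \<sigma> \<odot> h = M \<longleftrightarrow>
        h \<in> Hom (Graph C) (fst Y) P \<and> \<sigma> \<odot> h = M \<and> p \<odot> h = snd Y" for h
      unfolding DQ_def slice_Hom using y p_hom by auto
    ultimately show ?thesis by simp
  qed
  have \<delta>: "\<delta> \<odot> h = ?\<gamma> \<odot> M" if "h \<in> Hom DQ Y ?Z" "\<sigma> \<odot> h = M" for h Y M
    using gassoc[OF \<gamma> \<sigma>_hom, of h "fst Y"] grQ[OF that(1)] that(2) by simp
  let ?W = "prd DQ ?Z ?Z" and ?T = "one DQ"
  have W: "?W \<in> Ob DQ" and T: "?T \<in> Ob DQ" using Z DQ.prd_ob DQ.one_ob by blast+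
  note p1 = DQ.pr1_hom[OF Z Z] and p2 = DQ.pr2_hom[OF Z Z]
  let ?u = "pair DX (push ?W) ?U ?U (\<sigma> \<odot> pr1 DQ ?Z ?Z) (\<sigma> \<odot> pr2 DQ ?Z ?Z)"
  note u = DX.pair_hom[OF \<sigma>push[OF p1] \<sigma>push[OF p2]]
  have "mul ?H \<odot> ?u \<in> Hom DX (push ?W) ?U"
    using DX.cmp_hom[OF H(2) u] by simp
  from theI'[OF lift[OF W this]]
  have m: "mul sG \<in> Hom DQ ?W ?Z" "\<sigma> \<odot> mul sG = mul ?H \<odot> ?u"
    unfolding pullback_grp_def Let_def DQ_def[symmetric] DX_def[symmetric] push_def[symmetric] H(1)
    by simp_all
  have "\<delta> \<odot> mul sG = (?\<gamma> \<odot> mul ?H) \<odot> ?u"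
    using \<delta>[OF m] gassoc[OF \<gamma> _ grX[OF u], of "mul ?H"] grX[OF H(2)] by simp
  also have "\<dots> = graph_mul C G (fst ?W) ((?\<gamma> \<odot> pr1 DX ?U ?U) \<odot> ?u) ((?\<gamma> \<odot> pr2 DX ?U ?U) \<odot> ?u)"
    unfolding H(3)
    using graph_mul_cmp[OF gcmp_hom[OF \<gamma>] gcmp_hom[OF \<gamma>] grX[OF u]]
      grX[OF DX.pr1_hom[OF U U]] grX[OF DX.pr2_hom[OF U U]] pushs by simp
  also have "(?\<gamma> \<odot> pr1 DX ?U ?U) \<odot> ?u = \<delta> \<odot> pr1 DQ ?Z ?Z"
    using gassoc[OF \<gamma> _ grX[OF u], of "pr1 DX ?U ?U"] grX[OF DX.pr1_hom[OF U U]]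
      DX.pr1_pair[OF \<sigma>push[OF p1] \<sigma>push[OF p2]] \<delta>[OF p1 refl] by simp
  also have "(?\<gamma> \<odot> pr2 DX ?U ?U) \<odot> ?u = \<delta> \<odot> pr2 DQ ?Z ?Z"
    using gassoc[OF \<gamma> _ grX[OF u], of "pr2 DX ?U ?U"] grX[OF DX.pr2_hom[OF U U]]
      DX.pr2_pair[OF \<sigma>push[OF p1] \<sigma>push[OF p2]] \<delta>[OF p2 refl] by simp
  finally have m': "\<delta> \<odot> mul sG = graph_mul C G (fst ?W) (\<delta> \<odot> pr1 DQ ?Z ?Z) (\<delta> \<odot> pr2 DQ ?Z ?Z)" .
  note b = DX.bang_hom[OF pushO[OF T]]
  have "unt ?H \<odot> bang DX (push ?T) \<in> Hom DX (push ?T) ?U"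
    using DX.cmp_hom[OF H(4) b] by simp
  from theI'[OF lift[OF T this]]
  have e: "unt sG \<in> Hom DQ ?T ?Z" "\<sigma> \<odot> unt sG = unt ?H \<odot> bang DX (push ?T)"
    unfolding pullback_grp_def Let_def DQ_def[symmetric] DX_def[symmetric] push_def[symmetric] H(1)
    by simp_all
  have "\<delta> \<odot> unt sG = (?\<gamma> \<odot> unt ?H) \<odot> bang DX (push ?T)"
    using \<delta>[OF e] gassoc[OF \<gamma> _ grX[OF b], of "unt ?H"] grX[OF H(4)] by simp
  also have "\<dots> = graph_unt C G (fst ?T)"
    unfolding H(5) using graph_unt_cmp[OF grX[OF b]] pushs by simp
  finally have e': "\<delta> \<odot> unt sG = graph_unt C G (fst ?T)" .
  have \<sigma>Z: "\<sigma> \<in> Hom DX (push ?Z) ?U"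
    using \<sigma>push[OF DQ.idt_hom[OF Z]] gidt_right[OF \<sigma>_hom] unfolding DQ_def slice_idt by simp
  have "ivs ?H \<odot> \<sigma> \<in> Hom DX (push ?Z) ?U"
    using DX.cmp_hom[OF H(6) \<sigma>Z] by simp
  from theI'[OF lift[OF Z this]]
  have i: "ivs sG \<in> Hom DQ ?Z ?Z" "\<sigma> \<odot> ivs sG = ivs ?H \<odot> \<sigma>"
    unfolding pullback_grp_def Let_def DQ_def[symmetric] DX_def[symmetric] push_def[symmetric] H(1)
    by simp_all
  have "\<delta> \<odot> ivs sG = (?\<gamma> \<odot> ivs ?H) \<odot> \<sigma>"
    using \<delta>[OF i] gassoc[OF \<gamma> _ \<sigma>_hom, of "ivs ?H"] grX[OF H(6)] by simp
  also have "\<dots> = graph_ivs C G \<delta>"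
    unfolding H(7) using graph_ivs_cmp[OF \<gamma> \<sigma>_hom] .
  finally have i': "\<delta> \<odot> ivs sG = graph_ivs C G \<delta>" .
  have "car sG = ?Z" unfolding pullback_grp_def Let_def by simp
  then show ?thesis
    unfolding carries_structure_def Let_def DQ_def[symmetric] using m(1) m' e(1) e' i(1) i' by blast
qed

lemma sG_group_object: "sG \<in> Ob (Grp (slice (Graph C) Q))"
  unfolding Grp_def using structure_group_object[OF Q_ob pullback_represents pullback_structure] by simp

text \<open>
  The embedding \<open>\<psi>\<close> of \<open>s\<^sup>*G\<^sub>X\<close> into \<open>G \<times> Q\<close> has \<open>\<delta>\<close> as its component in \<open>G\<close>, and it lies
  over \<open>Q\<close> because \<open>q\<close> cancels \<open>s\<close>; hence it is a homomorphism.
\<close>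

lemma
  assumes q: "q \<in> Hom (Graph C) X Q" "q \<odot> s = idt (Graph C) Q"
  defines "\<psi> \<equiv> gcross C A X A Q (idt C A) q \<odot> k \<odot> \<sigma>"
  shows stabiliser_inclusion_hom: "\<psi> \<in> Hom (Grp (slice (Graph C) Q)) sG (FO (Delta C Q) G)"
    and gpr1_stabiliser_inclusion: "gpr1 C A Q \<odot> \<psi> = \<delta>"
proof -
  let ?c = "gcross C A X A Q (idt C A) q"
  note qx = gcmp_hom[OF q(1) pr_hom(2)]
  have idp: "idt C A \<cdot> pr1 C A (gE X) = pr1 C A (gE X)" "idt C A \<cdot> pr1 C A (gV X) = pr1 C A (gV X)"
    using idt_left pr1_hom[OF car_ob] graph_edges_vertices_ob[OF X_ob] by blast+
  have "?c = graph_tuple C A Q (gtimes C A X) (gpr1 C A X) (q \<odot> gpr2 C A X)"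
    unfolding gcross_def graph_tuple_def cross_def idp by (simp add: gtimes_def gpr1_def gpr2_def)
  then have c: "?c \<in> Hom (Graph C) (gtimes C A X) (gtimes C A Q)"
    "gpr1 C A Q \<odot> ?c = gpr1 C A X" "gpr2 C A Q \<odot> ?c = q \<odot> gpr2 C A X"
    using graph_tuple_hom[OF Q_ob pr_hom(1) qx] gpr1_tuple[OF Q_ob pr_hom(1) qx]
      gpr2_tuple[OF Q_ob pr_hom(1) qx] by simp_all
  note pQ = gtimes_pr_hom[OF car_ob Q_ob]
  note k\<sigma> = gcmp_hom[OF k_hom \<sigma>_hom]
  have \<psi>: "\<psi> \<in> Hom (Graph C) P (gtimes C A Q)"
    unfolding \<psi>_def using gcmp_hom[OF c(1) k\<sigma>] .
  show 1: "gpr1 C A Q \<odot> \<psi> = \<delta>"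
    unfolding \<psi>_def using gassoc[OF pQ(1) c(1) k\<sigma>] c(2) gassoc[OF pr_hom(1) k_hom \<sigma>_hom] by simp
  have "gpr2 C A Q \<odot> \<psi> = q \<odot> gpr2 C A X \<odot> k \<odot> \<sigma>"
    unfolding \<psi>_def using gassoc[OF pQ(2) c(1) k\<sigma>] c(3) gassoc[OF q(1) pr_hom(2) k\<sigma>] by simp
  also have "\<dots> = (q \<odot> s) \<odot> p"
    using gassoc[OF pr_hom(2) k_hom \<sigma>_hom] \<sigma>_p gassoc[OF q(1) s p_hom] by simp
  also have "\<dots> = p" using q(2) gidt_left[OF p_hom] by simp
  finally have "\<psi> \<in> Hom (slice (Graph C) Q) (P, p) (gtimes C A Q, gpr2 C A Q)"
    unfolding slice_Hom using \<psi> pQ(2) p_hom by simp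
  then show "\<psi> \<in> Hom (Grp (slice (Graph C) Q)) sG (FO (Delta C Q) G)"
    using structure_morphism[OF Q_ob pullback_represents pullback_structure
      Delta_represents[OF Q_ob] Delta_structure[OF Q_ob]] 1 by blast
qed

end

section \<open>Coequalisers of graphs\<close>

context finitely_complete
begin

text \<open>
  A functor from graphs to \<open>C\<close> with a right adjoint preserves coequalisers. The right adjoint is
  given objectwise: \<open>K\<close> is its value at \<open>Z\<close>, and the counit at \<open>Z\<close> is an identity.
\<close>

lemma coequaliser_component:
  fixes ob :: "('o, 'm) graph \<Rightarrow> 'o" and ar :: "'m \<times> 'm \<Rightarrow> 'm"
  assumes hom: "\<And>f X Y. f \<in> Hom (Graph C) X Y \<Longrightarrow> ar f \<in> Hom C (ob X) (ob Y)"
    and cmp: "\<And>f g. ar (g \<odot> f) = ar g \<cdot> ar f"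
    and radj: "\<And>Z. Z \<in> Ob C \<Longrightarrow> \<exists>K. ob K = Z \<and>
        (\<forall>Y\<in>Ob (Graph C). \<forall>h\<in>Hom C (ob Y) Z. \<exists>!u. u \<in> Hom (Graph C) Y K \<and> ar u = h)"
    and co: "is_coequaliser (Graph C) W X f g Q q"
  shows "is_coequaliser C (ob W) (ob X) (ar f) (ar g) (ob Q) (ar q)"
proof -
  have f: "f \<in> Hom (Graph C) W X" and g: "g \<in> Hom (Graph C) W X"
    and q: "q \<in> Hom (Graph C) X Q" and qfg: "q \<odot> f = q \<odot> g"
    and univ: "\<And>K h. h \<in> Hom (Graph C) X K \<Longrightarrow> h \<odot> f = h \<odot> g \<Longrightarrow>
      \<exists>!u. u \<in> Hom (Graph C) Q K \<and> u \<odot> q = h"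
    using co unfolding is_coequaliser_def by blast+
  show ?thesis
    unfolding is_coequaliser_def
  proof (intro conjI allI impI hom[OF f] hom[OF g] hom[OF q])
    show "ar q \<cdot> ar f = ar q \<cdot> ar g" using qfg cmp by metis
    fix Z h assume h: "h \<in> Hom C (ob X) Z \<and> h \<cdot> ar f = h \<cdot> ar g"
    then obtain K where K: "ob K = Z" "\<And>Y h. Y \<in> Ob (Graph C) \<Longrightarrow> h \<in> Hom C (ob Y) Z \<Longrightarrow>
        \<exists>!u. u \<in> Hom (Graph C) Y K \<and> ar u = h"
      using radj[of Z] hom_cod by blast
    have inj: "u = v" if "u \<in> Hom (Graph C) Y K" "v \<in> Hom (Graph C) Y K" "ar u = ar v" for u v Y
      using K(2)[OF gdom[OF that(1)], of "ar u"] hom[OF that(1)] that K(1) by auto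
    obtain l where l: "l \<in> Hom (Graph C) X K" "ar l = h" using K(2)[OF gdom[OF q]] h by blast
    have "l \<odot> f = l \<odot> g"
      by (rule inj[OF gcmp_hom[OF l(1) f] gcmp_hom[OF l(1) g]]) (simp add: cmp l h)
    then obtain u where u: "u \<in> Hom (Graph C) Q K" "u \<odot> q = l"
      and uniq: "\<And>v. v \<in> Hom (Graph C) Q K \<Longrightarrow> v \<odot> q = l \<Longrightarrow> v = u"
      using univ[OF l(1)] by blast
    show "\<exists>!u. u \<in> Hom C (ob Q) Z \<and> u \<cdot> ar q = h"
    proof (rule ex1I[of _ "ar u"])
      show "ar u \<in> Hom C (ob Q) Z \<and> ar u \<cdot> ar q = h"
        using hom[OF u(1)] K(1) u(2) l(2) cmp[of u q] by simp
      fix v assume v: "v \<in> Hom C (ob Q) Z \<and> v \<cdot> ar q = h"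
      then obtain v' where v': "v' \<in> Hom (Graph C) Q K" "ar v' = v"
        using K(2)[OF gcod[OF q]] by blast
      have "v' \<odot> q = l"
        by (rule inj[OF gcmp_hom[OF v'(1) q] l(1)]) (simp add: cmp l v' v)
      then show "v = ar u" using uniq v' by blast
    qed
  qed
qed

text \<open>
  The right adjoint of the vertex functor is the complete graph, with exactly one edge between
  any two vertices.
\<close>

lemma coequaliser_vertices:
  assumes "is_coequaliser (Graph C) W X f g Q q"
  shows "is_coequaliser C (gV W) (gV X) (snd f) (snd g) (gV Q) (snd q)"
proof (rule coequaliser_component[OF _ _ _ assms])
  fix Z assume Z: "Z \<in> Ob C"
  let ?K = "\<lparr>gE = prd C Z Z, gV = Z, gd0 = pr1 C Z Z, gd1 = pr2 C Z Z\<rparr>"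
  have "\<exists>!u. u \<in> Hom (Graph C) Y ?K \<and> snd u = h"
    if Y: "Y \<in> Ob (Graph C)" and h: "h \<in> Hom C (gV Y) Z" for Y h
  proof (rule ex1I[of _ "(pair C (gE Y) Z Z (h \<cdot> gd0 Y) (h \<cdot> gd1 Y), h)"])
    note Y' = Y[unfolded Graph_Ob]
    have hd: "h \<cdot> gd0 Y \<in> Hom C (gE Y) Z" "h \<cdot> gd1 Y \<in> Hom C (gE Y) Z"
      using cmp_hom[OF h] Y' by blast+
    show "(pair C (gE Y) Z Z (h \<cdot> gd0 Y) (h \<cdot> gd1 Y), h) \<in> Hom (Graph C) Y ?K \<and>
        snd (pair C (gE Y) Z Z (h \<cdot> gd0 Y) (h \<cdot> gd1 Y), h) = h"
      unfolding Graph_Hom Graph_Ob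
      using Y' h pr1_hom[OF Z Z] pr2_hom[OF Z Z] pair_hom[OF hd] pr1_pair[OF hd] pr2_pair[OF hd]
      by simp
    fix u assume u: "u \<in> Hom (Graph C) Y ?K \<and> snd u = h"
    then have "fst u = pair C (gE Y) Z Z (h \<cdot> gd0 Y) (h \<cdot> gd1 Y)"
      unfolding Graph_Hom by (intro pair_unique Z) auto
    then show "u = (pair C (gE Y) Z Z (h \<cdot> gd0 Y) (h \<cdot> gd1 Y), h)"
      using u by (simp add: prod_eq_iff)
  qed
  then show "\<exists>K. gV K = Z \<and>
      (\<forall>Y\<in>Ob (Graph C). \<forall>h\<in>Hom C (gV Y) Z. \<exists>!u. u \<in> Hom (Graph C) Y K \<and> snd u = h)"
    by (intro exI[of _ ?K]) simp
qed (simp_all add: Graph_Hom)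

text \<open>
  The right adjoint of the edge functor makes all edges loops at a single vertex.
\<close>

lemma coequaliser_edges:
  assumes "is_coequaliser (Graph C) W X f g Q q"
  shows "is_coequaliser C (gE W) (gE X) (fst f) (fst g) (gE Q) (fst q)"
proof (rule coequaliser_component[OF _ _ _ assms])
  fix Z assume Z: "Z \<in> Ob C"
  let ?K = "\<lparr>gE = Z, gV = one C, gd0 = bang C Z, gd1 = bang C Z\<rparr>"
  have "\<exists>!u. u \<in> Hom (Graph C) Y ?K \<and> fst u = h"
    if Y: "Y \<in> Ob (Graph C)" and h: "h \<in> Hom C (gE Y) Z" for Y h
  proof (rule ex1I[of _ "(h, bang C (gV Y))"])
    note Y' = Y[unfolded Graph_Ob]
    show "(h, bang C (gV Y)) \<in> Hom (Graph C) Y ?K \<and> fst (h, bang C (gV Y)) = h"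
      unfolding Graph_Hom Graph_Ob
      using Y' h bang_hom[OF Z] bang_hom[of "gV Y"] graph_edges_vertices_ob[OF Y] bang_cmp[OF h]
        bang_cmp[of _ "gE Y" "gV Y"]
      by simp
    fix u assume u: "u \<in> Hom (Graph C) Y ?K \<and> fst u = h"
    then have "snd u = bang C (gV Y)"
      unfolding Graph_Hom by (intro bang_unique) auto
    then show "u = (h, bang C (gV Y))"
      using u by (simp add: prod_eq_iff)
  qed
  then show "\<exists>K. gE K = Z \<and>
      (\<forall>Y\<in>Ob (Graph C). \<forall>h\<in>Hom C (gE Y) Z. \<exists>!u. u \<in> Hom (Graph C) Y K \<and> fst u = h)"
    by (intro exI[of _ ?K]) simp
qed (simp_all add: Graph_Hom)

lemma cross_cmp:
  assumes "f \<in> Hom C A A'" "g \<in> Hom C B B'" "f' \<in> Hom C A' A''" "g' \<in> Hom C B' B''"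
  shows "cross C A' B' A'' B'' f' g' \<cdot> cross C A B A' B' f g
    = cross C A B A'' B'' (f' \<cdot> f) (g' \<cdot> g)"
proof -
  have o: "A \<in> Ob C" "B \<in> Ob C" using assms hom_dom by blast+
  note p = pr1_hom[OF o] pr2_hom[OF o]
  show ?thesis
    unfolding cross_def[of C A B A' B'] cross_def[of C A B A'' B'']
    using cross_pair[OF assms(3,4) cmp_hom[OF assms(1) p(1)] cmp_hom[OF assms(2) p(2)]]
      cmp_assoc[OF assms(3,1) p(1)] cmp_assoc[OF assms(4,2) p(2)] by simp
qed

lemma fixing_elt_act:
  assumes "X \<in> Ob C" "car G \<in> Ob C" "fixing C (prd C (car G) X) (pr1 C (car G) X) (pr2 C (car G) X) b Z g x"
  shows "elt_act C G X b Z g x = x"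
proof -
  obtain u where u: "u \<in> Hom C Z (prd C (car G) X)" "pr1 C (car G) X \<cdot> u = g"
    "pr2 C (car G) X \<cdot> u = x" "b \<cdot> u = x"
    using assms(3) unfolding fixing_def by blast
  then have "u = pair C Z (car G) X g x" using pair_unique assms(1,2) by blast
  then show ?thesis using u(4) unfolding elt_act_def by simp
qed

end

section \<open>Transitive actions and regular epimorphisms\<close>

context group_in_category
begin

text \<open>
  This is the reason why homomorphisms, which only respect multiplication by definition, preserve
  units.
\<close>

lemma elt_idempotent:
  assumes u: "u \<in> Hom C Z (car G)" and "elt_mul C G Z u u = u"
  shows "u = elt_unt C G Z"
  using elt_assoc[OF cmp_hom[OF ivs_hom u] u u] elt_laws[OF u] assms(2) by simp

lemma elt_ivs_ivs:
  assumes u: "u \<in> Hom C Z (car G)"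
  shows "ivs G \<cdot> ivs G \<cdot> u = u"
proof -
  note i = cmp_hom[OF ivs_hom u]
  show ?thesis
    using elt_assoc[OF cmp_hom[OF ivs_hom i] i u] elt_laws[OF u] elt_laws[OF i]
      elt_laws(2)[OF cmp_hom[OF ivs_hom i]] by simp
qed

lemma Grp_hom_elt:
  assumes f: "\<phi> \<in> Hom (Grp C) K G"
  shows "is_group_object C K" "\<phi> \<in> Hom C (car K) (car G)"
    and "\<lbrakk>x \<in> Hom C Z (car K); y \<in> Hom C Z (car K)\<rbrakk>
      \<Longrightarrow> \<phi> \<cdot> elt_mul C K Z x y = elt_mul C G Z (\<phi> \<cdot> x) (\<phi> \<cdot> y)"
    and "Z \<in> Ob C \<Longrightarrow> \<phi> \<cdot> elt_unt C K Z = elt_unt C G Z"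
proof -
  show K: "is_group_object C K" and \<phi>: "\<phi> \<in> Hom C (car K) (car G)"
    using f unfolding Grp_def by auto
  have m: "\<phi> \<cdot> mul K = mul G \<cdot> cross C (car K) (car K) (car G) (car G) \<phi> \<phi>"
    using f unfolding Grp_def by auto
  note K' = K[unfolded group_object_iff]
  have mult: "\<phi> \<cdot> elt_mul C K Z x y = elt_mul C G Z (\<phi> \<cdot> x) (\<phi> \<cdot> y)"
    if x: "x \<in> Hom C Z (car K)" and y: "y \<in> Hom C Z (car K)" for x y Z
  proof -
    have mk: "mul K \<in> Hom C (prd C (car K) (car K)) (car K)" using K' by blast
    show ?thesis
      unfolding elt_mul_def
      using cmp_assoc[OF \<phi> mk pair_hom[OF x y]] m cross_pair[OF \<phi> \<phi> x y]
        cmp_assoc[OF mul_hom cross_hom[OF \<phi> \<phi>] pair_hom[OF x y]] by simp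
  qed
  show "\<lbrakk>x \<in> Hom C Z (car K); y \<in> Hom C Z (car K)\<rbrakk>
      \<Longrightarrow> \<phi> \<cdot> elt_mul C K Z x y = elt_mul C G Z (\<phi> \<cdot> x) (\<phi> \<cdot> y)"
    by (rule mult)
  assume Z: "Z \<in> Ob C"
  have u: "elt_unt C K Z \<in> Hom C Z (car K)" using elt_unt_hom[of K Z] K' Z by blast
  have "elt_mul C K Z (elt_unt C K Z) (elt_unt C K Z) = elt_unt C K Z" using K' u by blast
  then show "\<phi> \<cdot> elt_unt C K Z = elt_unt C G Z"
    using elt_idempotent[OF cmp_hom[OF \<phi> u]] mult[OF u u] by simp
qed

text \<open>
  Let \<open>K\<close> act on \<open>G\<close> by \<open>(b, g) \<mapsto> \<phi> b \<cdot> g\<close>. By the hypothesis \<open>trans\<close> the quotient of this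
  action is terminal, so the unit of \<open>G\<close> is a section of the quotient map. The condition on orbits and
  stabilisers, applied to this section, exhibits \<open>K \<times> T \<rightarrow> G\<close>, \<open>(b, _) \<mapsto> \<phi> b\<close>, as a coequaliser,
  and this is \<open>\<phi>\<close> up to the isomorphism \<open>K \<times> T \<rightarrow> K\<close>.
\<close>

lemma regular_epi_if_transitive:
  assumes OST: "OST C" and T: "is_terminal C T"
    and f: "\<phi> \<in> Hom (Grp C) K G"
    and trans: "\<And>Z h t. \<lbrakk>h \<in> Hom C (car G) Z; t \<in> Hom C (car G) T;
      \<And>Y b g. \<lbrakk>b \<in> Hom C Y (car K); g \<in> Hom C Y (car G)\<rbrakk>
        \<Longrightarrow> h \<cdot> elt_mul C G Y (\<phi> \<cdot> b) g = h \<cdot> g\<rbrakk>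
      \<Longrightarrow> \<exists>z. z \<in> Hom C T Z \<and> h = z \<cdot> t"
  shows "regular_epi C (car K) (car G) \<phi>"
proof -
  let ?A = "car G" and ?B = "car K"
  note K = Grp_hom_elt(1)[OF f] and \<phi> = Grp_hom_elt(2)[OF f]
  have B: "?B \<in> Ob C" using hom_dom[OF \<phi>] .
  have TO: "T \<in> Ob C" and T1: "\<And>Y f g. f \<in> Hom C Y T \<Longrightarrow> g \<in> Hom C Y T \<Longrightarrow> f = g"
    and Tex: "\<And>Y. Y \<in> Ob C \<Longrightarrow> \<exists>t. t \<in> Hom C Y T"
    using T hom_dom unfolding is_terminal_def by blast+
  let ?I = "idt C ?A"
  note I = idt_hom[OF car_ob]
  define a where "a = mul G \<cdot> cross C ?B ?A ?A ?A \<phi> ?I"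
  have a: "a \<in> Hom C (prd C ?B ?A) ?A"
    unfolding a_def using cmp_hom[OF mul_hom cross_hom[OF \<phi> I]] .
  have a_pair: "a \<cdot> pair C Y ?B ?A b g = elt_mul C G Y (\<phi> \<cdot> b) g"
    if b: "b \<in> Hom C Y ?B" and g: "g \<in> Hom C Y ?A" for b g Y
    unfolding a_def elt_mul_def
    using cmp_assoc[OF mul_hom cross_hom[OF \<phi> I] pair_hom[OF b g]] cross_pair[OF \<phi> I b g]
      idt_left[OF g] by simp
  have act: "is_action C K ?A a"
    unfolding action_iff[OF K]
  proof (intro conjI allI impI car_ob a)
    fix Z x assume x: "x \<in> Hom C Z ?A"
    have "elt_unt C K Z \<in> Hom C Z ?B"
      using K hom_dom[OF x] elt_unt_hom[of K Z] unfolding group_object_iff by blast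
    then show "elt_act C K ?A a Z (elt_unt C K Z) x = x"
      unfolding elt_act_def using a_pair x Grp_hom_elt(4)[OF f hom_dom[OF x]] elt_laws(1)[OF x] by simp
  next
    fix Z g h x assume "g \<in> Hom C Z ?B \<and> h \<in> Hom C Z ?B \<and> x \<in> Hom C Z ?A"
    then have g: "g \<in> Hom C Z ?B" and h: "h \<in> Hom C Z ?B" and x: "x \<in> Hom C Z ?A" by blast+
    have gh: "elt_mul C K Z g h \<in> Hom C Z ?B"
      using K g h elt_mul_hom[of K g Z h] unfolding group_object_iff by blast
    note fg = cmp_hom[OF \<phi> g] and fh = cmp_hom[OF \<phi> h]
    show "elt_act C K ?A a Z (elt_mul C K Z g h) x = elt_act C K ?A a Z g (elt_act C K ?A a Z h x)"
      unfolding elt_act_def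
      using a_pair[OF gh x] a_pair[OF h x] a_pair[OF g elt_mul_hom[OF mul_hom fh x]]
        Grp_hom_elt(3)[OF f g h] elt_assoc[OF fg fh x] by simp
  qed
  obtain t where t: "t \<in> Hom C ?A T" using Tex[OF car_ob] by blast
  note p2 = pr2_hom[OF B car_ob]
  have quot: "is_coequaliser C (prd C ?B ?A) ?A a (pr2 C ?B ?A) T t"
    unfolding is_coequaliser_def
  proof (intro conjI allI impI a p2 t)
    show "t \<cdot> a = t \<cdot> pr2 C ?B ?A" using T1[OF cmp_hom[OF t a] cmp_hom[OF t p2]] .
    fix Z h assume h: "h \<in> Hom C ?A Z \<and> h \<cdot> a = h \<cdot> pr2 C ?B ?A"
    have "h \<cdot> elt_mul C G Y (\<phi> \<cdot> b) g = h \<cdot> g"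
      if b: "b \<in> Hom C Y ?B" and g: "g \<in> Hom C Y ?A" for Y b g
    proof -
      have "h \<cdot> elt_mul C G Y (\<phi> \<cdot> b) g = (h \<cdot> a) \<cdot> pair C Y ?B ?A b g"
        using a_pair[OF b g] cmp_assoc[OF _ a pair_hom[OF b g], of h Z] h by simp
      also have "\<dots> = h \<cdot> pr2 C ?B ?A \<cdot> pair C Y ?B ?A b g"
        using h cmp_assoc[OF _ p2 pair_hom[OF b g], of h Z] by simp
      finally show ?thesis using pr2_pair[OF b g] by simp
    qed
    then obtain z where z: "z \<in> Hom C T Z" "h = z \<cdot> t" using trans[of h Z t] h t by blast
    show "\<exists>!u. u \<in> Hom C T Z \<and> u \<cdot> t = h"
    proof (rule ex1I[of _ z])
      fix u assume u: "u \<in> Hom C T Z \<and> u \<cdot> t = h"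
      let ?s = "elt_unt C G T"
      have s: "?s \<in> Hom C T ?A" using elt_unt_hom[OF unt_hom TO] .
      have ts: "t \<cdot> ?s = idt C T" using T1[OF cmp_hom[OF t s] idt_hom[OF TO]] .
      have "u \<cdot> t \<cdot> ?s = z \<cdot> t \<cdot> ?s"
        using cmp_assoc[OF _ t s, of u Z] cmp_assoc[OF z(1) t s] u z(2) by simp
      then show "u = z" unfolding ts using idt_right[OF z(1)] idt_right[of u T Z] u by simp
    qed (use z in simp)
  qed
  define s where "s = elt_unt C G T"
  have s: "s \<in> Hom C T ?A" unfolding s_def using elt_unt_hom[OF unt_hom TO] .
  have ts: "t \<cdot> s = idt C T" using T1[OF cmp_hom[OF t s] idt_hom[OF TO]] .
  obtain S k where S: "is_equaliser C (prd C ?B ?A) ?A a (pr2 C ?B ?A) S k"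
    using finite_limits_equaliser[OF lim a p2] by blast
  then have k: "k \<in> Hom C S (prd C ?B ?A)" unfolding is_equaliser_def by blast
  obtain P \<sigma> p where P: "is_pullback C S T ?A (pr2 C ?B ?A \<cdot> k) s P \<sigma> p"
    using finite_limits_pullback[OF lim cmp_hom[OF p2 k] s] by blast
  have KO: "K \<in> Ob (Grp C)" using K unfolding Grp_def by simp
  define e where "e = a \<cdot> cross C ?B T ?B ?A (idt C ?B) s"
  obtain u v where co: "is_coequaliser C (prd C ?B P) (prd C ?B T) u v ?A e"
    using OST KO act quot s ts S P unfolding OST_def Let_def e_def by blast
  obtain tB where tB: "tB \<in> Hom C ?B T" using Tex[OF B] by blast
  let ?J = "idt C ?B"
  note J = idt_hom[OF B]
  define j where "j = pair C ?B ?B T ?J tB"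
  have j: "j \<in> Hom C ?B (prd C ?B T)" and p1j: "pr1 C ?B T \<cdot> j = ?J"
    unfolding j_def using pair_hom[OF J tB] pr1_pair[OF J tB] .
  note p1 = pr1_hom[OF B TO] and p2T = pr2_hom[OF B TO]
  have jp1: "j \<cdot> pr1 C ?B T = idt C (prd C ?B T)"
  proof (rule prd_eqI[OF B TO cmp_hom[OF j p1] idt_hom[OF prd_ob[OF B TO]]])
    show "pr1 C ?B T \<cdot> j \<cdot> pr1 C ?B T = pr1 C ?B T \<cdot> idt C (prd C ?B T)"
      using cmp_assoc[OF p1 j p1] p1j idt_left[OF p1] idt_right[OF p1] by simp
    show "pr2 C ?B T \<cdot> j \<cdot> pr1 C ?B T = pr2 C ?B T \<cdot> idt C (prd C ?B T)"
      using T1[OF cmp_hom[OF p2T cmp_hom[OF j p1]] cmp_hom[OF p2T idt_hom[OF prd_ob[OF B TO]]]] .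
  qed
  note cr = cross_hom[OF J s]
  have e: "e \<in> Hom C (prd C ?B T) ?A" unfolding e_def using cmp_hom[OF a cr] .
  have "e \<cdot> j = a \<cdot> pair C ?B ?B ?A (?J \<cdot> ?J) (s \<cdot> tB)"
    unfolding e_def using cmp_assoc[OF a cr j] cross_pair[OF J s J tB] j_def by simp
  also have "\<dots> = elt_mul C G ?B \<phi> (elt_unt C G ?B)"
    using a_pair[OF J cmp_hom[OF s tB]] idt_left[OF J] idt_right[OF \<phi>]
      elt_unt_cmp[OF unt_hom tB] unfolding s_def by simp
  also have "\<dots> = \<phi>" using elt_laws(2)[OF \<phi>] .
  finally have ej: "e \<cdot> j = \<phi>" .
  \<comment> \<open>\<open>e\<close> is the orbit map of the unit, \<open>j\<close> the isomorphism from \<open>K\<close> to \<open>K \<times> T\<close>.\<close>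
  have e\<phi>: "e = \<phi> \<cdot> pr1 C ?B T"
    using cmp_assoc[OF e j p1] ej jp1 idt_right[OF e] by simp
  have u: "u \<in> Hom C (prd C ?B P) (prd C ?B T)" and v: "v \<in> Hom C (prd C ?B P) (prd C ?B T)"
    and euv: "e \<cdot> u = e \<cdot> v"
    using co unfolding is_coequaliser_def by blast+
  have "is_coequaliser C (prd C ?B P) ?B (pr1 C ?B T \<cdot> u) (pr1 C ?B T \<cdot> v) ?A \<phi>"
    unfolding is_coequaliser_def
  proof (intro conjI allI impI cmp_hom[OF p1 u] cmp_hom[OF p1 v] \<phi>)
    show "\<phi> \<cdot> pr1 C ?B T \<cdot> u = \<phi> \<cdot> pr1 C ?B T \<cdot> v"
      using cmp_assoc[OF \<phi> p1 u] cmp_assoc[OF \<phi> p1 v] euv e\<phi> by simp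
    fix Z h assume h: "h \<in> Hom C ?B Z \<and> h \<cdot> pr1 C ?B T \<cdot> u = h \<cdot> pr1 C ?B T \<cdot> v"
    then have hh: "h \<in> Hom C ?B Z" by blast
    have "(h \<cdot> pr1 C ?B T) \<cdot> u = (h \<cdot> pr1 C ?B T) \<cdot> v"
      using cmp_assoc[OF hh p1 u] cmp_assoc[OF hh p1 v] h by simp
    then have ex: "\<exists>!w. w \<in> Hom C ?A Z \<and> w \<cdot> e = h \<cdot> pr1 C ?B T"
      using co cmp_hom[OF hh p1] unfolding is_coequaliser_def by blast
    have eqv: "w \<in> Hom C ?A Z \<and> w \<cdot> e = h \<cdot> pr1 C ?B T \<longleftrightarrow> w \<in> Hom C ?A Z \<and> w \<cdot> \<phi> = h" for w
    proof (cases "w \<in> Hom C ?A Z")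
      case True
      have "w \<cdot> \<phi> = h" if "w \<cdot> e = h \<cdot> pr1 C ?B T"
        using cmp_assoc[OF True e j] ej cmp_assoc[OF hh p1 j] p1j idt_right[OF hh] that by simp
      moreover have "w \<cdot> e = h \<cdot> pr1 C ?B T" if "w \<cdot> \<phi> = h"
        using cmp_assoc[OF True \<phi> p1] e\<phi> that by simp
      ultimately show ?thesis using True by blast
    qed blast
    show "\<exists>!w. w \<in> Hom C ?A Z \<and> w \<cdot> \<phi> = h" using ex unfolding eqv .
  qed
  then show ?thesis unfolding regular_epi_def by blast
qed

end

section \<open>The category of group objects\<close>

lemma Grp_cmp [simp]: "cmp (Grp C) = cmp C"
  and Grp_idt [simp]: "idt (Grp C) K = idt C (car K)"
  unfolding Grp_def by simp_all

lemma Grp_Hom_underlying: "f \<in> Hom (Grp C) H K \<Longrightarrow> f \<in> Hom C (car H) (car K)"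
  unfolding Grp_def by simp

lemma (in cartesian) Grp_idt_hom:
  assumes K: "K \<in> Ob (Grp C)"
  shows "idt (Grp C) K \<in> Hom (Grp C) K K"
proof -
  have G: "is_group_object C K" using K unfolding Grp_def by simp
  then have o: "car K \<in> Ob C" and m: "mul K \<in> Hom C (prd C (car K) (car K)) (car K)"
    unfolding group_object_iff by blast+
  note p = pr1_hom[OF o o] pr2_hom[OF o o] and I = idt_hom[OF o]
  have "cross C (car K) (car K) (car K) (car K) (idt C (car K)) (idt C (car K))
      = idt C (prd C (car K) (car K))"
    unfolding cross_def idt_left[OF p(1)] idt_left[OF p(2)]
    using pair_unique[OF idt_hom[OF prd_ob[OF o o]] o o] idt_right[OF p(1)] idt_right[OF p(2)] by simp
  then show ?thesis
    unfolding Grp_def using G I idt_left[OF m] idt_right[OF m] by simp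
qed

section \<open>Functions on the orbits of a connected graph\<close>

context G_graph
begin

text \<open>
  The condition on orbits and stabilisers in terms of elements: \<open>Y\<close> is the quotient of \<open>G \<times> R\<close> that
  identifies \<open>(x g, r)\<close> with \<open>(x, r)\<close> whenever \<open>g\<close> fixes \<open>s r\<close>. A function of the group component
  alone descends to \<open>Y\<close> when right multiplication by such \<open>g\<close> does not change it.
\<close>

lemma orbit_stabiliser_coequaliser:
  assumes OST: "OST C" and act: "is_action C G Y b"
    and q: "is_coequaliser C (prd C A Y) Y b (pr2 C A Y) R q"
    and s: "s \<in> Hom C R Y" "q \<cdot> s = idt C R"
    and S: "is_equaliser C (prd C A Y) Y b (pr2 C A Y) S k"
    and P: "is_pullback C S R Y (pr2 C A Y \<cdot> k) s P \<sigma> p"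
  defines "c \<equiv> b \<cdot> cross C A R A Y (idt C A) s"
    and "g \<equiv> ((pr1 C A Y \<cdot> k) \<cdot> \<sigma>) \<cdot> pr2 C A P"
  shows orbit_map_hom: "c \<in> Hom C (prd C A R) Y"
    and orbit_map_epi: "\<lbrakk>u \<in> Hom C Y Z; v \<in> Hom C Y Z; u \<cdot> c = v \<cdot> c\<rbrakk> \<Longrightarrow> u = v"
    and orbit_map_descends: "\<lbrakk>h \<in> Hom C A Z;
      h \<cdot> elt_mul C G (prd C A P) (pr1 C A P) g = h \<cdot> pr1 C A P\<rbrakk>
      \<Longrightarrow> \<exists>w. w \<in> Hom C Y Z \<and> w \<cdot> c = h \<cdot> pr1 C A R"
proof -
  let ?I = "idt C A" and ?W = "prd C A P"
  note I = idt_hom[OF car_ob]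
  define f2 where "f2 = cross C (prd C A A) Y A R (mul G) q \<cdot> assocl C A A Y
                    \<cdot> cross C A S A (prd C A Y) ?I k \<cdot> cross C A P A S ?I \<sigma>"
  have "G \<in> Ob (Grp C)" using G unfolding Grp_def by simp
  then have co: "is_coequaliser C ?W (prd C A R) (cross C A P A R ?I p) f2 Y c"
    using OST act q s S P unfolding OST_def Let_def f2_def c_def by blast
  show "c \<in> Hom C (prd C A R) Y" using co unfolding is_coequaliser_def by blast
  show "\<lbrakk>u \<in> Hom C Y Z; v \<in> Hom C Y Z; u \<cdot> c = v \<cdot> c\<rbrakk> \<Longrightarrow> u = v"
    using coequaliser_epi[OF co] .
  have qh: "q \<in> Hom C Y R" using q unfolding is_coequaliser_def by blast
  have o: "Y \<in> Ob C" "R \<in> Ob C" using hom_dom[OF qh] hom_cod[OF qh] .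
  have k: "k \<in> Hom C S (prd C A Y)" using S unfolding is_equaliser_def by blast
  have \<sigma>: "\<sigma> \<in> Hom C P S" and p: "p \<in> Hom C P R" using P unfolding is_pullback_def by blast+
  have Po: "P \<in> Ob C" using hom_dom[OF p] .
  note w1 = pr1_hom[OF car_ob Po] and w2 = pr2_hom[OF car_ob Po]
  note k\<sigma> = cmp_hom[OF k cmp_hom[OF \<sigma> w2]]
  note y1 = pr1_hom[OF car_ob o(1)] and y2 = pr2_hom[OF car_ob o(1)]
  define x where "x = pr2 C A Y \<cdot> k \<cdot> \<sigma> \<cdot> pr2 C A P"
  have g_eq: "g = pr1 C A Y \<cdot> k \<cdot> \<sigma> \<cdot> pr2 C A P"
    unfolding g_def using cmp_assoc[OF cmp_hom[OF y1 k] \<sigma> w2] cmp_assoc[OF y1 k cmp_hom[OF \<sigma> w2]]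
    by simp
  have g: "g \<in> Hom C ?W A" and x: "x \<in> Hom C ?W Y"
    unfolding g_eq x_def using cmp_hom[OF y1 k\<sigma>] cmp_hom[OF y2 k\<sigma>] .
  have gx: "k \<cdot> \<sigma> \<cdot> pr2 C A P = pair C ?W A Y g x"
    unfolding g_eq x_def using pair_eta[OF car_ob o(1) k\<sigma>] by simp
  have "cross C A S A (prd C A Y) ?I k \<cdot> cross C A P A S ?I \<sigma>
      = pair C ?W A (prd C A Y) (pr1 C A P) (pair C ?W A Y g x)"
    unfolding cross_def[of C A P A S]
    using cross_pair[OF I k cmp_hom[OF I w1] cmp_hom[OF \<sigma> w2]] idt_left[OF w1] gx by simp
  then have "f2 = cross C (prd C A A) Y A R (mul G) q \<cdot>
      pair C ?W (prd C A A) Y (pair C ?W A A (pr1 C A P) g) x"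
    unfolding f2_def using assocl_pair[OF w1 g x] by simp
  also have "\<dots> = pair C ?W A R (elt_mul C G ?W (pr1 C A P) g) (q \<cdot> x)"
    unfolding elt_mul_def using cross_pair[OF mul_hom qh pair_hom[OF w1 g] x] .
  finally have f2: "f2 = pair C ?W A R (elt_mul C G ?W (pr1 C A P) g) (q \<cdot> x)" .
  note m = elt_mul_hom[OF mul_hom w1 g] and qx = cmp_hom[OF qh x]
  have p1f2: "pr1 C A R \<cdot> f2 = elt_mul C G ?W (pr1 C A P) g"
    unfolding f2 using pr1_pair[OF m qx] .
  have f2h: "f2 \<in> Hom C ?W (prd C A R)" unfolding f2 using pair_hom[OF m qx] .
  note r1 = pr1_hom[OF car_ob o(2)] and cp = cross_hom[OF I p]
  assume h: "h \<in> Hom C A Z" and inv: "h \<cdot> elt_mul C G ?W (pr1 C A P) g = h \<cdot> pr1 C A P"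
  have "(h \<cdot> pr1 C A R) \<cdot> cross C A P A R ?I p = (h \<cdot> pr1 C A R) \<cdot> f2"
    using cmp_assoc[OF h r1 cp] cmp_assoc[OF h r1 f2h] p1f2 inv pr1_cross[OF I p] idt_left[OF w1]
    by simp
  then show "\<exists>w. w \<in> Hom C Y Z \<and> w \<cdot> c = h \<cdot> pr1 C A R"
    using co cmp_hom[OF h r1] unfolding is_coequaliser_def by blast
qed

end

context graph_of_stabilisers
begin

text \<open>
  \<open>P\<close> has its universal property among graphs, whereas the condition on orbits and stabilisers
  refers to equalisers and pullbacks in \<open>C\<close>. The gap is closed by assembling the pullbacks \<open>PE\<close> and
  \<open>PV\<close> on edges and on vertices into a graph: the boundary maps exist because the boundary maps of
  \<open>X\<close> are equivariant, and the resulting graph maps to \<open>P\<close> compatibly with the maps to \<open>G\<close>.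
\<close>

lemma vertex_stabilisers_lift:
  assumes SE: "is_equaliser C (prd C A (gE X)) (gE X) (fst a) (pr2 C A (gE X)) SE kE"
    and PE: "is_pullback C SE (gE Q) (gE X) (pr2 C A (gE X) \<cdot> kE) (fst s) PE \<sigma>E pE"
    and SV: "is_equaliser C (prd C A (gV X)) (gV X) (snd a) (pr2 C A (gV X)) SV kV"
    and PV: "is_pullback C SV (gV Q) (gV X) (pr2 C A (gV X) \<cdot> kV) (snd s) PV \<sigma>V pV"
  shows "\<exists>l. l \<in> Hom C PV (gV P) \<and> (pr1 C A (gV X) \<cdot> kV) \<cdot> \<sigma>V = snd \<delta> \<cdot> l"
proof -
  note oX = graph_edges_vertices_ob[OF X_ob] 
  note prE = prd_is_product[OF car_ob conjunct1[OF oX]]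
  note prV = prd_is_product[OF car_ob conjunct2[OF oX]]
  define \<gamma>E where "\<gamma>E = (pr1 C A (gE X) \<cdot> kE) \<cdot> \<sigma>E"
  define \<gamma>V where "\<gamma>V = (pr1 C A (gV X) \<cdot> kV) \<cdot> \<sigma>V"
  have kE: "kE \<in> Hom C SE (prd C A (gE X))" and kV: "kV \<in> Hom C SV (prd C A (gV X))"
    using SE SV unfolding is_equaliser_def by blast+
  have pE: "pE \<in> Hom C PE (gE Q)" "\<sigma>E \<in> Hom C PE SE" and pV: "pV \<in> Hom C PV (gV Q)" "\<sigma>V \<in> Hom C PV SV"
    using PE PV unfolding is_pullback_def by blast+
  note IE = idt_hom[OF hom_dom[OF pE(1)]] and IV = idt_hom[OF hom_dom[OF pV(1)]]
  have \<gamma>E: "\<gamma>E \<in> Hom C PE A"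
    unfolding \<gamma>E_def using cmp_hom[OF cmp_hom[OF pr1_hom[OF car_ob] kE] pE(2)] oX by blast
  have \<gamma>V: "\<gamma>V \<in> Hom C PV A"
    unfolding \<gamma>V_def using cmp_hom[OF cmp_hom[OF pr1_hom[OF car_ob] kV] pV(2)] oX by blast
  note s' = s[unfolded Graph_Hom Graph_Ob]
  have fxE: "fixing C (prd C A (gE X)) (pr1 C A (gE X)) (pr2 C A (gE X)) (fst a) PE \<gamma>E (fst s \<cdot> pE)"
    using pullback_stabiliser_fixing[OF prE SE PE IE] idt_right[OF \<gamma>E] idt_right[OF pE(1)]
    unfolding \<gamma>E_def by simp
  have fxV: "fixing C (prd C A (gV X)) (pr1 C A (gV X)) (pr2 C A (gV X)) (snd a) PV \<gamma>V (snd s \<cdot> pV)"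
    using pullback_stabiliser_fixing[OF prV SV PV IV] idt_right[OF \<gamma>V] idt_right[OF pV(1)]
    unfolding \<gamma>V_def by simp
  have "\<exists>d. d \<in> Hom C PE PV \<and> \<gamma>V \<cdot> d = \<gamma>E \<and> pV \<cdot> d = dQ \<cdot> pE"
    if dX: "dX \<in> Hom C (gE X) (gV X)" and dQ: "dQ \<in> Hom C (gE Q) (gV Q)"
      and ds: "dX \<cdot> fst s = snd s \<cdot> dQ"
      and da: "dX \<cdot> fst a = snd a \<cdot> cross C A (gE X) A (gV X) (idt C A) dX" for dX dQ
  proof -
    let ?c = "cross C A (gE X) A (gV X) (idt C A) dX"
    note I = idt_hom[OF car_ob]
    note c = cross_hom[OF I dX]
    obtain u where u: "u \<in> Hom C PE (prd C A (gE X))" "pr1 C A (gE X) \<cdot> u = \<gamma>E"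
      "pr2 C A (gE X) \<cdot> u = fst s \<cdot> pE" "fst a \<cdot> u = fst s \<cdot> pE"
      using fxE unfolding fixing_def by blast
    have sp: "dX \<cdot> fst s \<cdot> pE = snd s \<cdot> dQ \<cdot> pE"
      using cmp_assoc[OF dX _ pE(1), of "fst s"] cmp_assoc[OF _ dQ pE(1), of "snd s" "gV X"] s' ds
      by simp
    have p1: "pr1 C A (gV X) \<in> Hom C (prd C A (gV X)) A" "pr2 C A (gV X) \<in> Hom C (prd C A (gV X)) (gV X)"
      "pr1 C A (gE X) \<in> Hom C (prd C A (gE X)) A" "pr2 C A (gE X) \<in> Hom C (prd C A (gE X)) (gE X)"
      using pr1_hom[OF car_ob] pr2_hom[OF car_ob] oX by blast+
    have aE: "fst a \<in> Hom C (prd C A (gE X)) (gE X)" and aV: "snd a \<in> Hom C (prd C A (gV X)) (gV X)"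
      using SE SV unfolding is_equaliser_def by blast+
    have "pr1 C A (gV X) \<cdot> ?c \<cdot> u = \<gamma>E"
      using cmp_assoc[OF p1(1) c u(1)] pr1_cross[OF I dX] cmp_assoc[OF I p1(3) u(1)] u(2)
        idt_left[OF \<gamma>E] by simp
    moreover have "pr2 C A (gV X) \<cdot> ?c \<cdot> u = snd s \<cdot> dQ \<cdot> pE"
      using cmp_assoc[OF p1(2) c u(1)] pr2_cross[OF I dX] cmp_assoc[OF dX p1(4) u(1)] u(3) sp by simp
    moreover have "snd a \<cdot> ?c \<cdot> u = snd s \<cdot> dQ \<cdot> pE"
      using cmp_assoc[OF aV c u(1)] da cmp_assoc[OF dX aE u(1)] u(4) sp by simp
    ultimately have "fixing C (prd C A (gV X)) (pr1 C A (gV X)) (pr2 C A (gV X)) (snd a) PE \<gamma>E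
        (snd s \<cdot> dQ \<cdot> pE)"
      unfolding fixing_def using cmp_hom[OF c u(1)] by blast
    then show ?thesis
      using fixing_pullback_stabiliser[OF prV SV PV cmp_hom[OF dQ pE(1)]] unfolding \<gamma>V_def by blast
  qed
  note ex = this
  have da: "gd0 X \<cdot> fst a = snd a \<cdot> cross C A (gE X) A (gV X) (idt C A) (gd0 X)"
    "gd1 X \<cdot> fst a = snd a \<cdot> cross C A (gE X) A (gV X) (idt C A) (gd1 X)"
    using X unfolding is_G_graph_def by blast+
  obtain d0 where d0: "d0 \<in> Hom C PE PV" "\<gamma>V \<cdot> d0 = \<gamma>E" "pV \<cdot> d0 = gd0 Q \<cdot> pE"
    using ex[of "gd0 X" "gd0 Q"] s' da by blast
  obtain d1 where d1: "d1 \<in> Hom C PE PV" "\<gamma>V \<cdot> d1 = \<gamma>E" "pV \<cdot> d1 = gd1 Q \<cdot> pE"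
    using ex[of "gd1 X" "gd1 Q"] s' da by blast
  let ?Y = "\<lparr>gE = PE, gV = PV, gd0 = d0, gd1 = d1\<rparr>"
  have YO: "?Y \<in> Ob (Graph C)" unfolding Graph_Ob using d0 d1 by simp
  have g: "(\<gamma>E, \<gamma>V) \<in> Hom (Graph C) ?Y KG"
    unfolding const_graph_hom using YO car_ob \<gamma>E \<gamma>V d0 d1 by simp
  have y: "(pE, pV) \<in> Hom (Graph C) ?Y Q"
    unfolding Graph_Hom using YO Q_ob pE pV d0 d1 by simp
  have "fixes_elt ?Y (\<gamma>E, \<gamma>V) (s \<odot> (pE, pV))"
    unfolding fixes_elt_iff using g gcmp_hom[OF s y]
      fixing_elt_act[OF conjunct1[OF oX] car_ob fxE] fixing_elt_act[OF conjunct2[OF oX] car_ob fxV]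
    by simp
  then obtain l where l: "l \<in> Hom (Graph C) ?Y P" "\<delta> \<odot> l = (\<gamma>E, \<gamma>V)"
    using category.fixing_pullback_stabiliser[OF gcategory gtimes_product[OF car_ob X_ob]
      stabiliser pullback y] unfolding fixes_elt_def by blast
  have "snd l \<in> Hom C PV (gV P)" using l(1) unfolding Graph_Hom by simp
  moreover have "\<gamma>V = snd \<delta> \<cdot> snd l" using Graph_cmp(2)[of C \<delta> l] unfolding l(2) by simp
  ultimately show ?thesis unfolding \<gamma>V_def by blast
qed

text \<open>
  This is where connectedness enters. A function \<open>h\<close> on \<open>G\<close> that is invariant under right
  multiplication by the elements of the vertex stabilisers gives a function \<open>(g, v) \<mapsto> h g\<close> on
  \<open>G \<times> V Q\<close>, which descends to a function \<open>w\<close> on the vertices of \<open>X\<close> with \<open>w (g \<cdot> s v) = h g\<close>.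
  An edge \<open>g \<cdot> s e\<close> has the ends \<open>g \<cdot> s (d\<^sub>i e)\<close>, as \<open>s\<close> is a map of graphs, and \<open>w\<close> takes
  the value \<open>h g\<close> at both. Every edge is of this form, so \<open>w\<close> is constant along edges and, \<open>X\<close> being
  connected, factors through the point. Finally \<open>h\<close> itself is constant because
  \<open>G \<times> V X \<rightarrow> G \<times> T\<close> is an epimorphism, as the product of \<open>G\<close> with a coequaliser.
\<close>

lemma invariant_factors_through_point:
  assumes OST: "OST C" and ppc: "products_preserve_coequalisers C"
    and quotient: "is_coequaliser (Graph C) (gtimes C A X) X a (gpr2 C A X) Q q"
    and section_q: "q \<odot> s = idt (Graph C) Q"
    and T: "is_terminal C T" and conn: "is_coequaliser C (gE X) (gV X) (gd0 X) (gd1 X) T t"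
    and h: "h \<in> Hom C A Z" and tA: "tA \<in> Hom C A T"
    and inv: "\<And>Y g v. \<lbrakk>g \<in> Hom C Y A; v \<in> Hom C Y (gV P)\<rbrakk>
      \<Longrightarrow> h \<cdot> elt_mul C G Y g (snd \<delta> \<cdot> v) = h \<cdot> g"
  shows "\<exists>z. z \<in> Hom C T Z \<and> h = z \<cdot> tA"
proof -
  note X' = X_ob[unfolded Graph_Ob]
  have oX: "gE X \<in> Ob C" "gV X \<in> Ob C" using graph_edges_vertices_ob[OF X_ob] by blast+
  have oQ: "gE Q \<in> Ob C" "gV Q \<in> Ob C" using graph_edges_vertices_ob[OF Q_ob] by blast+
  note s' = s[unfolded Graph_Hom Graph_Ob]
  have T1: "\<And>Y f g. f \<in> Hom C Y T \<Longrightarrow> g \<in> Hom C Y T \<Longrightarrow> f = g" and TO: "T \<in> Ob C"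
    using T hom_dom unfolding is_terminal_def by blast+
  have qE: "is_coequaliser C (prd C A (gE X)) (gE X) (fst a) (pr2 C A (gE X)) (gE Q) (fst q)"
    using coequaliser_edges[OF quotient] by (simp add: gtimes_def gpr2_def)
  have qV: "is_coequaliser C (prd C A (gV X)) (gV X) (snd a) (pr2 C A (gV X)) (gV Q) (snd q)"
    using coequaliser_vertices[OF quotient] by (simp add: gtimes_def gpr2_def)
  have qs: "fst q \<cdot> fst s = idt C (gE Q)" "snd q \<cdot> snd s = idt C (gV Q)"
    using section_q Graph_cmp[of C q s] by simp_all
  have sE: "fst s \<in> Hom C (gE Q) (gE X)" and sV: "snd s \<in> Hom C (gV Q) (gV X)" using s' by blast+
  have aE: "fst a \<in> Hom C (prd C A (gE X)) (gE X)" and aV: "snd a \<in> Hom C (prd C A (gV X)) (gV X)"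
    and qVh: "snd q \<in> Hom C (gV X) (gV Q)"
    using qE qV unfolding is_coequaliser_def by blast+
  obtain SE kE where SE: "is_equaliser C (prd C A (gE X)) (gE X) (fst a) (pr2 C A (gE X)) SE kE"
    using finite_limits_equaliser[OF lim aE pr2_hom[OF car_ob oX(1)]] by blast
  then have kE: "kE \<in> Hom C SE (prd C A (gE X))" unfolding is_equaliser_def by blast
  obtain PE \<sigma>E pE where PE: "is_pullback C SE (gE Q) (gE X) (pr2 C A (gE X) \<cdot> kE) (fst s) PE \<sigma>E pE"
    using finite_limits_pullback[OF lim cmp_hom[OF pr2_hom[OF car_ob oX(1)] kE] sE] by blast
  obtain SV kV where SV: "is_equaliser C (prd C A (gV X)) (gV X) (snd a) (pr2 C A (gV X)) SV kV"
    using finite_limits_equaliser[OF lim aV pr2_hom[OF car_ob oX(2)]] by blast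
  then have kV: "kV \<in> Hom C SV (prd C A (gV X))" unfolding is_equaliser_def by blast
  obtain PV \<sigma>V pV where PV: "is_pullback C SV (gV Q) (gV X) (pr2 C A (gV X) \<cdot> kV) (snd s) PV \<sigma>V pV"
    using finite_limits_pullback[OF lim cmp_hom[OF pr2_hom[OF car_ob oX(2)] kV] sV] by blast
  have PVo: "PV \<in> Ob C" using PV hom_dom unfolding is_pullback_def by blast
  note I = idt_hom[OF car_ob]
  let ?I = "idt C A"
  define cE where "cE = fst a \<cdot> cross C A (gE Q) A (gE X) ?I (fst s)"
  define cV where "cV = snd a \<cdot> cross C A (gV Q) A (gV X) ?I (snd s)"
  have cE: "cE \<in> Hom C (prd C A (gE Q)) (gE X)"
    unfolding cE_def by (rule orbit_map_hom[OF OST act_E qE sE qs(1) SE PE])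
  have cE_epi: "u = v" if "u \<in> Hom C (gE X) Z" "v \<in> Hom C (gE X) Z" "u \<cdot> cE = v \<cdot> cE" for u v Z
    using orbit_map_epi[OF OST act_E qE sE qs(1) SE PE] that unfolding cE_def by blast
  have cV: "cV \<in> Hom C (prd C A (gV Q)) (gV X)"
    unfolding cV_def by (rule orbit_map_hom[OF OST act_V qV sV qs(2) SV PV])
  obtain l where l: "l \<in> Hom C PV (gV P)" "(pr1 C A (gV X) \<cdot> kV) \<cdot> \<sigma>V = snd \<delta> \<cdot> l"
    using vertex_stabilisers_lift[OF SE PE SV PV] by blast
  have \<delta>V: "snd \<delta> \<in> Hom C (gV P) A" using \<delta>_hom unfolding const_graph_hom by blast
  note w1 = pr1_hom[OF car_ob PVo] and w2 = pr2_hom[OF car_ob PVo]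
  have "h \<cdot> elt_mul C G (prd C A PV) (pr1 C A PV) (((pr1 C A (gV X) \<cdot> kV) \<cdot> \<sigma>V) \<cdot> pr2 C A PV)
      = h \<cdot> pr1 C A PV"
    unfolding l(2) cmp_assoc[OF \<delta>V l(1) w2] by (rule inv[OF w1 cmp_hom[OF l(1) w2]])
  then obtain w where w: "w \<in> Hom C (gV X) Z" and wc: "w \<cdot> cV = h \<cdot> pr1 C A (gV Q)"
    using orbit_map_descends[OF OST act_V qV sV qs(2) SV PV h] unfolding cV_def by blast
  note q1 = pr1_hom[OF car_ob oQ(2)] and e1 = pr1_hom[OF car_ob oQ(1)]
  have wd: "(w \<cdot> dX) \<cdot> cE = h \<cdot> pr1 C A (gE Q)"
    if dX: "dX \<in> Hom C (gE X) (gV X)" and dQ: "dQ \<in> Hom C (gE Q) (gV Q)"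
      and ds: "dX \<cdot> fst s = snd s \<cdot> dQ"
      and da: "dX \<cdot> fst a = snd a \<cdot> cross C A (gE X) A (gV X) ?I dX" for dX dQ
  proof -
    have "dX \<cdot> cE = (dX \<cdot> fst a) \<cdot> cross C A (gE Q) A (gE X) ?I (fst s)"
      unfolding cE_def using cmp_assoc[OF dX aE cross_hom[OF I sE]] by simp
    also have "\<dots> = snd a \<cdot> cross C A (gE X) A (gV X) ?I dX \<cdot> cross C A (gE Q) A (gE X) ?I (fst s)"
      unfolding da using cmp_assoc[OF aV cross_hom[OF I dX] cross_hom[OF I sE]] .
    also have "cross C A (gE X) A (gV X) ?I dX \<cdot> cross C A (gE Q) A (gE X) ?I (fst s)
        = cross C A (gV Q) A (gV X) ?I (snd s) \<cdot> cross C A (gE Q) A (gV Q) ?I dQ"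
      unfolding cross_cmp[OF I sE I dX] cross_cmp[OF I dQ I sV] ds ..
    also have "snd a \<cdot> \<dots> = cV \<cdot> cross C A (gE Q) A (gV Q) ?I dQ"
      unfolding cV_def using cmp_assoc[OF aV cross_hom[OF I sV] cross_hom[OF I dQ]] by simp
    finally have dc: "dX \<cdot> cE = cV \<cdot> cross C A (gE Q) A (gV Q) ?I dQ" .
    have "(w \<cdot> dX) \<cdot> cE = (h \<cdot> pr1 C A (gV Q)) \<cdot> cross C A (gE Q) A (gV Q) ?I dQ"
      using cmp_assoc[OF w dX cE] dc cmp_assoc[OF w cV cross_hom[OF I dQ]] wc by simp
    also have "\<dots> = h \<cdot> pr1 C A (gE Q)"
      using cmp_assoc[OF h q1 cross_hom[OF I dQ]] pr1_cross[OF I dQ] idt_left[OF e1] by simp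
    finally show ?thesis .
  qed
  have da: "gd0 X \<cdot> fst a = snd a \<cdot> cross C A (gE X) A (gV X) (idt C A) (gd0 X)"
    "gd1 X \<cdot> fst a = snd a \<cdot> cross C A (gE X) A (gV X) (idt C A) (gd1 X)"
    using X unfolding is_G_graph_def by blast+
  have "w \<cdot> gd0 X = w \<cdot> gd1 X"
  proof (rule cE_epi)
    show "w \<cdot> gd0 X \<in> Hom C (gE X) Z" "w \<cdot> gd1 X \<in> Hom C (gE X) Z"
      using cmp_hom[OF w] X' by blast+
    show "(w \<cdot> gd0 X) \<cdot> cE = (w \<cdot> gd1 X) \<cdot> cE"
      using wd[of "gd0 X" "gd0 Q"] wd[of "gd1 X" "gd1 Q"] s' da by simp
  qed
  then obtain z where z: "z \<in> Hom C T Z" and wz: "w = z \<cdot> t"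
    using conn w unfolding is_coequaliser_def by blast
  have t: "t \<in> Hom C (gV X) T" using conn unfolding is_coequaliser_def by blast
  note x1 = pr1_hom[OF car_ob oX(2)] and x2 = pr2_hom[OF car_ob oX(2)]
  note t1 = pr1_hom[OF car_ob TO] and t2 = pr2_hom[OF car_ob TO]
  note cq = cross_hom[OF I qVh] and ct = cross_hom[OF I t]
  have "h \<cdot> pr1 C A T = z \<cdot> pr2 C A T"
  proof (rule coequaliser_epi[OF ppc[unfolded products_preserve_coequalisers_def, rule_format,
          OF car_ob conn] cmp_hom[OF h t1] cmp_hom[OF z t2]])
    have "(h \<cdot> pr1 C A T) \<cdot> cross C A (gV X) A T ?I t = h \<cdot> pr1 C A (gV X)"
      using cmp_assoc[OF h t1 ct] pr1_cross[OF I t] idt_left[OF x1] by simp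
    also have "\<dots> = (h \<cdot> pr1 C A (gV Q)) \<cdot> cross C A (gV X) A (gV Q) ?I (snd q)"
      using cmp_assoc[OF h q1 cq] pr1_cross[OF I qVh] idt_left[OF x1] by simp
    also have "\<dots> = z \<cdot> t \<cdot> cV \<cdot> cross C A (gV X) A (gV Q) ?I (snd q)"
      unfolding wc[symmetric] wz
      using cmp_assoc[OF cmp_hom[OF z t] cV cq] cmp_assoc[OF z t cmp_hom[OF cV cq]] by simp
    also have "t \<cdot> cV \<cdot> cross C A (gV X) A (gV Q) ?I (snd q) = pr2 C A T \<cdot> cross C A (gV X) A T ?I t"
      by (rule T1[OF cmp_hom[OF t cmp_hom[OF cV cq]] cmp_hom[OF t2 ct]])
    also have "z \<cdot> \<dots> = (z \<cdot> pr2 C A T) \<cdot> cross C A (gV X) A T ?I t"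
      using cmp_assoc[OF z t2 ct] by simp
    finally show "(h \<cdot> pr1 C A T) \<cdot> cross C A (gV X) A T ?I t = (z \<cdot> pr2 C A T) \<cdot> cross C A (gV X) A T ?I t" .
  qed
  then have "(h \<cdot> pr1 C A T) \<cdot> pair C A A T ?I tA = (z \<cdot> pr2 C A T) \<cdot> pair C A A T ?I tA" by simp
  then have "h = z \<cdot> tA"
    using cmp_assoc[OF h t1 pair_hom[OF I tA]] cmp_assoc[OF z t2 pair_hom[OF I tA]]
      pr1_pair[OF I tA] pr2_pair[OF I tA] idt_right[OF h] by simp
  then show ?thesis using z by blast
qed

section \<open>The canonical map of the fundamental group\<close>

text \<open>
  Elements of the vertex stabilisers lie in the image of \<open>\<phi>\<close>. Functions on \<open>G\<close> that are invariant
  under left multiplication by this image are constant: composition with the inversion of \<open>G\<close> turns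
  left invariance into right invariance.
\<close>

lemma canonical_map_regular_epi:
  assumes OST: "OST C" and ppc: "products_preserve_coequalisers C"
    and quotient: "is_coequaliser (Graph C) (gtimes C A X) X a (gpr2 C A X) Q q"
    and section_q: "q \<odot> s = idt (Graph C) Q"
    and conn: "connected_graph C X"
    and f: "\<phi> \<in> Hom (Grp C) K G"
    and factor: "\<eta> \<in> Hom C (gV P) (car K)" "snd \<delta> = \<phi> \<cdot> \<eta>"
  shows "regular_epi C (car K) A \<phi>"
proof -
  obtain T t where T: "is_terminal C T"
    and Tt: "is_coequaliser C (gE X) (gV X) (gd0 X) (gd1 X) T t"
    using conn unfolding connected_graph_def by blast
  have T1: "\<And>Y f g. f \<in> Hom C Y T \<Longrightarrow> g \<in> Hom C Y T \<Longrightarrow> f = g"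
    using T hom_dom unfolding is_terminal_def by blast
  note \<phi> = Grp_hom_elt(2)[OF f]
  show ?thesis
  proof (rule regular_epi_if_transitive[OF OST T f])
    fix Z h tA
    assume h: "h \<in> Hom C A Z" and tA: "tA \<in> Hom C A T"
      and left: "\<And>Y b g. \<lbrakk>b \<in> Hom C Y (car K); g \<in> Hom C Y A\<rbrakk>
        \<Longrightarrow> h \<cdot> elt_mul C G Y (\<phi> \<cdot> b) g = h \<cdot> g"
    have "\<exists>z. z \<in> Hom C T Z \<and> h \<cdot> ivs G = z \<cdot> tA"
    proof (rule invariant_factors_through_point[OF OST ppc quotient section_q T Tt
          cmp_hom[OF h ivs_hom] tA])
      fix Y g v assume g: "g \<in> Hom C Y A" and v: "v \<in> Hom C Y (gV P)"
      define b where "b = \<eta> \<cdot> v"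
      have b: "b \<in> Hom C Y (car K)" unfolding b_def using cmp_hom[OF factor(1) v] .
      note x = cmp_hom[OF \<phi> b]
      have \<delta>v: "snd \<delta> \<cdot> v = \<phi> \<cdot> b"
        unfolding factor(2) b_def using cmp_assoc[OF \<phi> factor(1) v] .
      note gx = elt_mul_hom[OF mul_hom g x]
      define u where "u = ivs G \<cdot> elt_mul C G Y g (\<phi> \<cdot> b)"
      have u: "u \<in> Hom C Y A" unfolding u_def using cmp_hom[OF ivs_hom gx] .
      note xu = elt_mul_hom[OF mul_hom x u]
      note ig = cmp_hom[OF ivs_hom g]
      \<comment> \<open>For \<open>u = (g \<cdot> \<phi> b)\<^sup>-\<^sup>1\<close> the product \<open>\<phi> b \<cdot> u\<close> is \<open>g\<^sup>-\<^sup>1\<close>.\<close>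
      have "elt_mul C G Y g (elt_mul C G Y (\<phi> \<cdot> b) u) = elt_unt C G Y"
        using elt_assoc[OF g x u] elt_laws(4)[OF gx] unfolding u_def by simp
      then have "elt_mul C G Y (\<phi> \<cdot> b) u = ivs G \<cdot> g"
        using elt_assoc[OF ig g xu] elt_laws(3)[OF g] elt_laws(1)[OF xu] elt_laws(2)[OF ig] by simp
      then have "h \<cdot> u = h \<cdot> ivs G \<cdot> g" using left[OF b u] by simp
      then show "(h \<cdot> ivs G) \<cdot> elt_mul C G Y g (snd \<delta> \<cdot> v) = (h \<cdot> ivs G) \<cdot> g"
        unfolding \<delta>v using cmp_assoc[OF h ivs_hom gx] cmp_assoc[OF h ivs_hom g] u_def by simp
    qed
    then obtain z where z: "z \<in> Hom C T Z" "h \<cdot> ivs G = z \<cdot> tA" by blast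
    note I = idt_hom[OF car_ob]
    have "h = h \<cdot> ivs G \<cdot> ivs G"
      using elt_ivs_ivs[OF I] idt_right[OF ivs_hom] idt_right[OF h] by simp
    also have "\<dots> = z \<cdot> tA \<cdot> ivs G"
      using cmp_assoc[OF h ivs_hom ivs_hom] z(2) cmp_assoc[OF z(1) tA ivs_hom] by simp
    also have "tA \<cdot> ivs G = tA" by (rule T1[OF cmp_hom[OF tA ivs_hom] tA])
    finally show "\<exists>z. z \<in> Hom C T Z \<and> h = z \<cdot> tA" using z(1) by blast
  qed
qed

end

theorem theorem3p8:
  fixes C :: "('o, 'm) cat"
    and G :: "('o, 'm) grpobj"
    and X Q S P :: "('o, 'm) graph"
    and a q s k \<sigma> p :: "'m \<times> 'm"
    and colim :: "((('o, 'm) graph \<times> ('m \<times> 'm), 'm \<times> 'm) grpobj, 'm \<times> 'm,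
                   ('o, 'm) grpobj, 'm) fnctor"
    and \<Phi> :: "(('o, 'm) graph \<times> ('m \<times> 'm), 'm \<times> 'm) grpobj \<Rightarrow> ('o, 'm) grpobj \<Rightarrow> 'm \<Rightarrow> 'm \<times> 'm"
  assumes "category C" and "has_finite_limits C" and "has_coequalisers C"
    and "products_preserve_coequalisers C"
    and "OST C"
    and "G \<in> Ob (Grp C)"
    and "is_G_graph C G X a"
    and quotient: "is_coequaliser (Graph C) (gtimes C (car G) X) X a (gpr2 C (car G) X) Q q"
    and s: "s \<in> Hom (Graph C) Q X" "q \<cdot>\<^bsub>Graph C\<^esub> s = idt (Graph C) Q"
    and stabiliser: "is_equaliser (Graph C) (gtimes C (car G) X) X a (gpr2 C (car G) X) S k"
    and pullback: "is_pullback (Graph C) S Q X (gpr2 C (car G) X \<cdot>\<^bsub>Graph C\<^esub> k) s P \<sigma> p"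
    and "sG = pullback_grp (Graph C) Q X s (stabiliser_grp C G X S k) P \<sigma> p"
    and "adjunction (Grp (slice (Graph C) Q)) (Grp C) colim (Delta C Q) \<Phi>"
    and "\<pi> = FO colim sG"
    and "\<phi> = adjoint_arrow (Grp C) colim \<Phi> sG G
               (gcross C (car G) X (car G) Q (idt C (car G)) q \<cdot>\<^bsub>Graph C\<^esub> k \<cdot>\<^bsub>Graph C\<^esub> \<sigma>)"
    and "connected_graph C X"
  shows "regular_epi C (car \<pi>) (car G) \<phi>"
proof -
  interpret graph_of_stabilisers C G X a S k Q P s \<sigma> p
  proof (intro graph_of_stabilisers.intro G_graph_stabiliser.intro G_graph.intro
      group_in_category.intro finitely_complete.intro finitely_complete_axioms.intro
      group_in_category_axioms.intro G_graph_axioms.intro G_graph_stabiliser_axioms.intro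
      graph_of_stabilisers_axioms.intro)
    show "is_group_object C G" using assms(6) unfolding Grp_def by simp
  qed (fact assms)+
  let ?D = "Grp (slice (Graph C) Q)"
  have colim: "is_functor ?D (Grp C) colim"
    and bij: "\<And>H K. H \<in> Ob ?D \<Longrightarrow> K \<in> Ob (Grp C) \<Longrightarrow>
      bij_betw (\<Phi> H K) (Hom (Grp C) (FO colim H) K) (Hom ?D H (FO (Delta C Q) K))"
    and nat: "\<And>H H' K K' u v f. u \<in> Hom ?D H' H \<Longrightarrow> v \<in> Hom (Grp C) K K' \<Longrightarrow>
      f \<in> Hom (Grp C) (FO colim H) K \<Longrightarrow>
      \<Phi> H' K' (v \<cdot>\<^bsub>Grp C\<^esub> f \<cdot>\<^bsub>Grp C\<^esub> FM colim H' H u) =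
        FM (Delta C Q) K K' v \<cdot>\<^bsub>?D\<^esub> \<Phi> H K f \<cdot>\<^bsub>?D\<^esub> u"
    using assms(14) unfolding adjunction_def by blast+
  note sGO = sG_group_object
  have sG: "sG = pullback_grp (Graph C) Q X s (stabiliser_grp C G X S k) P \<sigma> p" by (rule assms)
  have qh: "q \<in> Hom (Graph C) X Q" using quotient unfolding is_coequaliser_def by blast
  let ?\<psi> = "gcross C (car G) X (car G) Q (idt C (car G)) q \<odot> k \<odot> \<sigma>"
  have \<psi>: "?\<psi> \<in> Hom ?D sG (FO (Delta C Q) G)" "gpr1 C (car G) Q \<odot> ?\<psi> = \<delta>"
    using stabiliser_inclusion_hom[OF qh assms(10)] gpr1_stabiliser_inclusion[OF qh assms(10)]
    unfolding sG by blast+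
  have b: "bij_betw (\<Phi> sG G) (Hom (Grp C) \<pi> G) (Hom ?D sG (FO (Delta C Q) G))"
    using bij[OF sGO assms(6)] unfolding assms(15) sG .
  have \<phi>: "\<phi> \<in> Hom (Grp C) \<pi> G" and \<Phi>\<phi>: "\<Phi> sG G \<phi> = ?\<psi>"
    using \<psi>(1) b f_the_inv_into_f_bij_betw[OF b] the_inv_into_into[of "\<Phi> sG G" "Hom (Grp C) \<pi> G" ?\<psi>]
    unfolding assms(16) adjoint_arrow_def assms(15) bij_betw_def by auto
  have \<pi>O: "\<pi> \<in> Ob (Grp C)" using \<phi> unfolding Grp_def by simp
  interpret D: cartesian "slice (Graph C) Q" using lim Q_ob by (rule Graph_slice_cartesian)
  have idS: "idt ?D sG \<in> Hom ?D sG sG" using D.Grp_idt_hom sGO unfolding sG by blast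
  have id\<pi>: "idt (Grp C) \<pi> \<in> Hom (Grp C) \<pi> \<pi>" using Grp_idt_hom[OF \<pi>O] .
  have Fid: "FM colim sG sG (idt ?D sG) = idt (Grp C) \<pi>"
    using colim sGO unfolding is_functor_def sG assms(15) by blast
  define \<eta> where "\<eta> = \<Phi> sG \<pi> (idt (Grp C) \<pi>)"
  have "bij_betw (\<Phi> sG \<pi>) (Hom (Grp C) \<pi> \<pi>) (Hom ?D sG (FO (Delta C Q) \<pi>))"
    using bij[OF sGO \<pi>O] unfolding assms(15) sG .
  then have \<eta>: "\<eta> \<in> Hom ?D sG (FO (Delta C Q) \<pi>)"
    unfolding \<eta>_def using id\<pi> bij_betwE by blast
  have car_sG: "car sG = (P, p)" unfolding sG pullback_grp_def Let_def by simp
  have car_D: "car (FO (Delta C Q) \<pi>) = (gtimes C (car \<pi>) Q, gpr2 C (car \<pi>) Q)"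
    unfolding Delta_def induced_grp_def Let_def by simp
  have \<eta>h: "\<eta> \<in> Hom (Graph C) P (gtimes C (car \<pi>) Q)"
    using over_hom[OF Grp_Hom_underlying[OF \<eta>]] unfolding car_sG car_D by simp
  then have \<eta>V: "snd \<eta> \<in> Hom C (gV P) (prd C (car \<pi>) (gV Q))"
    unfolding Graph_Hom gtimes_def by simp
  have \<phi>h: "\<phi> \<in> Hom C (car \<pi>) (car G)" using Grp_Hom_underlying[OF \<phi>] .
  have "\<phi> \<cdot>\<^bsub>Grp C\<^esub> idt (Grp C) \<pi> \<cdot>\<^bsub>Grp C\<^esub> idt (Grp C) \<pi> = \<phi>"
    using idt_right[OF \<phi>h] idt_right[OF idt_hom[OF hom_dom[OF \<phi>h]]] by simp
  \<comment> \<open>By naturality the embedding \<open>\<psi>\<close> factors as \<open>\<Delta> \<phi>\<close> after the unit \<open>\<eta>\<close> of the adjunction.\<close>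
  then have "?\<psi> = FM (Delta C Q) \<pi> G \<phi> \<odot> \<eta> \<odot> idt (Graph C) P"
    using nat[OF idS \<phi>, of "idt (Grp C) \<pi>"] id\<pi> \<Phi>\<phi> Fid
    unfolding \<eta>_def by (simp add: assms(15)[symmetric] car_sG)
  also have "\<eta> \<odot> idt (Graph C) P = \<eta>" using gidt_right[OF \<eta>h] .
  finally have \<psi>V: "snd ?\<psi> = cross C (car \<pi>) (gV Q) (car G) (gV Q) \<phi> (idt C (gV Q)) \<cdot>\<^bsub>C\<^esub> snd \<eta>"
    unfolding Delta_def gcross_def by simp
  have Qo: "gV Q \<in> Ob C" using graph_edges_vertices_ob[OF Q_ob] by blast
  note p1 = pr1_hom[OF hom_dom[OF \<phi>h] Qo] and p1G = pr1_hom[OF car_ob Qo]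
  note c = cross_hom[OF \<phi>h idt_hom[OF Qo]]
  have "snd \<delta> = pr1 C (car G) (gV Q) \<cdot>\<^bsub>C\<^esub> snd ?\<psi>"
    unfolding \<psi>(2)[symmetric] by (simp add: gpr1_def)
  also have "\<dots> = \<phi> \<cdot>\<^bsub>C\<^esub> pr1 C (car \<pi>) (gV Q) \<cdot>\<^bsub>C\<^esub> snd \<eta>"
    unfolding \<psi>V using cmp_assoc[OF p1G c \<eta>V] pr1_cross[OF \<phi>h idt_hom[OF Qo]]
      cmp_assoc[OF \<phi>h p1 \<eta>V] by simp
  finally have "snd \<delta> = \<phi> \<cdot>\<^bsub>C\<^esub> pr1 C (car \<pi>) (gV Q) \<cdot>\<^bsub>C\<^esub> snd \<eta>" .
  then show ?thesis
    using canonical_map_regular_epi[OF assms(5,4) quotient assms(10) assms(17) \<phi> cmp_hom[OF p1 \<eta>V]]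
    by blast
qed

end
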